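(* Let $(M,g_{\mu\nu})$ be a 4-dimensional spacetime and let $P\subset M$ be a future converging achronal spacelike submanifold of codimension $2$, with mean normal curvature vector field $H^\mu=H\hat H^\mu$, where $\hat H^\mu$ is a future-pointing timelike unit vector. Let $\ell,\ell_0>0$ and let $\gamma:[-\ell_0,\ell]\to M$ be a future-directed null geodesic meeting $P$ normally at $\gamma(0)\in P$, with affine parameter $\lambda$ normalized so that $\hat H_\mu\, d\gamma^\mu/d\lambda=1$, where $\hat H_\mu$ is extended along $\gamma$ by parallel transport. Let $\rho(\lambda)=R_{kk}(\gamma(\lambda))=R_{\mu\nu}k^\mu k^\nu$ with $k^\mu=d\gamma^\mu/d\lambda$, and let $\rho_{\max}=\max_{[-\ell_0,0]}\rho$. Let $B>0$ and $Q_1=32\pi B$, and suppose that $$\int_{-\ell_0}^{\ell} g(\lambda)^2\rho(\lambda)\,d\lambda\;\ge\;-Q_1\int_{-\ell_0}^{\ell} g'(\lambda)^2\,d\lambda$$ for every real-valued $C^1$ function $g$ with compact support in $(-\ell_0,\ell)$. Define $$\hat L_1(\ell')=\frac{Q_1+2}{\ell'},\qquad \hat L_2(\ell_0')=\frac{Q_1}{\ell_0'}+\frac13\rho_{\max}\,\ell_0',$$ $$L_1(\ell)=\min_{\ell'\in(0,\ell]}\hat L_1(\ell'),\qquad L_2(\ell_0)=\min_{\ell_0'\in(0,\ell_0]}\hat L_2(\ell_0').$$ If $-2H|_{\gamma(0)}\ge L_1(\ell)+L_2(\ell_0)$, then there is a focal point to $P$ along $\gamma$ in $[0,\ell]$.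
   Context: Conventions: metric signature is $(+,-,-,-)$, and the Ricci tensor sign is such that Einstein's equation reads $G_{\mu\nu}=8\pi G_N T_{\mu\nu}$ and the Raychaudhuri equation for a twist-free null congruence reads $d\theta/d\lambda=-\tfrac12\theta^2-\sigma_{ab}\sigma^{ab}-R_{kk}$. Mean normal curvature: $H^\mu=\frac12\sum_{i=1}^{2}\mathrm{II}(e_i,e_i)^\mu$, where $e_1,e_2$ is a local orthonormal frame of $TP$ (so $g(e_i,e_i)=-1$) and $\mathrm{II}(V,W)=(\nabla_VW)^{\perp}$ is the second fundamental form. $P$ is future converging if $H^\mu$ is everywhere past-pointing timelike; hence $H<0$ when one writes $H^\mu=H\hat H^\mu$ with $\hat H^\mu$ future-pointing timelike unit. With the normalization $\hat H_\mu k^\mu=1$, the initial expansion at $\gamma(0)$ of the null geodesic congruence normal to $P$ containing $\gamma$ is $\theta(0)=2H|_{\gamma(0)}$. A focal point to $P$ along $\gamma$ is a point $\gamma(\lambda)$, $\lambda>0$, at which some nontrivial $P$-Jacobi field along $\gamma$ vanishes. The integral inequality assumed on $\rho$ is the geometric form (via the semiclassical Einstein equation $8\pi G_N\langle T_{\mu\nu}\rangle=G_{\mu\nu}$) of the smeared null energy condition $\int g^2\langle T_{kk}\rangle d\lambda\ge-\frac{4B}{G_N}\int (g')^2d\lambda$. *)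

theory Defs
  imports "HOL-Analysis.Analysis"
begin

section \<open>Smooth functions on open sets\<close>

primrec Ck_on :: "nat \<Rightarrow> ('a::real_normed_vector \<Rightarrow> 'b::real_normed_vector) \<Rightarrow> 'a set \<Rightarrow> bool" where
  "Ck_on 0 f S \<longleftrightarrow> continuous_on S f"
| "Ck_on (Suc k) f S \<longleftrightarrow>
     f differentiable_on S \<and> (\<forall>v. Ck_on k (\<lambda>x. frechet_derivative f (at x) v) S)"

(* Only used for open S. *)
definition smooth_on :: "('a::real_normed_vector \<Rightarrow> 'b::real_normed_vector) \<Rightarrow> 'a set \<Rightarrow> bool" where
  "smooth_on f S \<longleftrightarrow> (\<forall>k. Ck_on k f S)"


section \<open>Charts, tangent vectors and spacetimes\<close>

(* A chart is a pair (U, phi); the values of phi outside U play no role. *)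
type_synonym 'a chart = "'a set \<times> ('a \<Rightarrow> real^4)"

(* A tangent vector is represented by the family of its component vectors in the charts;
   see tangent_space for the transformation law. *)
type_synonym 'a tvec = "'a chart \<Rightarrow> real^4"

(* The underlying point set and topology of the manifold are those of the type 'a. *)
record 'a lorentz_structure =
  atlas :: "'a chart set"
  metric :: "'a \<Rightarrow> 'a tvec \<Rightarrow> 'a tvec \<Rightarrow> real"
  time_field :: "'a \<Rightarrow> 'a tvec"

abbreviation chart_dom :: "'a chart \<Rightarrow> 'a set" where
  "chart_dom c \<equiv> fst c"

abbreviation chart_map :: "'a chart \<Rightarrow> 'a \<Rightarrow> real^4" where
  "chart_map c \<equiv> snd c"

definition chart_inv :: "'a chart \<Rightarrow> real^4 \<Rightarrow> 'a" where
  "chart_inv c = inv_into (chart_dom c) (chart_map c)"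

definition is_chart :: "'a::topological_space chart \<Rightarrow> bool" where
  "is_chart c \<longleftrightarrow> open (chart_dom c) \<and> open (chart_map c ` chart_dom c) \<and>
     homeomorphism (chart_dom c) (chart_map c ` chart_dom c) (chart_map c) (chart_inv c)"

definition compatible :: "'a chart \<Rightarrow> 'a chart \<Rightarrow> bool" where
  "compatible c d \<longleftrightarrow>
     smooth_on (chart_map d \<circ> chart_inv c) (chart_map c ` (chart_dom c \<inter> chart_dom d)) \<and>
     smooth_on (chart_map c \<circ> chart_inv d) (chart_map d ` (chart_dom c \<inter> chart_dom d))"

definition maximal_smooth_atlas :: "'a::topological_space chart set \<Rightarrow> bool" where
  "maximal_smooth_atlas A \<longleftrightarrow>
     (\<forall>c\<in>A. is_chart c) \<and> (\<Union>c\<in>A. chart_dom c) = UNIV \<and>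
     (\<forall>c\<in>A. \<forall>d\<in>A. compatible c d) \<and>
     (\<forall>c. is_chart c \<and> (\<forall>d\<in>A. compatible c d) \<longrightarrow> c \<in> A)"

definition charts_at :: "'a lorentz_structure \<Rightarrow> 'a \<Rightarrow> 'a chart set" where
  "charts_at M p = {c \<in> atlas M. p \<in> chart_dom c}"

definition zero_tvec :: "'a tvec" where
  "zero_tvec = (\<lambda>_. 0)"

(* The convention that components vanish for charts not around p makes the representation of a
   tangent vector unique. *)
definition tangent_space :: "'a lorentz_structure \<Rightarrow> 'a \<Rightarrow> 'a tvec set" where
  "tangent_space M p =
     {v. (\<forall>c. c \<notin> charts_at M p \<longrightarrow> v c = 0) \<and>
         (\<forall>c\<in>charts_at M p. \<forall>d\<in>charts_at M p.
            v d = frechet_derivative (chart_map d \<circ> chart_inv c) (at (chart_map c p)) (v c))}"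

(* The tangent vector at p whose components in the chart c are x. *)
definition tvec_of_components :: "'a lorentz_structure \<Rightarrow> 'a chart \<Rightarrow> 'a \<Rightarrow> real^4 \<Rightarrow> 'a tvec" where
  "tvec_of_components M c p x =
     (\<lambda>d. if d \<in> charts_at M p
          then frechet_derivative (chart_map d \<circ> chart_inv c) (at (chart_map c p)) x else 0)"

definition smooth_vector_field_on ::
    "'a lorentz_structure \<Rightarrow> 'a set \<Rightarrow> ('a \<Rightarrow> 'a tvec) \<Rightarrow> bool" where
  "smooth_vector_field_on M U W \<longleftrightarrow>
     (\<forall>p\<in>U. W p \<in> tangent_space M p) \<and>
     (\<forall>c\<in>atlas M. smooth_on (\<lambda>q. W (chart_inv c q) c) (chart_map c ` (chart_dom c \<inter> U)))"

(* g(x^i d_i, y^j d_j) at the point with coordinates q in the chart c. *)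
definition metric_coord ::
    "'a lorentz_structure \<Rightarrow> 'a chart \<Rightarrow> real^4 \<Rightarrow> real^4 \<Rightarrow> real^4 \<Rightarrow> real" where
  "metric_coord M c q x y =
     (let p = chart_inv c q
      in metric M p (tvec_of_components M c p x) (tvec_of_components M c p y))"

definition lorentzian_metric :: "'a lorentz_structure \<Rightarrow> bool" where
  "lorentzian_metric M \<longleftrightarrow>
     (\<forall>p. \<forall>u\<in>tangent_space M p. \<forall>v\<in>tangent_space M p. metric M p u v = metric M p v u) \<and>
     (\<forall>p. \<forall>u\<in>tangent_space M p. \<forall>v\<in>tangent_space M p. \<forall>w\<in>tangent_space M p. \<forall>a.
        metric M p (\<lambda>c. a *\<^sub>R u c + v c) w = a * metric M p u w + metric M p v w) \<and>
     (\<forall>p. \<exists>e :: 4 \<Rightarrow> 'a tvec. (\<forall>i. e i \<in> tangent_space M p) \<and>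
        (\<forall>i j. metric M p (e i) (e j) = (if i \<noteq> j then 0 else if i = 0 then 1 else - 1))) \<and>
     (\<forall>c\<in>atlas M. \<forall>x y. smooth_on (\<lambda>q. metric_coord M c q x y) (chart_map c ` chart_dom c))"

(* Connected, Hausdorff, second countable, time-oriented smooth Lorentzian 4-manifold of
   signature (+,-,-,-); the time orientation is given by a smooth timelike vector field. *)
definition spacetime ::
    "'a::{t2_space, second_countable_topology} lorentz_structure \<Rightarrow> bool" where
  "spacetime M \<longleftrightarrow>
     connected (UNIV :: 'a set) \<and> maximal_smooth_atlas (atlas M) \<and> lorentzian_metric M \<and>
     smooth_vector_field_on M UNIV (time_field M) \<and>
     (\<forall>p. metric M p (time_field M p) (time_field M p) > 0)"

definition future_timelike :: "'a lorentz_structure \<Rightarrow> 'a \<Rightarrow> 'a tvec \<Rightarrow> bool" where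
  "future_timelike M p v \<longleftrightarrow>
     v \<in> tangent_space M p \<and> metric M p v v > 0 \<and> metric M p (time_field M p) v > 0"

definition past_timelike :: "'a lorentz_structure \<Rightarrow> 'a \<Rightarrow> 'a tvec \<Rightarrow> bool" where
  "past_timelike M p v \<longleftrightarrow>
     v \<in> tangent_space M p \<and> metric M p v v > 0 \<and> metric M p (time_field M p) v < 0"

(* The last condition excludes v = 0. *)
definition future_null :: "'a lorentz_structure \<Rightarrow> 'a \<Rightarrow> 'a tvec \<Rightarrow> bool" where
  "future_null M p v \<longleftrightarrow>
     v \<in> tangent_space M p \<and> metric M p v v = 0 \<and> metric M p (time_field M p) v > 0"


section \<open>Levi-Civita connection and curvature\<close>

definition metric_matrix :: "'a lorentz_structure \<Rightarrow> 'a chart \<Rightarrow> real^4 \<Rightarrow> real^4^4" where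
  "metric_matrix M c q = (\<chi> i j. metric_coord M c q (axis i 1) (axis j 1))"

(* The vector with components Gamma^k_{ij} x^i y^j at the point with coordinates q, where
   Gamma^k_{ij} = g^{kl} (d_i g_{jl} + d_j g_{il} - d_l g_{ij}) / 2. *)
definition christoffel ::
    "'a lorentz_structure \<Rightarrow> 'a chart \<Rightarrow> real^4 \<Rightarrow> real^4 \<Rightarrow> real^4 \<Rightarrow> real^4" where
  "christoffel M c q x y =
     matrix_inv (metric_matrix M c q) *v
       (\<chi> l. (frechet_derivative (\<lambda>r. metric_coord M c r y (axis l 1)) (at q) x
            + frechet_derivative (\<lambda>r. metric_coord M c r x (axis l 1)) (at q) y
            - frechet_derivative (\<lambda>r. metric_coord M c r x y) (at q) (axis l 1)) / 2)"

(* Components in the chart c of R(x,y)z, with the sign convention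
   R(X,Y)Z = nabla_X nabla_Y Z - nabla_Y nabla_X Z - nabla_[X,Y] Z. *)
definition riemann_coord ::
    "'a lorentz_structure \<Rightarrow> 'a chart \<Rightarrow> real^4 \<Rightarrow> real^4 \<Rightarrow> real^4 \<Rightarrow> real^4 \<Rightarrow> real^4" where
  "riemann_coord M c q x y z =
     frechet_derivative (\<lambda>r. christoffel M c r y z) (at q) x
     - frechet_derivative (\<lambda>r. christoffel M c r x z) (at q) y
     + christoffel M c q x (christoffel M c q y z)
     - christoffel M c q y (christoffel M c q x z)"

definition riemann ::
    "'a lorentz_structure \<Rightarrow> 'a \<Rightarrow> 'a tvec \<Rightarrow> 'a tvec \<Rightarrow> 'a tvec \<Rightarrow> 'a tvec" where
  "riemann M p X Y Z =
     (\<lambda>c. if c \<in> charts_at M p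
          then riemann_coord M c (chart_map c p) (X c) (Y c) (Z c) else 0)"

(* Ric(Y,Z) is the trace of X |-> R(X,Y)Z; the chart used to compute the trace is immaterial.
   With this sign the Raychaudhuri equation reads theta' = -theta^2/2 - sigma^2 - Ric(k,k), and
   Einstein's equation reads G = 8 pi G_N T (Ric with lower indices is unchanged by g |-> -g). *)
definition ricci :: "'a lorentz_structure \<Rightarrow> 'a \<Rightarrow> 'a tvec \<Rightarrow> 'a tvec \<Rightarrow> real" where
  "ricci M p Y Z =
     (let c = (SOME c. c \<in> charts_at M p)
      in trace (matrix (\<lambda>x. riemann_coord M c (chart_map c p) x (Y c) (Z c))))"

(* nabla_v W at p, for a tangent vector v at p and a vector field W defined near p. *)
definition nabla :: "'a lorentz_structure \<Rightarrow> 'a \<Rightarrow> 'a tvec \<Rightarrow> ('a \<Rightarrow> 'a tvec) \<Rightarrow> 'a tvec" where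
  "nabla M p v W =
     (\<lambda>c. if c \<in> charts_at M p
          then frechet_derivative (\<lambda>q. W (chart_inv c q) c) (at (chart_map c p)) (v c)
               + christoffel M c (chart_map c p) (v c) (W p c)
          else 0)"


section \<open>Curves and vector fields along curves\<close>

text \<open>Curves are defined on an interval I with more than one point; derivatives at its endpoints
  are one-sided.\<close>

definition velocity :: "'a lorentz_structure \<Rightarrow> real set \<Rightarrow> (real \<Rightarrow> 'a) \<Rightarrow> real \<Rightarrow> 'a tvec" where
  "velocity M I \<gamma> t =
     (\<lambda>c. if c \<in> charts_at M (\<gamma> t)
          then vector_derivative (chart_map c \<circ> \<gamma>) (at t within I) else 0)"

definition differentiable_curve ::
    "'a::topological_space lorentz_structure \<Rightarrow> real set \<Rightarrow> (real \<Rightarrow> 'a) \<Rightarrow> bool" where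
  "differentiable_curve M I \<gamma> \<longleftrightarrow>
     continuous_on I \<gamma> \<and>
     (\<forall>t\<in>I. \<forall>c\<in>charts_at M (\<gamma> t). (chart_map c \<circ> \<gamma>) differentiable (at t within I))"

definition C1_curve ::
    "'a::topological_space lorentz_structure \<Rightarrow> real set \<Rightarrow> (real \<Rightarrow> 'a) \<Rightarrow> bool" where
  "C1_curve M I \<gamma> \<longleftrightarrow>
     differentiable_curve M I \<gamma> \<and>
     (\<forall>c\<in>atlas M. continuous_on {t \<in> I. \<gamma> t \<in> chart_dom c} (\<lambda>t. velocity M I \<gamma> t c))"

definition differentiable_field_along ::
    "'a lorentz_structure \<Rightarrow> real set \<Rightarrow> (real \<Rightarrow> 'a) \<Rightarrow> (real \<Rightarrow> 'a tvec) \<Rightarrow> bool" where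
  "differentiable_field_along M I \<gamma> V \<longleftrightarrow>
     (\<forall>t\<in>I. V t \<in> tangent_space M (\<gamma> t)) \<and>
     (\<forall>t\<in>I. \<forall>c\<in>charts_at M (\<gamma> t). (\<lambda>s. V s c) differentiable (at t within I))"

definition cov_deriv_along ::
    "'a lorentz_structure \<Rightarrow> real set \<Rightarrow> (real \<Rightarrow> 'a) \<Rightarrow> (real \<Rightarrow> 'a tvec) \<Rightarrow> real \<Rightarrow> 'a tvec" where
  "cov_deriv_along M I \<gamma> V t =
     (\<lambda>c. if c \<in> charts_at M (\<gamma> t)
          then vector_derivative (\<lambda>s. V s c) (at t within I)
               + christoffel M c (chart_map c (\<gamma> t)) (velocity M I \<gamma> t c) (V t c)
          else 0)"

definition parallel_along ::
    "'a lorentz_structure \<Rightarrow> real set \<Rightarrow> (real \<Rightarrow> 'a) \<Rightarrow> (real \<Rightarrow> 'a tvec) \<Rightarrow> bool" where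
  "parallel_along M I \<gamma> V \<longleftrightarrow>
     differentiable_field_along M I \<gamma> V \<and> (\<forall>t\<in>I. cov_deriv_along M I \<gamma> V t = zero_tvec)"

(* Affinely parametrised. *)
definition geodesic ::
    "'a::topological_space lorentz_structure \<Rightarrow> real set \<Rightarrow> (real \<Rightarrow> 'a) \<Rightarrow> bool" where
  "geodesic M I \<gamma> \<longleftrightarrow>
     differentiable_curve M I \<gamma> \<and> parallel_along M I \<gamma> (velocity M I \<gamma>)"

definition future_null_geodesic ::
    "'a::topological_space lorentz_structure \<Rightarrow> real set \<Rightarrow> (real \<Rightarrow> 'a) \<Rightarrow> bool" where
  "future_null_geodesic M I \<gamma> \<longleftrightarrow>
     geodesic M I \<gamma> \<and> (\<forall>t\<in>I. future_null M (\<gamma> t) (velocity M I \<gamma> t))"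

definition jacobi_field ::
    "'a lorentz_structure \<Rightarrow> real set \<Rightarrow> (real \<Rightarrow> 'a) \<Rightarrow> (real \<Rightarrow> 'a tvec) \<Rightarrow> bool" where
  "jacobi_field M I \<gamma> J \<longleftrightarrow>
     differentiable_field_along M I \<gamma> J \<and>
     differentiable_field_along M I \<gamma> (cov_deriv_along M I \<gamma> J) \<and>
     (\<forall>t\<in>I. \<forall>c. cov_deriv_along M I \<gamma> (cov_deriv_along M I \<gamma> J) t c =
        - riemann M (\<gamma> t) (J t) (velocity M I \<gamma> t) (velocity M I \<gamma> t) c)"

definition chronologically_precedes ::
    "'a::topological_space lorentz_structure \<Rightarrow> 'a \<Rightarrow> 'a \<Rightarrow> bool" where
  "chronologically_precedes M p q \<longleftrightarrow>
     (\<exists>a b \<alpha>. a < b \<and> C1_curve M {a..b} \<alpha> \<and> \<alpha> a = p \<and> \<alpha> b = q \<and>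
        (\<forall>t\<in>{a..b}. future_timelike M (\<alpha> t) (velocity M {a..b} \<alpha> t)))"

definition achronal :: "'a::topological_space lorentz_structure \<Rightarrow> 'a set \<Rightarrow> bool" where
  "achronal M P \<longleftrightarrow> (\<forall>p\<in>P. \<forall>q\<in>P. \<not> chronologically_precedes M p q)"


section \<open>Submanifolds of codimension 2\<close>

definition slice_chart ::
    "'a lorentz_structure \<Rightarrow> 'a set \<Rightarrow> 'a \<Rightarrow> 'a chart \<Rightarrow> (real^4) set \<Rightarrow> bool" where
  "slice_chart M P p c S \<longleftrightarrow>
     c \<in> charts_at M p \<and> subspace S \<and> dim S = 2 \<and>
     chart_map c ` (P \<inter> chart_dom c) = chart_map c ` chart_dom c \<inter> S"

definition submanifold_codim2 :: "'a lorentz_structure \<Rightarrow> 'a set \<Rightarrow> bool" where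
  "submanifold_codim2 M P \<longleftrightarrow> (\<forall>p\<in>P. \<exists>c S. slice_chart M P p c S)"

definition sub_tangent_space :: "'a lorentz_structure \<Rightarrow> 'a set \<Rightarrow> 'a \<Rightarrow> 'a tvec set" where
  "sub_tangent_space M P p =
     {v \<in> tangent_space M p. \<exists>c S. slice_chart M P p c S \<and> v c \<in> S}"

definition sub_normal_space :: "'a lorentz_structure \<Rightarrow> 'a set \<Rightarrow> 'a \<Rightarrow> 'a tvec set" where
  "sub_normal_space M P p =
     {n \<in> tangent_space M p. \<forall>w\<in>sub_tangent_space M P p. metric M p n w = 0}"

definition spacelike_submanifold_codim2 :: "'a lorentz_structure \<Rightarrow> 'a set \<Rightarrow> bool" where
  "spacelike_submanifold_codim2 M P \<longleftrightarrow>
     submanifold_codim2 M P \<and>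
     (\<forall>p\<in>P. \<forall>v\<in>sub_tangent_space M P p. v \<noteq> zero_tvec \<longrightarrow> metric M p v v < 0)"

definition normal_part :: "'a lorentz_structure \<Rightarrow> 'a set \<Rightarrow> 'a \<Rightarrow> 'a tvec \<Rightarrow> 'a tvec" where
  "normal_part M P p x =
     (THE n. n \<in> sub_normal_space M P p \<and> (\<lambda>c. x c - n c) \<in> sub_tangent_space M P p)"

(* W is a vector field near p, tangent to P along P, that extends the tangent vector w at p. *)
definition tangent_extension ::
    "'a::topological_space lorentz_structure \<Rightarrow> 'a set \<Rightarrow> 'a \<Rightarrow> 'a tvec \<Rightarrow> ('a \<Rightarrow> 'a tvec) \<Rightarrow> bool" where
  "tangent_extension M P p w W \<longleftrightarrow>
     W p = w \<and>
     (\<exists>U. open U \<and> p \<in> U \<and> smooth_vector_field_on M U W \<and>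
        (\<forall>q\<in>P \<inter> U. W q \<in> sub_tangent_space M P q))"

(* II(v,w) is the normal part of nabla_v W; the choice of the extension W is immaterial. *)
definition second_fundamental_form ::
    "'a::topological_space lorentz_structure \<Rightarrow> 'a set \<Rightarrow> 'a \<Rightarrow> 'a tvec \<Rightarrow> 'a tvec \<Rightarrow> 'a tvec" where
  "second_fundamental_form M P p v w =
     (let W = (SOME W. tangent_extension M P p w W) in normal_part M P p (nabla M p v W))"

definition orthonormal_basis ::
    "'a lorentz_structure \<Rightarrow> 'a set \<Rightarrow> 'a \<Rightarrow> 'a tvec \<Rightarrow> 'a tvec \<Rightarrow> bool" where
  "orthonormal_basis M P p e1 e2 \<longleftrightarrow>
     e1 \<in> sub_tangent_space M P p \<and> e2 \<in> sub_tangent_space M P p \<and>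
     metric M p e1 e1 = - 1 \<and> metric M p e2 e2 = - 1 \<and> metric M p e1 e2 = 0"

(* As II is tensorial, the value of a local orthonormal frame at p suffices, and the choice of the
   frame is immaterial. *)
definition mean_normal_curvature ::
    "'a::topological_space lorentz_structure \<Rightarrow> 'a set \<Rightarrow> 'a \<Rightarrow> 'a tvec" where
  "mean_normal_curvature M P p =
     (let (e1, e2) = (SOME (e1, e2). orthonormal_basis M P p e1 e2)
      in (\<lambda>c. (1/2) *\<^sub>R (second_fundamental_form M P p e1 e1 c
                           + second_fundamental_form M P p e2 e2 c)))"

definition future_converging :: "'a::topological_space lorentz_structure \<Rightarrow> 'a set \<Rightarrow> bool" where
  "future_converging M P \<longleftrightarrow> (\<forall>p\<in>P. past_timelike M p (mean_normal_curvature M P p))"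

(* Jacobi fields arising from variations of gamma through geodesics that start normally to P:
   J(0) is tangent to P, and the tangential part of J'(0) is fixed by the shape of P. *)
definition P_jacobi_field ::
    "'a::topological_space lorentz_structure \<Rightarrow> 'a set \<Rightarrow> real set \<Rightarrow> (real \<Rightarrow> 'a) \<Rightarrow>
     (real \<Rightarrow> 'a tvec) \<Rightarrow> bool" where
  "P_jacobi_field M P I \<gamma> J \<longleftrightarrow>
     jacobi_field M I \<gamma> J \<and> J 0 \<in> sub_tangent_space M P (\<gamma> 0) \<and>
     (\<forall>w\<in>sub_tangent_space M P (\<gamma> 0).
        metric M (\<gamma> 0) (cov_deriv_along M I \<gamma> J 0) w =
        - metric M (\<gamma> 0) (second_fundamental_form M P (\<gamma> 0) (J 0) w) (velocity M I \<gamma> 0))"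

(* The point gamma(t) is a focal point to P along the curve gamma defined on I. *)
definition focal_point ::
    "'a::topological_space lorentz_structure \<Rightarrow> 'a set \<Rightarrow> real set \<Rightarrow> (real \<Rightarrow> 'a) \<Rightarrow> real \<Rightarrow> bool" where
  "focal_point M P I \<gamma> t \<longleftrightarrow>
     t \<in> I \<and> t > 0 \<and>
     (\<exists>J. P_jacobi_field M P I \<gamma> J \<and> (\<exists>s\<in>I. J s \<noteq> zero_tvec) \<and> J t = zero_tvec)"

end

theory Submission
  imports Defs
begin

text \<open>
  Suppose there is no focal point in \<open>(0, l]\<close>. Along \<open>\<gamma>\<close> take a parallel frame \<open>E1, E2, k, N\<close>, where
  \<open>E1, E2\<close> start as an orthonormal basis of \<open>TP\<close> and \<open>N\<close> is null with \<open>N \<cdot> k = 1\<close>. In this frame the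
  \<open>P\<close>-Jacobi fields orthogonal to \<open>k\<close> are the solutions of a linear system \<open>y'' = - S y\<close> with \<open>S\<close> a
  symmetric \<open>2 \<times> 2\<close> matrix of trace \<open>\<rho>\<close>, together with a component along \<open>k\<close>, which can always be made to
  vanish at a prescribed parameter. Hence the determinant \<open>D\<close> of two solutions has no zero on \<open>[0, l]\<close>, and
  the expansion \<open>\<theta> = D'/D\<close> satisfies \<open>\<theta>' \<le> - \<rho> - \<theta>\<^sup>2/2\<close> and \<open>\<theta> 0 = 2 H\<close>. Integrating against \<open>(1 - t/l)\<^sup>2\<close>
  bounds \<open>- 2 H\<close> strictly from above, and the integral inequality for \<open>\<rho>\<close>, applied to (approximations of) the
  tent function with slopes \<open>1/l0'\<close> and \<open>- 1/l\<close>, turns this bound into \<open>- 2 H < L1 + L2\<close>.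
\<close>

section \<open>Calculus of functions of class Ck\<close>

text \<open>Tangent vectors, connection and curvature exist only as components in charts, and no
  single chart need contain the geodesic. Hence the transformation laws of the Christoffel symbols
  and of the curvature come first: parallel transport and frames along \<gamma> rest on them. The
  signature fixes the signs: E1 and E2 have square -1, so S has the entries - g(R(Ei,k)k, Ej), and
  the second fundamental form enters the initial velocities with sign +. The system closes on E1 and
  E2 because R(k,k)k = 0 and R(x,k)k is orthogonal to k: nothing flows into N, and nothing flows
  back from k. Each constant of the bound has one source. The energy of the tent gives Q1 (1/l0' +
  1/l), completing the square in the Riccati inequality gives 2/l, and the integral of (1 + t/l0')^2
  gives the factor 1/3 of \<rho>max l0'. As (Q1 + 2)/l' decreases in l', its minimum is at l' = l;
  the other minimum may lie inside, so the tent starts at - l0' and not at - l0.\<close>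

lemma frechet_derivative_eqI: "(f has_derivative f') (at x) \<Longrightarrow> frechet_derivative f (at x) = f'"
  by (metis frechet_derivative_at)

lemma Ck_on_Suc_has_derivative:
  "Ck_on (Suc k) f S \<Longrightarrow> open S \<Longrightarrow> x \<in> S \<Longrightarrow> (f has_derivative frechet_derivative f (at x)) (at x)"
  by (simp add: differentiable_on_eq_differentiable_at frechet_derivative_works)

text \<open>A derivative at a point of an open set sees only values inside the set, so the induction
  can pass from \<open>f\<close> to \<open>g\<close> together with all their derivatives.\<close>

lemma Ck_on_cong:
  assumes "open S" "\<And>x. x \<in> S \<Longrightarrow> f x = g x" "Ck_on k g S"
  shows "Ck_on k f S"
  using assms(2,3)
proof (induction k arbitrary: f g)
  case 0
  then show ?case by (simp cong: continuous_on_cong)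
next
  case (Suc k)
  have d: "(f has_derivative frechet_derivative g (at x)) (at x)" if "x \<in> S" for x
    by (rule has_derivative_transform_within_open[OF Ck_on_Suc_has_derivative[OF Suc.prems(2) assms(1) that] assms(1) that])
      (simp add: Suc.prems(1))
  then have "f differentiable_on S"
    using assms(1) by (auto simp: differentiable_on_eq_differentiable_at differentiable_def)
  moreover have "Ck_on k (\<lambda>x. frechet_derivative f (at x) v) S" for v
    by (rule Suc.IH[where g="\<lambda>x. frechet_derivative g (at x) v"])
      (use Suc.prems(2) frechet_derivative_eqI[OF d] in auto)
  ultimately show ?case by simp
qed

text \<open>\<open>Ck_on\<close> speaks of the canonical \<open>frechet_derivative\<close>; this
  form accepts any explicitly known derivative instead.\<close>

lemma Ck_on_SucI:
  assumes "open S" "\<And>x. x \<in> S \<Longrightarrow> (f has_derivative f' x) (at x)" "\<And>v. Ck_on k (\<lambda>x. f' x v) S"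
  shows "Ck_on (Suc k) f S"
proof -
  have "Ck_on k (\<lambda>x. frechet_derivative f (at x) v) S" for v
    by (rule Ck_on_cong[OF assms(1) _ assms(3)[of v]]) (simp add: frechet_derivative_eqI[OF assms(2)])
  moreover have "f differentiable_on S"
    using assms(1,2) by (auto simp: differentiable_on_eq_differentiable_at differentiable_def)
  ultimately show ?thesis by simp
qed

lemma Ck_on_subset:
  assumes "open S" "open T" "T \<subseteq> S"
  shows "Ck_on k f S \<Longrightarrow> Ck_on k f T"
proof (induction k arbitrary: f)
  case 0
  then show ?case using assms(3) continuous_on_subset by auto
next
  case (Suc k)
  then show ?case using assms(3) differentiable_on_subset by auto
qed

lemma Ck_on_Suc_imp: "open S \<Longrightarrow> Ck_on (Suc k) f S \<Longrightarrow> Ck_on k f S"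
proof (induction k arbitrary: f)
  case 0
  then show ?case by (auto intro: differentiable_imp_continuous_on)
next
  case (Suc k)
  from Suc.prems(2) have "f differentiable_on S" "\<And>v. Ck_on (Suc k) (\<lambda>x. frechet_derivative f (at x) v) S"
    by (simp_all only: Ck_on.simps(2)[of "Suc k"] simp_thms)
  with Suc.IH[OF Suc.prems(1)] show ?case unfolding Ck_on.simps(2)[of k] by blast
qed

lemma Ck_on_imp_continuous_on: "open S \<Longrightarrow> Ck_on k f S \<Longrightarrow> continuous_on S f"
  by (induction k) (auto intro: differentiable_imp_continuous_on)

lemma Ck_on_const: "open S \<Longrightarrow> Ck_on k (\<lambda>x. c) S"
proof (induction k arbitrary: c)
  case (Suc k)
  then show ?case by (intro Ck_on_SucI[where f'="\<lambda>_ _. 0"]) auto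
qed simp

lemma Ck_on_bounded_linear_compose:
  assumes "open S" "bounded_linear L"
  shows "Ck_on k f S \<Longrightarrow> Ck_on k (\<lambda>x. L (f x)) S"
proof (induction k arbitrary: f)
  case 0
  then show ?case using bounded_linear.continuous_on[OF assms(2)] by simp
next
  case (Suc k)
  show ?case
    by (rule Ck_on_SucI[OF assms(1), where f'="\<lambda>x v. L (frechet_derivative f (at x) v)"])
      (use Suc assms in \<open>auto intro!: bounded_linear.has_derivative[OF assms(2)] Ck_on_Suc_has_derivative\<close>)
qed

lemma Ck_on_add:
  assumes "open S"
  shows "Ck_on k f S \<Longrightarrow> Ck_on k g S \<Longrightarrow> Ck_on k (\<lambda>x. f x + g x) S"
proof (induction k arbitrary: f g)
  case 0
  then show ?case by (auto intro: continuous_intros)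
next
  case (Suc k)
  show ?case
    by (rule Ck_on_SucI[OF assms, where f'="\<lambda>x v. frechet_derivative f (at x) v + frechet_derivative g (at x) v"])
      (use Suc assms in \<open>auto intro!: has_derivative_add Ck_on_Suc_has_derivative\<close>)
qed

lemma Ck_on_bilinear:
  assumes "open S" "bounded_bilinear h"
  shows "Ck_on k f S \<Longrightarrow> Ck_on k g S \<Longrightarrow> Ck_on k (\<lambda>x. h (f x) (g x)) S"
proof (induction k arbitrary: f g)
  case 0
  then show ?case using bounded_bilinear.continuous_on[OF assms(2)] by simp
next
  case (Suc k)
  have "Ck_on k (\<lambda>x. h (f x) (frechet_derivative g (at x) v) + h (frechet_derivative f (at x) v) (g x)) S" for v
    using Suc.prems Ck_on_Suc_imp[OF assms(1) Suc.prems(1)] Ck_on_Suc_imp[OF assms(1) Suc.prems(2)]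
    by (intro Ck_on_add[OF assms(1)] Suc.IH) auto
  then show ?case
    by (intro Ck_on_SucI[OF assms(1), where f'="\<lambda>x v. h (f x) (frechet_derivative g (at x) v) + h (frechet_derivative f (at x) v) (g x)"])
      (use Suc.prems assms in \<open>auto intro!: bounded_bilinear.FDERIV Ck_on_Suc_has_derivative\<close>)
qed

lemmas Ck_on_scaleR = Ck_on_bilinear[OF _ bounded_bilinear_scaleR]
lemmas Ck_on_mult = Ck_on_bilinear[OF _ bounded_bilinear_mult]

lemma Ck_on_uminus: "open S \<Longrightarrow> Ck_on k f S \<Longrightarrow> Ck_on k (\<lambda>x. - f x) S"
  by (rule Ck_on_bounded_linear_compose[OF _ bounded_linear_minus[OF bounded_linear_ident]])

lemma Ck_on_diff: "open S \<Longrightarrow> Ck_on k f S \<Longrightarrow> Ck_on k g S \<Longrightarrow> Ck_on k (\<lambda>x. f x - g x) S"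
  using Ck_on_add[OF _ _ Ck_on_uminus] by fastforce

lemma Ck_on_sum:
  "open S \<Longrightarrow> (\<And>i. i \<in> I \<Longrightarrow> Ck_on k (f i) S) \<Longrightarrow> Ck_on k (\<lambda>x. \<Sum>i\<in>I. f i x) S"
  by (induction I rule: infinite_finite_induct) (auto intro: Ck_on_const Ck_on_add)

lemma Ck_on_prod:
  fixes f :: "'i \<Rightarrow> 'a::real_normed_vector \<Rightarrow> real"
  shows "open S \<Longrightarrow> (\<And>i. i \<in> I \<Longrightarrow> Ck_on k (f i) S) \<Longrightarrow> Ck_on k (\<lambda>x. \<Prod>i\<in>I. f i x) S"
  by (induction I rule: infinite_finite_induct) (auto intro: Ck_on_const Ck_on_mult)

lemma Ck_on_inverse:
  fixes f :: "'a::real_normed_vector \<Rightarrow> real"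
  assumes "open S" "\<And>x. x \<in> S \<Longrightarrow> f x \<noteq> 0"
  shows "Ck_on k f S \<Longrightarrow> Ck_on k (\<lambda>x. inverse (f x)) S"
proof (induction k)
  case 0
  then show ?case using assms by (auto intro!: continuous_intros)
next
  case (Suc k)
  have "Ck_on k (\<lambda>x. - (inverse (f x) * frechet_derivative f (at x) v * inverse (f x))) S" for v
    using Suc Ck_on_Suc_imp[OF assms(1) Suc.prems]
    by (intro Ck_on_uminus Ck_on_mult assms) auto
  then show ?case
    by (intro Ck_on_SucI[OF assms(1), where f'="\<lambda>x v. - (inverse (f x) * frechet_derivative f (at x) v * inverse (f x))"])
      (use Suc.prems assms in \<open>auto intro!: Deriv.has_derivative_inverse Ck_on_Suc_has_derivative\<close>)
qed

lemma Ck_on_vec: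
  fixes f :: "'a::real_normed_vector \<Rightarrow> real^'n"
  assumes "open S" "\<And>i. Ck_on k (\<lambda>x. f x $ i) S"
  shows "Ck_on k f S"
proof -
  have "f = (\<lambda>x. \<Sum>i\<in>UNIV. (f x $ i) *\<^sub>R axis i 1)"
    by (auto simp: vec_eq_iff axis_def if_distrib cong: if_cong)
  moreover have "Ck_on k (\<lambda>x. \<Sum>i\<in>UNIV. (f x $ i) *\<^sub>R (axis i 1 :: real^'n)) S"
    by (intro Ck_on_sum Ck_on_scaleR Ck_on_const assms)
  ultimately show ?thesis by metis
qed

lemma linear_sum_Basis:
  fixes f :: "'a::euclidean_space \<Rightarrow> 'b::real_vector"
  assumes "linear f"
  shows "f x = (\<Sum>i\<in>Basis. (x \<bullet> i) *\<^sub>R f i)"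
  by (subst euclidean_representation[symmetric, of x]) (simp add: linear_sum[OF assms] linear_scale[OF assms] o_def del: euclidean_representation)

lemma Ck_on_compose:
  fixes f :: "'b::euclidean_space \<Rightarrow> 'c::real_normed_vector" and g :: "'a::real_normed_vector \<Rightarrow> 'b"
  assumes "open S" "open T" "\<And>x. x \<in> S \<Longrightarrow> g x \<in> T"
  shows "Ck_on k f T \<Longrightarrow> Ck_on k g S \<Longrightarrow> Ck_on k (\<lambda>x. f (g x)) S"
proof (induction k arbitrary: f)
  case 0
  then show ?case using assms(3) by (auto intro: continuous_on_compose2)
next
  case (Suc k)
  note f = Ck_on_Suc_has_derivative[OF Suc.prems(1) assms(2) assms(3)]
  note g = Ck_on_Suc_has_derivative[OF Suc.prems(2) assms(1)]
  \<comment> \<open>\<open>Ck_on\<close> controls the derivative of \<open>f\<close> only in fixed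
    directions, while the chain rule needs it in a direction that moves with x. The expansion in the
    basis separates the two.\<close>
  let ?D = "\<lambda>x v. \<Sum>i\<in>Basis. (frechet_derivative g (at x) v \<bullet> i) *\<^sub>R frechet_derivative f (at (g x)) i"
  have "((\<lambda>x. f (g x)) has_derivative ?D x) (at x)" if "x \<in> S" for x
  proof -
    have "linear (frechet_derivative f (at (g x)))" using f[OF that] has_derivative_linear by blast
    then have "?D x v = frechet_derivative f (at (g x)) (frechet_derivative g (at x) v)" for v
      using linear_sum_Basis by metis
    then show ?thesis
      using has_derivative_compose[OF g[OF that] f[OF that]] by simp
  qed
  moreover have "Ck_on k (\<lambda>x. ?D x v) S" for v
    using Suc.prems Ck_on_Suc_imp[OF assms(1) Suc.prems(2)]
    by (intro Ck_on_sum Ck_on_scaleR assms Suc.IH Ck_on_bounded_linear_compose[OF assms(1) bounded_linear_inner_left]) auto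
  ultimately show ?case by (intro Ck_on_SucI[OF assms(1), where f'="?D"])
qed

lemma smooth_on_Ck: "smooth_on f S \<Longrightarrow> Ck_on k f S"
  by (simp add: smooth_on_def)

lemma smooth_on_has_derivative:
  "smooth_on f S \<Longrightarrow> open S \<Longrightarrow> x \<in> S \<Longrightarrow> (f has_derivative frechet_derivative f (at x)) (at x)"
  using Ck_on_Suc_has_derivative smooth_on_Ck by blast

lemma smooth_on_frechet_derivative:
  "smooth_on f S \<Longrightarrow> smooth_on (\<lambda>x. frechet_derivative f (at x) v) S"
  unfolding smooth_on_def by (metis Ck_on.simps(2))

lemma smooth_on_subset: "smooth_on f S \<Longrightarrow> open S \<Longrightarrow> open T \<Longrightarrow> T \<subseteq> S \<Longrightarrow> smooth_on f T"
  unfolding smooth_on_def using Ck_on_subset by blast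

lemma smooth_on_imp_continuous_on: "smooth_on f S \<Longrightarrow> open S \<Longrightarrow> continuous_on S f"
  using Ck_on_imp_continuous_on smooth_on_Ck by blast

text \<open>Regularity of metric and connection is known only for fixed vector arguments. Expansion
  in a basis turns this into the product rule for a linear map applied to a moving vector.\<close>

lemma has_derivative_linear_family:
  fixes F :: "'s::real_normed_vector \<Rightarrow> 'a::euclidean_space \<Rightarrow> 'b::real_normed_vector"
  assumes lin: "\<And>s. s \<in> T \<Longrightarrow> linear (F s)" and t: "t \<in> T"
    and F: "\<And>v. ((\<lambda>s. F s v) has_derivative (\<lambda>h. F' h v)) (at t within T)" and lin': "\<And>h. linear (F' h)"
    and x: "(x has_derivative x') (at t within T)"
  shows "((\<lambda>s. F s (x s)) has_derivative (\<lambda>h. F' h (x t) + F t (x' h))) (at t within T)"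
proof -
  have "((\<lambda>s. \<Sum>i\<in>Basis. (x s \<bullet> i) *\<^sub>R F s i) has_derivative
         (\<lambda>h. \<Sum>i\<in>Basis. (x t \<bullet> i) *\<^sub>R F' h i + (x' h \<bullet> i) *\<^sub>R F t i)) (at t within T)"
    by (intro has_derivative_sum has_derivative_scaleR F has_derivative_inner_left x)
  moreover have "(\<lambda>h. \<Sum>i\<in>Basis. (x t \<bullet> i) *\<^sub>R F' h i + (x' h \<bullet> i) *\<^sub>R F t i) = (\<lambda>h. F' h (x t) + F t (x' h))"
    by (rule ext, subst (2) linear_sum_Basis[OF lin'], subst (2) linear_sum_Basis[OF lin[OF t]])
      (simp add: sum.distrib)
  ultimately show ?thesis
    using t by (elim has_derivative_transform[rotated 2, OF back_subst[of "\<lambda>f. (_ has_derivative f) _"]])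
      (auto simp: linear_sum_Basis[OF lin])
qed

lemma has_vector_derivative_linear_family:
  fixes F :: "real \<Rightarrow> 'a::euclidean_space \<Rightarrow> 'b::real_normed_vector"
  assumes "\<And>s. s \<in> T \<Longrightarrow> linear (F s)" "t \<in> T"
    and "\<And>v. ((\<lambda>s. F s v) has_vector_derivative F' v) (at t within T)" "linear F'"
    and "(x has_vector_derivative x') (at t within T)"
  shows "((\<lambda>s. F s (x s)) has_vector_derivative (F' (x t) + F t x')) (at t within T)"
proof -
  have "linear (\<lambda>v. h *\<^sub>R F' v)" for h
    using linear_compose_scale_right[OF assms(4)] .
  from has_derivative_linear_family[where F'="\<lambda>h v. h *\<^sub>R F' v", OF assms(1,2) assms(3)[unfolded has_vector_derivative_def] this assms(5)[unfolded has_vector_derivative_def]]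
  show ?thesis
    by (simp add: has_vector_derivative_def algebra_simps linear_scale[OF assms(1)[OF assms(2)]])
qed

lemma continuous_on_linear_family:
  fixes F :: "'s::topological_space \<Rightarrow> 'a::euclidean_space \<Rightarrow> 'b::real_normed_vector"
  assumes "\<And>s. s \<in> T \<Longrightarrow> linear (F s)" "\<And>v. continuous_on T (\<lambda>s. F s v)" "continuous_on T x"
  shows "continuous_on T (\<lambda>s. F s (x s))"
proof -
  have "continuous_on T (\<lambda>s. \<Sum>i\<in>Basis. (x s \<bullet> i) *\<^sub>R F s i)"
    by (intro continuous_intros assms)
  then show ?thesis
    by (rule continuous_on_eq) (simp add: linear_sum_Basis[OF assms(1)])
qed

lemma linear_frechet_derivative_param:
  assumes "open S" "q \<in> S" "\<And>r. r \<in> S \<Longrightarrow> linear (F r)" "\<And>v. (\<lambda>r. F r v) differentiable (at q)"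
  shows "linear (\<lambda>v. frechet_derivative (\<lambda>r. F r v) (at q) h)"
proof
  note d = assms(4)[unfolded frechet_derivative_works]
  fix v w and a :: real
  show "frechet_derivative (\<lambda>r. F r (v + w)) (at q) h = frechet_derivative (\<lambda>r. F r v) (at q) h + frechet_derivative (\<lambda>r. F r w) (at q) h"
    by (subst frechet_derivative_eqI[OF has_derivative_transform_within_open[OF has_derivative_add[OF d[of v] d[of w]] assms(1,2)]])
      (auto simp: linear_add[OF assms(3)])
  show "frechet_derivative (\<lambda>r. F r (a *\<^sub>R v)) (at q) h = a *\<^sub>R frechet_derivative (\<lambda>r. F r v) (at q) h"
    by (subst frechet_derivative_eqI[OF has_derivative_transform_within_open[OF has_derivative_scaleR_right[OF d[of v]] assms(1,2)]])
      (auto simp: linear_scale[OF assms(3)])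
qed

section \<open>Symmetry of second derivatives\<close>

lemma has_real_derivative_along_line:
  fixes F :: "'a::real_normed_vector \<Rightarrow> real"
  assumes "(F has_derivative F') (at (p + s *\<^sub>R v))"
  shows "((\<lambda>s. F (p + s *\<^sub>R v)) has_real_derivative F' v) (at s)"
proof -
  have "((\<lambda>s. p + s *\<^sub>R v) has_derivative (\<lambda>h. h *\<^sub>R v)) (at s)"
    by (auto intro!: derivative_eq_intros)
  from has_derivative_compose[OF this assms] show ?thesis
    unfolding has_field_derivative_def
    by (rule back_subst[of "\<lambda>f. (_ has_derivative f) _"])
      (simp add: fun_eq_iff linear_scale[OF has_derivative_linear[OF assms]] mult.commute)
qed

text \<open>The mean value theorem is used twice, along \<open>v\<close> and then along
  \<open>w\<close>; this makes the second difference a single second derivative at a nearby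
  point.\<close>

lemma mixed_difference_mean_value:
  fixes f :: "'a::real_normed_vector \<Rightarrow> real"
  assumes S: "open S" and f: "Ck_on 2 f S" and r: "ball x r \<subseteq> S" and t: "0 < t" "t * (norm v + norm w) < r"
  shows "\<exists>p. dist p x \<le> t * (norm v + norm w) \<and>
     f (x + t *\<^sub>R v + t *\<^sub>R w) - f (x + t *\<^sub>R v) - f (x + t *\<^sub>R w) + f x
     = t\<^sup>2 * frechet_derivative (\<lambda>y. frechet_derivative f (at y) v) (at p) w"
proof -
  have near: "dist (x + a *\<^sub>R v + b *\<^sub>R w) x \<le> t * (norm v + norm w)" if "0 \<le> a" "a \<le> t" "0 \<le> b" "b \<le> t" for a b
  proof -
    have "norm (a *\<^sub>R v + b *\<^sub>R w) \<le> a * norm v + b * norm w"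
      using norm_triangle_ineq[of "a *\<^sub>R v" "b *\<^sub>R w"] that by simp
    also have "\<dots> \<le> t * norm v + t * norm w"
      using that by (intro add_mono mult_right_mono) auto
    finally show ?thesis by (simp add: dist_norm algebra_simps)
  qed
  then have inS: "x + a *\<^sub>R v + b *\<^sub>R w \<in> S" if "0 \<le> a" "a \<le> t" "0 \<le> b" "b \<le> t" for a b
    using that t(2) r by (force simp: dist_commute)
  have f2: "Ck_on (Suc (Suc 0)) f S" using f by (simp add: numeral_2_eq_2)
  let ?D = "\<lambda>y. frechet_derivative f (at y) v"
  have D1: "(f has_derivative frechet_derivative f (at y)) (at y)" if "y \<in> S" for y
    using Ck_on_Suc_has_derivative[OF f2 S that] .
  have "Ck_on (Suc 0) ?D S" using f2 by (simp only: Ck_on.simps(2)[of "Suc 0"])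
  then have D2: "(?D has_derivative frechet_derivative ?D (at y)) (at y)" if "y \<in> S" for y
    using Ck_on_Suc_has_derivative[OF _ S that] by blast
  \<comment> \<open>The increment in direction \<open>w\<close> as a function of the displacement
    along \<open>v\<close>; the second difference is its total change.\<close>
  define \<phi> where "\<phi> = (\<lambda>s. f ((x + t *\<^sub>R w) + s *\<^sub>R v) - f (x + s *\<^sub>R v))"
  have "\<exists>z. 0 < z \<and> z < t \<and> \<phi> t - \<phi> 0 = (t - 0) * (?D ((x + t *\<^sub>R w) + z *\<^sub>R v) - ?D (x + z *\<^sub>R v))"
  proof (rule MVT2[OF t(1)])
    fix s assume s: "0 \<le> s" "s \<le> t"
    have "(x + t *\<^sub>R w) + s *\<^sub>R v \<in> S" "x + s *\<^sub>R v \<in> S"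
      using inS[of s t] inS[of s 0] s t(1) by (simp_all add: algebra_simps)
    then show "DERIV \<phi> s :> ?D ((x + t *\<^sub>R w) + s *\<^sub>R v) - ?D (x + s *\<^sub>R v)"
      unfolding \<phi>_def by (intro DERIV_diff has_real_derivative_along_line D1)
  qed
  then obtain z where z: "0 < z" "z < t"
    "\<phi> t - \<phi> 0 = t * (?D ((x + t *\<^sub>R w) + z *\<^sub>R v) - ?D (x + z *\<^sub>R v))" by auto
  have "\<exists>u. 0 < u \<and> u < t \<and> ?D ((x + z *\<^sub>R v) + t *\<^sub>R w) - ?D ((x + z *\<^sub>R v) + 0 *\<^sub>R w)
      = (t - 0) * frechet_derivative ?D (at ((x + z *\<^sub>R v) + u *\<^sub>R w)) w"
    by (rule MVT2[OF t(1)]) (intro has_real_derivative_along_line D2, use inS z in auto)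
  then obtain u where u: "0 < u" "u < t"
    "?D ((x + z *\<^sub>R v) + t *\<^sub>R w) - ?D (x + z *\<^sub>R v) = t * frechet_derivative ?D (at ((x + z *\<^sub>R v) + u *\<^sub>R w)) w"
    by auto
  have "f (x + t *\<^sub>R v + t *\<^sub>R w) - f (x + t *\<^sub>R v) - f (x + t *\<^sub>R w) + f x = \<phi> t - \<phi> 0"
    by (simp add: \<phi>_def algebra_simps)
  also have "\<dots> = t\<^sup>2 * frechet_derivative ?D (at ((x + z *\<^sub>R v) + u *\<^sub>R w)) w"
    using z(3) u(3) by (simp add: power2_eq_square add.commute add.left_commute)
  finally show ?thesis using near[of z u] z u by (intro exI[of _ "(x + z *\<^sub>R v) + u *\<^sub>R w"]) auto
qed

text \<open>The second difference is symmetric in \<open>v\<close> and \<open>w\<close>. Hence one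
  mixed derivative at some point p equals the other at some point q, both close to \<open>x\<close>,
  and continuity excludes a gap at \<open>x\<close>.\<close>

lemma second_derivative_symmetric_real:
  fixes f :: "'a::real_normed_vector \<Rightarrow> real"
  assumes S: "open S" "x \<in> S" and f: "Ck_on 2 f S"
  shows "frechet_derivative (\<lambda>y. frechet_derivative f (at y) v) (at x) w =
         frechet_derivative (\<lambda>y. frechet_derivative f (at y) w) (at x) v"
proof (rule ccontr)
  let ?A = "\<lambda>p. frechet_derivative (\<lambda>y. frechet_derivative f (at y) v) (at p) w"
  let ?B = "\<lambda>p. frechet_derivative (\<lambda>y. frechet_derivative f (at y) w) (at p) v"
  assume ne: "?A x \<noteq> ?B x"
  define e where "e = \<bar>?A x - ?B x\<bar> / 2"
  have e: "e > 0" using ne by (simp add: e_def)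
  have "continuous_on S ?A" "continuous_on S ?B"
    using f by (auto simp: numeral_2_eq_2)
  then have "isCont ?A x" "isCont ?B x"
    using S by (simp_all add: continuous_on_eq_continuous_at)
  then obtain d1 d2 where d: "d1 > 0" "\<And>p. dist p x < d1 \<Longrightarrow> dist (?A p) (?A x) < e"
      "d2 > 0" "\<And>p. dist p x < d2 \<Longrightarrow> dist (?B p) (?B x) < e"
    using e unfolding continuous_at_eps_delta by metis
  obtain r where r: "r > 0" "ball x r \<subseteq> S" using S open_contains_ball by blast
  define m where "m = min r (min d1 d2)"
  \<comment> \<open>The summand 1 keeps the step size \<open>t\<close> meaningful when
    \<open>v\<close> and \<open>w\<close> are both 0.\<close>
  define N where "N = norm v + norm w + 1"
  define t where "t = m / (2 * N)"
  have m: "m > 0" using r d by (simp add: m_def)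
  have N: "N > 0" "norm v + norm w < N" by (simp_all add: N_def add_nonneg_pos)
  have t: "t > 0" using m N by (simp add: t_def)
  have tm: "t * (norm v + norm w) < m"
  proof -
    have "t * (norm v + norm w) < t * N" using t N by simp
    also have "\<dots> \<le> m" using m N by (simp add: t_def)
    finally show ?thesis .
  qed
  then have tr: "t * (norm v + norm w) < r" by (simp add: m_def)
  obtain p where p: "dist p x \<le> t * (norm v + norm w)"
     "f (x + t *\<^sub>R v + t *\<^sub>R w) - f (x + t *\<^sub>R v) - f (x + t *\<^sub>R w) + f x = t\<^sup>2 * ?A p"
    using mixed_difference_mean_value[OF S(1) f r(2) t tr] by blast
  obtain q where q: "dist q x \<le> t * (norm v + norm w)"
     "f (x + t *\<^sub>R w + t *\<^sub>R v) - f (x + t *\<^sub>R w) - f (x + t *\<^sub>R v) + f x = t\<^sup>2 * ?B q"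
    using mixed_difference_mean_value[OF S(1) f r(2) t, of w v] tr by (auto simp: add.commute)
  have "t\<^sup>2 * ?A p = t\<^sup>2 * ?B q" using p(2) q(2) by (simp add: algebra_simps)
  then have "?A p = ?B q" using t by simp
  moreover have "dist (?A p) (?A x) < e" "dist (?B q) (?B x) < e"
    using d p(1) q(1) tm unfolding m_def by auto
  ultimately show False by (auto simp: dist_real_def e_def abs_if split: if_splits)
qed

lemma second_derivative_symmetric:
  fixes f :: "'a::real_normed_vector \<Rightarrow> 'b::euclidean_space"
  assumes S: "open S" "x \<in> S" and f: "smooth_on f S"
  shows "frechet_derivative (\<lambda>y. frechet_derivative f (at y) v) (at x) w =
         frechet_derivative (\<lambda>y. frechet_derivative f (at y) w) (at x) v"
proof (rule euclidean_eqI)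
  fix b :: 'b
  have *: "frechet_derivative (\<lambda>y. g y \<bullet> b) (at z) u = frechet_derivative g (at z) u \<bullet> b"
    if "smooth_on g S" "z \<in> S" for g :: "'a \<Rightarrow> 'b" and z u
    using frechet_derivative_eqI[OF has_derivative_inner_left[OF smooth_on_has_derivative[OF that(1) S(1) that(2)]]] by simp
  have **: "frechet_derivative (\<lambda>y. frechet_derivative (\<lambda>y. f y \<bullet> b) (at y) u) (at x) u'
      = frechet_derivative (\<lambda>y. frechet_derivative f (at y) u) (at x) u' \<bullet> b" for u u'
  proof -
    have "((\<lambda>y. frechet_derivative f (at y) u \<bullet> b) has_derivative (\<lambda>h. frechet_derivative (\<lambda>y. frechet_derivative f (at y) u) (at x) h \<bullet> b)) (at x)"
      by (intro has_derivative_inner_left smooth_on_has_derivative[OF smooth_on_frechet_derivative[OF f] S])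
    then have "((\<lambda>y. frechet_derivative (\<lambda>y. f y \<bullet> b) (at y) u) has_derivative (\<lambda>h. frechet_derivative (\<lambda>y. frechet_derivative f (at y) u) (at x) h \<bullet> b)) (at x)"
      by (rule has_derivative_transform_within_open[OF _ S]) (simp add: *[OF f])
    then show ?thesis by (simp add: frechet_derivative_eqI)
  qed
  have "Ck_on 2 (\<lambda>y. f y \<bullet> b) S"
    by (intro Ck_on_bounded_linear_compose[OF S(1) bounded_linear_inner_left] smooth_on_Ck f)
  from second_derivative_symmetric_real[OF S this, of v w]
  show "frechet_derivative (\<lambda>y. frechet_derivative f (at y) v) (at x) w \<bullet> b =
    frechet_derivative (\<lambda>y. frechet_derivative f (at y) w) (at x) v \<bullet> b" by (simp add: **)
qed

section \<open>Existence for linear ordinary differential equations\<close>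

lemma linear_ode_short_interval:
  fixes A :: "real \<Rightarrow> 'a::euclidean_space \<Rightarrow> 'a"
  assumes lin: "\<And>t. t \<in> {a..b} \<Longrightarrow> linear (A t)"
    and cont: "\<And>v. continuous_on {a..b} (\<lambda>t. A t v)"
    and K: "\<And>t v. t \<in> {a..b} \<Longrightarrow> norm (A t v) \<le> K * norm v" "0 \<le> K" "2 * K * (b - a) < 1"
    and t0: "t0 \<in> {a..b}"
  shows "\<exists>x. x t0 = x0 \<and> (\<forall>t\<in>{a..b}. (x has_vector_derivative A t (x t)) (at t within {a..b}))"
proof -
  have ab: "a \<le> b" using t0 by simp
  \<comment> \<open>Clamping onto the interval allows the fixed point to be sought among bounded
    continuous functions on the whole line, a complete space.\<close>
  define cl where "cl = (\<lambda>t. max a (min b t))"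
  have cl: "cl t \<in> {a..b}" "t \<in> {a..b} \<Longrightarrow> cl t = t" for t using ab by (auto simp: cl_def)
  have ccl: "continuous_on UNIV cl" unfolding cl_def by (intro continuous_intros)
  \<comment> \<open>The Picard operator. Both integrals start at \<open>a\<close>, which avoids
    oriented integrals when t < t0; the price is the factor 2 in the contraction constant.\<close>
  define G where "G = (\<lambda>u t. x0 + (integral {a..cl t} (\<lambda>s. A s (apply_bcontfun u s)) - integral {a..t0} (\<lambda>s. A s (apply_bcontfun u s))))"
  have cu: "continuous_on {a..b} (\<lambda>s. A s (apply_bcontfun u s))" for u
    by (rule continuous_on_linear_family[OF lin cont continuous_on_apply_bcontfun])
  then have iu: "(\<lambda>s. A s (apply_bcontfun u s)) integrable_on {a..c}" if "c \<in> {a..b}" for u c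
    by (rule integrable_continuous_real[OF continuous_on_subset]) (use that in auto)
  have cF: "continuous_on {a..b} (\<lambda>t. integral {a..t} (\<lambda>s. A s (apply_bcontfun u s)))" for u
    by (intro indefinite_integral_continuous_1 iu) (use ab in auto)
  have bG: "G u \<in> bcontfun" for u
  proof -
    have 1: "continuous_on UNIV (\<lambda>t. integral {a..cl t} (\<lambda>s. A s (apply_bcontfun u s)))"
      by (rule continuous_on_compose2[OF cF ccl]) (use cl in auto)
    have "bounded ((\<lambda>t. integral {a..t} (\<lambda>s. A s (apply_bcontfun u s))) ` {a..b})"
      by (intro compact_imp_bounded compact_continuous_image cF compact_Icc)
    then obtain B where B: "\<And>t. t \<in> {a..b} \<Longrightarrow> norm (integral {a..t} (\<lambda>s. A s (apply_bcontfun u s))) \<le> B"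
      unfolding bounded_iff by blast
    have "norm (G u t) \<le> norm x0 + (B + B)" for t
      unfolding G_def
      by (intro norm_triangle_mono order_refl norm_triangle_le_diff add_mono order_trans[OF norm_triangle_ineq4] B cl t0)
    then have "bounded (range (G u))" unfolding bounded_iff by blast
    then show ?thesis unfolding bcontfun_def
      using 1 by (auto simp: G_def intro!: continuous_intros)
  qed
  define \<Phi> where "\<Phi> = (\<lambda>u. Bcontfun (G u))"
  have \<Phi>: "apply_bcontfun (\<Phi> u) = G u" for u using bG by (simp add: \<Phi>_def Bcontfun_inverse)
  have "\<exists>!u. \<Phi> u = u"
  proof (rule banach_fix_type[of "2 * K * (b - a)"])
    show "0 \<le> 2 * K * (b - a)" using K ab by simp
    show "2 * K * (b - a) < 1" by fact
    show "\<forall>u v. dist (\<Phi> u) (\<Phi> v) \<le> 2 * K * (b - a) * dist u v"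
    proof (intro allI dist_bound)
      fix u v :: "(real, 'a) bcontfun" and t
      let ?I = "\<lambda>c. integral {a..c} (\<lambda>s. A s (apply_bcontfun u s)) - integral {a..c} (\<lambda>s. A s (apply_bcontfun v s))"
      have I: "norm (?I c) \<le> K * dist u v * (b - a)" if c: "c \<in> {a..b}" for c
      proof -
        have "?I c = integral {a..c} (\<lambda>s. A s (apply_bcontfun u s) - A s (apply_bcontfun v s))"
          by (rule Henstock_Kurzweil_Integration.integral_diff[symmetric]) (intro iu c)+
        also have "norm \<dots> \<le> K * dist u v * (c - a)"
        proof (rule integral_bound)
          show "a \<le> c" using c by simp
          show "continuous_on {a..c} (\<lambda>s. A s (apply_bcontfun u s) - A s (apply_bcontfun v s))"
            by (rule continuous_on_subset[OF continuous_on_diff[OF cu cu]]) (use c in auto)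
          fix s assume s: "s \<in> {a..c}"
          then have s': "s \<in> {a..b}" using c by auto
          have "norm (A s (apply_bcontfun u s) - A s (apply_bcontfun v s)) = norm (A s (apply_bcontfun u s - apply_bcontfun v s))"
            by (simp add: linear_diff[OF lin[OF s']])
          also have "\<dots> \<le> K * norm (apply_bcontfun u s - apply_bcontfun v s)" by (rule K(1)[OF s'])
          also have "\<dots> \<le> K * dist u v"
            by (intro mult_left_mono K) (metis dist_norm dist_bounded)
          finally show "norm (A s (apply_bcontfun u s) - A s (apply_bcontfun v s)) \<le> K * dist u v" .
        qed
        also have "\<dots> \<le> K * dist u v * (b - a)" using c K by (intro mult_left_mono) auto
        finally show ?thesis .
      qed
      have "dist (apply_bcontfun (\<Phi> u) t) (apply_bcontfun (\<Phi> v) t) = norm (?I (cl t) - ?I t0)"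
        by (simp add: \<Phi> G_def dist_norm algebra_simps)
      also have "\<dots> \<le> K * dist u v * (b - a) + K * dist u v * (b - a)"
        by (intro order_trans[OF norm_triangle_ineq4] add_mono I cl t0)
      finally show "dist (apply_bcontfun (\<Phi> u) t) (apply_bcontfun (\<Phi> v) t) \<le> 2 * K * (b - a) * dist u v"
        by (simp add: algebra_simps)
    qed
  qed
  then obtain u where u: "\<Phi> u = u" by blast
  define x where "x = apply_bcontfun u"
  have x: "x t = G u t" for t using \<Phi>[of u] by (simp add: u x_def)
  have "x t0 = x0" using cl(2)[OF t0] by (simp add: x G_def)
  moreover have "(x has_vector_derivative A t (x t)) (at t within {a..b})" if t: "t \<in> {a..b}" for t
  proof -
    have "((\<lambda>t. integral {a..t} (\<lambda>s. A s (apply_bcontfun u s))) has_vector_derivative A t (apply_bcontfun u t)) (at t within {a..b})"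
      by (rule integral_has_vector_derivative[OF cu t])
    then have "((\<lambda>t. x0 + (integral {a..t} (\<lambda>s. A s (apply_bcontfun u s)) - integral {a..t0} (\<lambda>s. A s (apply_bcontfun u s)))) has_vector_derivative A t (x t)) (at t within {a..b})"
      unfolding x_def by (auto intro!: derivative_eq_intros)
    then show ?thesis
      by (rule has_vector_derivative_transform[OF t, rotated]) (simp add: x G_def cl)
  qed
  ultimately show ?thesis by blast
qed

lemma linear_family_bounded:
  fixes A :: "real \<Rightarrow> 'a::euclidean_space \<Rightarrow> 'b::real_normed_vector"
  assumes "\<And>t. t \<in> {a..b} \<Longrightarrow> linear (A t)" "\<And>v. continuous_on {a..b} (\<lambda>t. A t v)"
  obtains K where "0 \<le> K" "\<And>t v. t \<in> {a..b} \<Longrightarrow> norm (A t v) \<le> K * norm v"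
proof -
  have "\<exists>k. \<forall>t\<in>{a..b}. norm (A t i) \<le> k" for i
    using compact_imp_bounded[OF compact_continuous_image[OF assms(2)[of i] compact_Icc]] unfolding bounded_iff by auto
  then obtain k where k: "\<And>i t. t \<in> {a..b} \<Longrightarrow> norm (A t i) \<le> k i" by metis
  define K where "K = (\<Sum>i\<in>Basis. \<bar>k i\<bar>)"
  have "norm (A t v) \<le> K * norm v" if t: "t \<in> {a..b}" for t v
  proof -
    have "norm (A t v) \<le> (\<Sum>i\<in>Basis. norm ((v \<bullet> i) *\<^sub>R A t i))"
      unfolding linear_sum_Basis[OF assms(1)[OF t], of v] by (rule norm_sum)
    also have "\<dots> \<le> (\<Sum>i\<in>Basis. norm v * \<bar>k i\<bar>)"
      using k[OF t] Basis_le_norm by (auto intro!: sum_mono mult_mono order_trans[OF _ abs_ge_self])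
    finally show ?thesis by (simp add: K_def sum_distrib_left mult.commute)
  qed
  moreover have "0 \<le> K" by (simp add: K_def sum_nonneg)
  ultimately show thesis using that by blast
qed

lemma has_vector_derivative_within_Icc_Un:
  assumes "a \<le> b" "b \<le> c" "t \<in> {a..c}"
    "t \<in> {a..b} \<Longrightarrow> (x has_vector_derivative d) (at t within {a..b})"
    "t \<in> {b..c} \<Longrightarrow> (x has_vector_derivative d) (at t within {b..c})"
  shows "(x has_vector_derivative d) (at t within {a..c})"
proof -
  have un: "{a..c} = {a..b} \<union> {b..c}" using assms by auto
  consider "t < b" | "t = b" | "t > b" by linarith
  then show ?thesis
  proof cases
    case 1
    then have "at t within {a..c} = at t within {a..b}"
      using assms by (intro at_within_nhd[of _ "{..<b}"]) auto
    then show ?thesis using 1 assms by simp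
  next
    case 2
    then show ?thesis
      using assms unfolding has_vector_derivative_def has_derivative_within un by (auto simp: Lim_within_Un)
  next
    case 3
    then have "at t within {a..c} = at t within {b..c}"
      using assms by (intro at_within_nhd[of _ "{b<..}"]) auto
    then show ?thesis using 3 assms by simp
  qed
qed

lemma has_vector_derivative_glue:
  assumes "a \<le> b" "b \<le> c" "x b = y b"
    and "\<And>t. t \<in> {a..b} \<Longrightarrow> (x has_vector_derivative d t) (at t within {a..b})"
    and "\<And>t. t \<in> {b..c} \<Longrightarrow> (y has_vector_derivative e t) (at t within {b..c})"
    and "d b = e b" "t \<in> {a..c}"
  shows "((\<lambda>t. if t \<le> b then x t else y t) has_vector_derivative (if t \<le> b then d t else e t)) (at t within {a..c})"
proof (rule has_vector_derivative_within_Icc_Un[OF assms(1,2,7)])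
  assume t: "t \<in> {a..b}"
  then have "(x has_vector_derivative (if t \<le> b then d t else e t)) (at t within {a..b})"
    using assms(4)[OF t] by simp
  then show "((\<lambda>t. if t \<le> b then x t else y t) has_vector_derivative (if t \<le> b then d t else e t)) (at t within {a..b})"
    by (rule has_vector_derivative_transform[OF t, rotated]) simp
next
  assume t: "t \<in> {b..c}"
  then have "(y has_vector_derivative (if t \<le> b then d t else e t)) (at t within {b..c})"
    using assms(5)[OF t] assms(6) by auto
  then show "((\<lambda>t. if t \<le> b then x t else y t) has_vector_derivative (if t \<le> b then d t else e t)) (at t within {b..c})"
    by (rule has_vector_derivative_transform[OF t, rotated]) (use assms(3) in \<open>auto dest: antisym\<close>)
qed

text \<open>A linear equation has a bound \<open>K\<close> on the whole interval, hence a uniform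
  length below which the contraction works. Bisection then glues the short solutions.\<close>

lemma linear_ode_solution:
  fixes A :: "real \<Rightarrow> 'a::euclidean_space \<Rightarrow> 'a"
  assumes ab: "a \<le> b"
    and lin: "\<And>t. t \<in> {a..b} \<Longrightarrow> linear (A t)"
    and cont: "\<And>v. continuous_on {a..b} (\<lambda>t. A t v)"
    and t0: "t0 \<in> {a..b}"
  obtains x where "x t0 = x0" "\<And>t. t \<in> {a..b} \<Longrightarrow> (x has_vector_derivative A t (x t)) (at t within {a..b})"
proof -
  obtain K where K: "0 \<le> K" "\<And>t v. t \<in> {a..b} \<Longrightarrow> norm (A t v) \<le> K * norm v"
    using linear_family_bounded[OF lin cont] by metis
  define P where "P = (\<lambda>c d. a \<le> c \<and> d \<le> b \<longrightarrow> (\<forall>t0\<in>{c..d}. \<forall>x0. \<exists>x. x t0 = x0 \<and> (\<forall>t\<in>{c..d}. (x has_vector_derivative A t (x t)) (at t within {c..d}))))"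
  have "P a b"
    using ab
  proof (induction rule: Bolzano)
    case (trans c d e)
    show ?case unfolding P_def
    proof (intro impI ballI allI)
      fix t0 x0 assume ce: "a \<le> c \<and> e \<le> b" and t0: "t0 \<in> {c..e}"
      have glue: "\<exists>x. x t0 = x0 \<and> (\<forall>t\<in>{c..e}. (x has_vector_derivative A t (x t)) (at t within {c..e}))"
        \<comment> \<open>The initial parameter may lie on either side of the gluing point; the
          solution on that side is found first and continued across.\<close>
        if "y d = z d" "(if t0 \<le> d then y t0 else z t0) = x0"
          "\<forall>t\<in>{c..d}. (y has_vector_derivative A t (y t)) (at t within {c..d})"
          "\<forall>t\<in>{d..e}. (z has_vector_derivative A t (z t)) (at t within {d..e})" for y z
      proof (intro exI[of _ "\<lambda>t. if t \<le> d then y t else z t"] conjI ballI)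
        fix t assume t: "t \<in> {c..e}"
        have "((\<lambda>t. if t \<le> d then y t else z t) has_vector_derivative (if t \<le> d then A t (y t) else A t (z t))) (at t within {c..e})"
          by (rule has_vector_derivative_glue[OF trans(3,4) that(1) bspec[OF that(3)] bspec[OF that(4)] _ t]) (simp_all add: that(1))
        then show "((\<lambda>t. if t \<le> d then y t else z t) has_vector_derivative A t (if t \<le> d then y t else z t)) (at t within {c..e})"
          by (simp add: if_distrib)
      qed (use that in auto)
      show "\<exists>x. x t0 = x0 \<and> (\<forall>t\<in>{c..e}. (x has_vector_derivative A t (x t)) (at t within {c..e}))"
      proof (cases "t0 \<le> d")
        case True
        with trans(1) ce t0 trans(4) obtain y where y: "y t0 = x0" "\<forall>t\<in>{c..d}. (y has_vector_derivative A t (y t)) (at t within {c..d})"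
          unfolding P_def by force
        from trans(2) ce trans(3,4) obtain z where "z d = y d" "\<forall>t\<in>{d..e}. (z has_vector_derivative A t (z t)) (at t within {d..e})"
          unfolding P_def by force
        with y True show ?thesis by (intro glue[of y z]) auto
      next
        case False
        with trans(2) ce t0 trans(3) obtain z where z: "z t0 = x0" "\<forall>t\<in>{d..e}. (z has_vector_derivative A t (z t)) (at t within {d..e})"
          unfolding P_def by force
        from trans(1) ce trans(3,4) obtain y where "y d = z d" "\<forall>t\<in>{c..d}. (y has_vector_derivative A t (y t)) (at t within {c..d})"
          unfolding P_def by force
        with z False show ?thesis by (intro glue[of y z]) auto
      qed
    qed
  next
    case (local x)
    show ?case
    \<comment> \<open>Any length below this bound makes 2 K (d - c) less than 1; the added 1 covers
      K = 0.\<close>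
    proof (intro exI[of _ "1 / (2 * K + 1)"] conjI allI impI)
      fix c d assume cd: "c \<le> x \<and> x \<le> d \<and> d - c < 1 / (2 * K + 1)"
      have "2 * K * (d - c) \<le> (2 * K + 1) * (d - c)" using cd K(1) by (intro mult_right_mono) auto
      also have "\<dots> < (2 * K + 1) * (1 / (2 * K + 1))" using cd K(1) by (intro mult_strict_left_mono) auto
      finally have *: "2 * K * (d - c) < 1" using K(1) by auto
      show "P c d" unfolding P_def
        by (intro impI ballI allI linear_ode_short_interval[of _ _ _ K])
          (use * K lin continuous_on_subset[OF cont] in \<open>auto\<close>)
    qed (use K(1) in auto)
  qed
  then show thesis using t0 that unfolding P_def by force
qed

section \<open>Metrics on open subsets of coordinate space\<close>

text \<open>The chart metric is a parameter here, so that the identities of Riemannian geometry can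
  be proved for coefficient functions on an open set, apart from the manifold.\<close>

definition christoffel_of :: "(real^4 \<Rightarrow> real^4 \<Rightarrow> real^4 \<Rightarrow> real) \<Rightarrow> real^4 \<Rightarrow> real^4 \<Rightarrow> real^4 \<Rightarrow> real^4" where
  "christoffel_of g q x y =
     matrix_inv (\<chi> i j. g q (axis i 1) (axis j 1)) *v
       (\<chi> l. (frechet_derivative (\<lambda>r. g r y (axis l 1)) (at q) x
            + frechet_derivative (\<lambda>r. g r x (axis l 1)) (at q) y
            - frechet_derivative (\<lambda>r. g r x y) (at q) (axis l 1)) / 2)"

definition riemann_of :: "(real^4 \<Rightarrow> real^4 \<Rightarrow> real^4 \<Rightarrow> real) \<Rightarrow> real^4 \<Rightarrow> real^4 \<Rightarrow> real^4 \<Rightarrow> real^4 \<Rightarrow> real^4" where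
  "riemann_of g q x y z =
     frechet_derivative (\<lambda>r. christoffel_of g r y z) (at q) x
     - frechet_derivative (\<lambda>r. christoffel_of g r x z) (at q) y
     + christoffel_of g q x (christoffel_of g q y z)
     - christoffel_of g q y (christoffel_of g q x z)"

lemma christoffel_eq: "christoffel M c = christoffel_of (metric_coord M c)"
  by (simp add: fun_eq_iff christoffel_def christoffel_of_def metric_matrix_def)

lemma riemann_coord_eq: "riemann_coord M c = riemann_of (metric_coord M c)"
  by (simp add: fun_eq_iff riemann_coord_def riemann_of_def christoffel_eq)

lemma matrix_inv_right:
  fixes A :: "real^'n^'n"
  shows "invertible A \<Longrightarrow> A ** matrix_inv A = mat 1"
  unfolding invertible_def matrix_inv_def by (rule someI2_ex) auto

lemma smooth_on_det:
  fixes A :: "'a::real_normed_vector \<Rightarrow> real^'n^'n"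
  assumes "open S" "\<And>i j. smooth_on (\<lambda>x. A x $ i $ j) S"
  shows "smooth_on (\<lambda>x. det (A x)) S"
  unfolding smooth_on_def det_def
  by (intro allI Ck_on_sum Ck_on_mult Ck_on_prod Ck_on_const smooth_on_Ck assms)

text \<open>Nondegeneracy stands in for the Lorentz signature: it makes the Gram matrix invertible
  and allows vectors to be compared through their products with all others.\<close>

locale local_metric =
  fixes U :: "(real^4) set" and g :: "real^4 \<Rightarrow> real^4 \<Rightarrow> real^4 \<Rightarrow> real"
  assumes open_dom: "open U"
    and sym: "q \<in> U \<Longrightarrow> g q x y = g q y x"
    and linear_left: "q \<in> U \<Longrightarrow> linear (\<lambda>x. g q x y)"
    and nondegenerate: "q \<in> U \<Longrightarrow> (\<And>y. g q x y = 0) \<Longrightarrow> x = 0"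
    and smooth: "smooth_on (\<lambda>q. g q x y) U"
begin

abbreviation "\<Gamma> \<equiv> christoffel_of g"
abbreviation "riem \<equiv> riemann_of g"
abbreviation "Dg q h x y \<equiv> frechet_derivative (\<lambda>r. g r x y) (at q) h"
abbreviation "D\<Gamma> q h x y \<equiv> frechet_derivative (\<lambda>r. \<Gamma> r x y) (at q) h"

lemma linear_right: "q \<in> U \<Longrightarrow> linear (g q x)"
  using linear_left[of q x] sym[of q _ x] by (simp add: linear_iff)

lemmas lin_simps =
  linear_add[OF linear_left] linear_scale[OF linear_left] linear_diff[OF linear_left] linear_0[OF linear_left] linear_neg[OF linear_left]
  linear_add[OF linear_right] linear_scale[OF linear_right] linear_diff[OF linear_right] linear_0[OF linear_right] linear_neg[OF linear_right]

lemma g_eqI: "q \<in> U \<Longrightarrow> (\<And>z. g q x z = g q y z) \<Longrightarrow> x = y"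
  using nondegenerate[of q "x - y"] by (simp add: lin_simps)

lemma g_differentiable: "q \<in> U \<Longrightarrow> (\<lambda>r. g r x y) differentiable (at q)"
  using smooth_on_has_derivative[OF smooth open_dom] by (auto simp: differentiable_def)

lemma g_has_derivative: "q \<in> U \<Longrightarrow> ((\<lambda>r. g r x y) has_derivative (\<lambda>h. Dg q h x y)) (at q)"
  using smooth_on_has_derivative[OF smooth open_dom] .

lemma linear_Dg:
  assumes "q \<in> U"
  shows "linear (\<lambda>h. Dg q h x y)" "linear (\<lambda>x. Dg q h x y)" "linear (\<lambda>y. Dg q h x y)"
proof -
  show "linear (\<lambda>h. Dg q h x y)" using has_derivative_linear[OF g_has_derivative[OF assms]] .
  show "linear (\<lambda>x. Dg q h x y)"
    by (rule linear_frechet_derivative_param[OF open_dom assms linear_left g_differentiable[OF assms]])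
  show "linear (\<lambda>y. Dg q h x y)"
    by (rule linear_frechet_derivative_param[OF open_dom assms linear_right g_differentiable[OF assms]])
qed

lemma Dg_sym: "q \<in> U \<Longrightarrow> Dg q h x y = Dg q h y x"
  by (rule fun_cong[OF frechet_derivative_transform_within_open[OF g_differentiable open_dom]])
    (auto intro: sym)

lemma gram_matrix_mult:
  assumes q: "q \<in> U"
  shows "g q x y = x \<bullet> ((\<chi> i j. g q (axis i 1) (axis j 1)) *v y)"
proof -
  have "g q x y = (\<Sum>j\<in>UNIV. \<Sum>i\<in>UNIV. x $ i * (y $ j * g q (axis i 1) (axis j 1)))"
    by (subst (1) basis_expansion[symmetric, of x], subst (1) basis_expansion[symmetric, of y])
      (simp add: inner_vec_def matrix_vector_mult_def scalar_mult_eq_scaleR linear_sum[OF linear_left[OF q]] linear_sum[OF linear_right[OF q]] lin_simps[OF q]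
        sum_distrib_left mult.assoc mult.commute mult.left_commute)
  also have "\<dots> = x \<bullet> ((\<chi> i j. g q (axis i 1) (axis j 1)) *v y)"
    by (subst sum.swap) (simp add: inner_vec_def matrix_vector_mult_def sum_distrib_left mult.commute)
  finally show ?thesis .
qed

lemma invertible_gram_matrix: "q \<in> U \<Longrightarrow> invertible (\<chi> i j. g q (axis i 1) (axis j 1))"
proof -
  let ?A = "\<chi> i j. g q (axis i 1) (axis j 1)"
  assume q: "q \<in> U"
  have "y = 0" if "?A *v y = 0" for y
    using nondegenerate[OF q, of y] gram_matrix_mult[OF q, of _ y] sym[OF q, of y] that by simp
  then show ?thesis
    using matrix_left_invertible_ker[of ?A] invertible_left_inverse[of ?A] by blast
qed

lemma gram_matrix_christoffel:
  assumes q: "q \<in> U"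
  shows "(\<chi> i j. g q (axis i 1) (axis j 1)) *v \<Gamma> q x y =
    (\<chi> l. (Dg q x y (axis l 1) + Dg q y x (axis l 1) - Dg q (axis l 1) x y) / 2)"
  unfolding christoffel_of_def matrix_vector_mul_assoc matrix_inv_right[OF invertible_gram_matrix[OF q]]
  by (rule matrix_vector_mul_lid)

text \<open>Contraction with the Gram matrix removes the matrix inverse. Symmetry, linearity and
  metric compatibility of \<open>\<Gamma>\<close> are all read off from this form.\<close>

lemma koszul:
  assumes q: "q \<in> U"
  shows "2 * g q (\<Gamma> q x y) z = Dg q x y z + Dg q y x z - Dg q z x y"
proof -
  let ?A = "\<chi> i j. g q (axis i 1) (axis j 1)"
  let ?K = "\<lambda>z. Dg q x y z + Dg q y x z - Dg q z x y"
  have lin: "linear ?K"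
    by (intro linear_compose_add linear_compose_sub linear_Dg[OF q])
  have "g q (\<Gamma> q x y) z = z \<bullet> (?A *v (\<Gamma> q x y))"
    unfolding sym[OF q, of "\<Gamma> q x y" z] by (rule gram_matrix_mult[OF q])
  also have "?A *v (\<Gamma> q x y) = (\<chi> l. ?K (axis l 1) / 2)" by (rule gram_matrix_christoffel[OF q])
  also have "z \<bullet> (\<chi> l. ?K (axis l 1) / 2) = (\<Sum>l\<in>UNIV. z $ l * ?K (axis l 1)) / 2"
    by (simp only: inner_vec_def vec_lambda_beta inner_real_def sum_divide_distrib times_divide_eq_right)
  also have "(\<Sum>l\<in>UNIV. z $ l * ?K (axis l 1)) = ?K (\<Sum>l\<in>UNIV. z $ l *\<^sub>R axis l 1)"
    by (simp only: linear_sum[OF lin] linear_scale[OF lin] o_def real_scaleR_def)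
  also have "(\<Sum>l\<in>UNIV. z $ l *\<^sub>R axis l 1) = z"
    using basis_expansion[of z] by (simp add: scalar_mult_eq_scaleR)
  finally show ?thesis by simp
qed

lemma christoffel_sym:
  assumes q: "q \<in> U"
  shows "\<Gamma> q x y = \<Gamma> q y x"
proof (rule g_eqI[OF q])
  fix z show "g q (\<Gamma> q x y) z = g q (\<Gamma> q y x) z"
    using koszul[OF q, of x y z] koszul[OF q, of y x z] Dg_sym[OF q, of x y z] by linarith
qed

lemma linear_christoffel: "q \<in> U \<Longrightarrow> linear (\<lambda>x. \<Gamma> q x y)" "q \<in> U \<Longrightarrow> linear (\<Gamma> q x)"
proof -
  show *: "linear (\<lambda>x. \<Gamma> q x y)" if q: "q \<in> U" for q y
  proof
    note l = linear_add[OF linear_Dg(1)[OF q]] linear_add[OF linear_Dg(2)[OF q]] linear_add[OF linear_Dg(3)[OF q]]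
      linear_scale[OF linear_Dg(1)[OF q]] linear_scale[OF linear_Dg(2)[OF q]] linear_scale[OF linear_Dg(3)[OF q]]
    have *: "g q (\<Gamma> q x y) z = (Dg q x y z + Dg q y x z - Dg q z x y) / 2" for x y z
      using koszul[OF q, of x y z] by simp
    fix a :: real and x1 x2
    show "\<Gamma> q (x1 + x2) y = \<Gamma> q x1 y + \<Gamma> q x2 y"
      by (rule g_eqI[OF q]) (simp add: lin_simps[OF q] l * field_simps)
    show "\<Gamma> q (a *\<^sub>R x1) y = a *\<^sub>R \<Gamma> q x1 y"
      by (rule g_eqI[OF q]) (simp add: lin_simps[OF q] l * field_simps)
  qed
  show "linear (\<Gamma> q x)" if q: "q \<in> U"
    using *[OF q, of x] christoffel_sym[OF q, of x] by (simp add: linear_iff)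
qed

lemmas christoffel_lin_simps =
  linear_add[OF linear_christoffel(1)] linear_scale[OF linear_christoffel(1)] linear_diff[OF linear_christoffel(1)]
  linear_add[OF linear_christoffel(2)] linear_scale[OF linear_christoffel(2)] linear_diff[OF linear_christoffel(2)]
  linear_neg[OF linear_christoffel(1)] linear_neg[OF linear_christoffel(2)]
  linear_0[OF linear_christoffel(1)] linear_0[OF linear_christoffel(2)]

lemma metric_compatible:
  assumes "q \<in> U"
  shows "Dg q h x y = g q (\<Gamma> q h x) y + g q x (\<Gamma> q h y)"
  using koszul[OF assms, of h x y] koszul[OF assms, of h y x] sym[OF assms, of x "\<Gamma> q h y"]
    Dg_sym[OF assms, of x y h]
  by simp

text \<open>\<open>matrix_inv\<close> is given by a choice and says nothing about regularity. By
  Cramer's rule the components are quotients of determinants, which are polynomials in smooth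
  entries.\<close>

lemma smooth_christoffel: "smooth_on (\<lambda>q. \<Gamma> q x y) U"
proof -
  let ?A = "\<lambda>q. \<chi> i j. g q (axis i 1) (axis j 1)"
  let ?b = "\<lambda>q. \<chi> l. (Dg q x y (axis l 1) + Dg q y x (axis l 1) - Dg q (axis l 1) x y) / 2"
  \<comment> \<open>The Gram matrix with column k replaced by the right-hand side, as in Cramer's
    rule.\<close>
  let ?C = "\<lambda>q k. \<chi> i j. if j = k then ?b q $ i else ?A q $ i $ j"
  have b: "smooth_on (\<lambda>q. ?b q $ i) U" for i
  proof -
    note d = smooth_on_Ck[OF smooth_on_frechet_derivative[OF smooth]]
    show ?thesis
      unfolding smooth_on_def vec_lambda_beta
      by (rule allI, rule Ck_on_bounded_linear_compose[OF open_dom bounded_linear_divide],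
          rule Ck_on_diff[OF open_dom Ck_on_add[OF open_dom d d] d])
  qed
  have sC: "smooth_on (\<lambda>q. ?C q k $ i $ j) U" for i j k
  proof (cases "j = k")
    case True
    then show ?thesis using b[of i] by (simp only: vec_lambda_beta if_True refl)
  next
    case False
    then show ?thesis using smooth by (simp only: vec_lambda_beta if_False simp_thms)
  qed
  have s: "Ck_on n (\<lambda>q. \<chi> k. det (?C q k) * inverse (det (?A q))) U" for n
  proof (rule Ck_on_vec[OF open_dom])
    fix k
    have dA: "det (?A q) \<noteq> 0" if "q \<in> U" for q
      using invertible_gram_matrix[OF that] by (simp add: invertible_det_nz)
    have A: "Ck_on n (\<lambda>q. det (?A q)) U"
      by (rule smooth_on_Ck, rule smooth_on_det[OF open_dom], unfold vec_lambda_beta, rule smooth)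
    have C: "Ck_on n (\<lambda>q. det (?C q k)) U"
      by (rule smooth_on_Ck, rule smooth_on_det[OF open_dom sC])
    show "Ck_on n (\<lambda>q. (\<chi> k. det (?C q k) * inverse (det (?A q))) $ k) U"
      using Ck_on_mult[OF open_dom C Ck_on_inverse[OF open_dom dA A]] unfolding vec_lambda_beta .
  qed
  have e: "\<Gamma> q x y = (\<chi> k. det (?C q k) * inverse (det (?A q)))" if q: "q \<in> U" for q
  proof -
    have "det (?A q) \<noteq> 0"
      using invertible_gram_matrix[OF q] by (simp add: invertible_det_nz)
    from iffD1[OF cramer[OF this] gram_matrix_christoffel[OF q]]
    show ?thesis unfolding divide_inverse .
  qed
  show ?thesis
    unfolding smooth_on_def by (rule allI, rule Ck_on_cong[OF open_dom e s])
qed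

lemma christoffel_has_derivative: "q \<in> U \<Longrightarrow> ((\<lambda>r. \<Gamma> r x y) has_derivative (\<lambda>h. D\<Gamma> q h x y)) (at q)"
  using smooth_on_has_derivative[OF smooth_christoffel open_dom] .

lemma linear_D\<Gamma>:
  assumes "q \<in> U"
  shows "linear (\<lambda>h. D\<Gamma> q h x y)" "linear (\<lambda>x. D\<Gamma> q h x y)" "linear (\<lambda>y. D\<Gamma> q h x y)"
proof -
  have d: "(\<lambda>r. \<Gamma> r x y) differentiable (at q)" for x y
    by (rule differentiableI[OF christoffel_has_derivative[OF assms]])
  show "linear (\<lambda>h. D\<Gamma> q h x y)" using has_derivative_linear[OF christoffel_has_derivative[OF assms]] .
  show "linear (\<lambda>x. D\<Gamma> q h x y)"
    by (rule linear_frechet_derivative_param[OF open_dom assms linear_christoffel(1) d])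
  show "linear (\<lambda>y. D\<Gamma> q h x y)"
    by (rule linear_frechet_derivative_param[OF open_dom assms linear_christoffel(2) d])
qed

lemma D\<Gamma>_sym: "q \<in> U \<Longrightarrow> D\<Gamma> q h x y = D\<Gamma> q h y x"
  by (rule fun_cong[OF frechet_derivative_transform_within_open[OF _ open_dom]])
    (auto intro: christoffel_sym differentiableI[OF christoffel_has_derivative])

lemma linear_riem:
  assumes q: "q \<in> U"
  shows "linear (\<lambda>x. riem q x y z)" "linear (\<lambda>y. riem q x y z)" "linear (riem q x y)"
proof -
  note l = linear_add[OF linear_D\<Gamma>(1)[OF q]] linear_add[OF linear_D\<Gamma>(2)[OF q]] linear_add[OF linear_D\<Gamma>(3)[OF q]]
    linear_scale[OF linear_D\<Gamma>(1)[OF q]] linear_scale[OF linear_D\<Gamma>(2)[OF q]] linear_scale[OF linear_D\<Gamma>(3)[OF q]]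
    christoffel_lin_simps[OF q]
  show "linear (\<lambda>x. riem q x y z)"
    by (rule linearI) (simp_all add: riemann_of_def l algebra_simps)
  show "linear (\<lambda>y. riem q x y z)"
    by (rule linearI) (simp_all add: riemann_of_def l algebra_simps)
  show "linear (riem q x y)"
    by (rule linearI) (simp_all add: riemann_of_def l algebra_simps)
qed

lemma riem_antisym: "riem q x y z = - riem q y x z"
  by (simp add: riemann_of_def)

text \<open>Torsion freeness: with \<open>\<Gamma>\<close> and \<open>D\<Gamma>\<close> symmetric in
  their lower arguments, the terms cancel in pairs.\<close>

lemma riem_bianchi:
  assumes q: "q \<in> U"
  shows "riem q x y z + riem q y z x + riem q z x y = 0"
  unfolding riemann_of_def D\<Gamma>_sym[OF q, of y z x] D\<Gamma>_sym[OF q, of x z y] D\<Gamma>_sym[OF q, of x y z]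
    christoffel_sym[OF q, of x y] christoffel_sym[OF q, of y z] christoffel_sym[OF q, of z x]
  by simp

lemma continuous_riem: "continuous_on U (\<lambda>q. riem q x y z)"
proof -
  have c: "continuous_on U (\<lambda>q. \<Gamma> q x y)" for x y
    by (rule smooth_on_imp_continuous_on[OF smooth_christoffel open_dom])
  have d: "continuous_on U (\<lambda>q. D\<Gamma> q h x y)" for h x y
    by (rule smooth_on_imp_continuous_on[OF smooth_on_frechet_derivative[OF smooth_christoffel] open_dom])
  show ?thesis
    unfolding riemann_of_def
    by (intro continuous_on_add continuous_on_diff c d continuous_on_linear_family[OF linear_christoffel(2)])
qed

text \<open>For constant \<open>z\<close>, half the commutator of the second derivatives of g(z,z)
  along \<open>x\<close> and \<open>y\<close> is this product, and second derivatives
  commute.\<close>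

lemma riem_skew_diag:
  assumes q: "q \<in> U"
  shows "g q (riem q x y z) z = 0"
proof -
  let ?F = "\<lambda>r. g r z z"
  have 1: "frechet_derivative (\<lambda>r. frechet_derivative ?F (at r) y) (at q) x =
     2 * (Dg q x (\<Gamma> q y z) z + g q (D\<Gamma> q x y z) z)" for x y
  proof -
    have "((\<lambda>r. g r (\<Gamma> r y z) z) has_derivative (\<lambda>h. Dg q h (\<Gamma> q y z) z + g q (D\<Gamma> q h y z) z)) (at q within U)"
      by (rule has_derivative_linear_family[where F="\<lambda>r v. g r v z" and F'="\<lambda>h v. Dg q h v z", OF linear_left q
            has_derivative_at_withinI[OF g_has_derivative[OF q]] linear_Dg(2)[OF q]
            has_derivative_at_withinI[OF christoffel_has_derivative[OF q]]])
    then have "((\<lambda>r. g r (\<Gamma> r y z) z) has_derivative (\<lambda>h. Dg q h (\<Gamma> q y z) z + g q (D\<Gamma> q h y z) z)) (at q)"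
      using at_within_open[OF q open_dom] by simp
    from has_derivative_mult_right[OF this, of 2]
    have "((\<lambda>r. frechet_derivative ?F (at r) y) has_derivative (\<lambda>h. 2 * (Dg q h (\<Gamma> q y z) z + g q (D\<Gamma> q h y z) z))) (at q)"
      by (rule has_derivative_transform_within_open[OF _ open_dom q])
        (simp add: metric_compatible[of _ z z y] sym[of _ z "\<Gamma> _ y z"])
    then show ?thesis by (simp add: frechet_derivative_eqI)
  qed
  have "2 * (Dg q x (\<Gamma> q y z) z + g q (D\<Gamma> q x y z) z) = 2 * (Dg q y (\<Gamma> q x z) z + g q (D\<Gamma> q y x z) z)"
    unfolding 1[symmetric] by (rule second_derivative_symmetric[OF open_dom q smooth])
  then show ?thesis
    by (simp add: riemann_of_def lin_simps[OF q] metric_compatible[OF q] sym[OF q, of "\<Gamma> q y z"])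
qed

lemma riem_skew: "q \<in> U \<Longrightarrow> g q (riem q x y z) w = - g q (riem q x y w) z"
  using riem_skew_diag[of q x y "z + w"] riem_skew_diag[of q x y z] riem_skew_diag[of q x y w]
  by (simp add: lin_simps linear_add[OF linear_riem(3)])

text \<open>The classical octahedron argument: four instances of the cyclic identity, combined with
  skewness in the first and in the last pair of arguments.\<close>

lemma riem_pair_sym:
  assumes q: "q \<in> U"
  shows "g q (riem q x y z) w = g q (riem q z w x) y"
proof -
  have b: "g q (riem q a b c) d + g q (riem q b c a) d + g q (riem q c a b) d = 0" for a b c d
    using arg_cong[OF riem_bianchi[OF q, of a b c], of "\<lambda>v. g q v d"] by (simp add: lin_simps[OF q])
  have a: "g q (riem q a b c) d = - g q (riem q b a c) d" for a b c d
    by (subst riem_antisym) (simp add: lin_simps[OF q])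
  note s = riem_skew[OF q]
  show ?thesis
    using b[of x y z w] b[of y z w x] b[of z w x y] b[of w x y z]
      s[of x y z w] s[of y z w x] s[of z x y w] s[of y z x w] s[of z w y x] s[of w y z x] s[of z w x y] s[of w x y z] s[of w x z y] s[of x y w z]
      a[of w x z y] a[of x z w y] a[of z x w y] a[of w y x z] a[of y w x z] a[of x w z y] a[of w y z x]
      s[of x z w y] s[of y w x z]
    by linarith
qed

end

section \<open>Change of coordinates\<close>

locale metric_transform = A: local_metric U g + B: local_metric U' g'
  for U g U' g' +
  fixes \<phi> :: "real^4 \<Rightarrow> real^4"
  assumes smooth_map: "smooth_on \<phi> U"
    and maps: "q \<in> U \<Longrightarrow> \<phi> q \<in> U'"
    and surj_D: "q \<in> U \<Longrightarrow> surj (frechet_derivative \<phi> (at q))"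
    and pullback: "q \<in> U \<Longrightarrow> g q x y = g' (\<phi> q) (frechet_derivative \<phi> (at q) x) (frechet_derivative \<phi> (at q) y)"
begin

abbreviation "D1 q \<equiv> frechet_derivative \<phi> (at q)"
abbreviation "D2 q h v \<equiv> frechet_derivative (\<lambda>r. D1 r v) (at q) h"
abbreviation "D3 q h x y \<equiv> frechet_derivative (\<lambda>r. D2 r x y) (at q) h"

lemma map_derivatives:
  assumes q: "q \<in> U"
  shows "(\<phi> has_derivative D1 q) (at q)" "((\<lambda>r. D1 r v) has_derivative (\<lambda>h. D2 q h v)) (at q)"
    "((\<lambda>r. D2 r x y) has_derivative (\<lambda>h. D3 q h x y)) (at q)"
    "linear (D1 q)" "linear (\<lambda>h. D2 q h v)" "linear (D2 q h)"
    "D2 q x y = D2 q y x" "D3 q x y z = D3 q y x z"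
proof -
  note s1 = smooth_on_frechet_derivative[OF smooth_map]
  show 1: "(\<phi> has_derivative D1 q) (at q)"
    by (rule smooth_on_has_derivative[OF smooth_map A.open_dom q])
  show 2: "((\<lambda>r. D1 r v) has_derivative (\<lambda>h. D2 q h v)) (at q)" for v
    by (rule smooth_on_has_derivative[OF s1 A.open_dom q])
  show 3: "((\<lambda>r. D2 r x y) has_derivative (\<lambda>h. D3 q h x y)) (at q)"
    by (rule smooth_on_has_derivative[OF smooth_on_frechet_derivative[OF s1] A.open_dom q])
  show "linear (D1 q)" "linear (\<lambda>h. D2 q h v)"
    using has_derivative_linear[OF 1] has_derivative_linear[OF 2] by auto
  have "linear (D1 r)" if "r \<in> U" for r
    using has_derivative_linear[OF smooth_on_has_derivative[OF smooth_map A.open_dom that]] .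
  then show "linear (D2 q h)"
    by (rule linear_frechet_derivative_param[OF A.open_dom q]) (use 2 in \<open>auto simp: differentiable_def\<close>)
  show "D2 q x y = D2 q y x"
    by (rule second_derivative_symmetric[OF A.open_dom q smooth_map])
  show "D3 q x y z = D3 q y x z"
    by (rule second_derivative_symmetric[OF A.open_dom q s1])
qed

text \<open>The second vector argument \<open>y\<close> is kept fixed; the moving second argument is
  inserted afterwards by \<open>has_derivative_linear_family\<close>.\<close>

lemma compose_has_derivative:
  fixes f :: "real^4 \<Rightarrow> real^4 \<Rightarrow> real^4 \<Rightarrow> 'b::real_normed_vector"
  assumes q: "q \<in> U" and f: "\<And>r. r \<in> U' \<Longrightarrow> linear (\<lambda>x. f r x y)"
    and d: "\<And>x. ((\<lambda>r. f r x y) has_derivative (\<lambda>h. f' h x)) (at (\<phi> q))" "\<And>h. linear (f' h)"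
    and x: "(x has_derivative x') (at q)"
  shows "((\<lambda>r. f (\<phi> r) (x r) y) has_derivative (\<lambda>h. f' (D1 q h) (x q) + f (\<phi> q) (x' h) y)) (at q)"
proof -
  have "((\<lambda>r. f (\<phi> r) (x r) y) has_derivative (\<lambda>h. f' (D1 q h) (x q) + f (\<phi> q) (x' h) y)) (at q within U)"
  proof (rule has_derivative_linear_family[where F="\<lambda>r x. f (\<phi> r) x y" and F'="\<lambda>h. f' (D1 q h)", OF _ q _ d(2)])
    fix r assume "r \<in> U" then show "linear (\<lambda>x. f (\<phi> r) x y)" by (intro f maps)
  next
    fix v show "((\<lambda>s. f (\<phi> s) v y) has_derivative (\<lambda>h. f' (D1 q h) v)) (at q within U)"
      using has_derivative_compose[OF map_derivatives(1)[OF q] d(1)] by (rule has_derivative_at_withinI)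
  qed (rule has_derivative_at_withinI[OF x])
  then show ?thesis using at_within_open[OF q A.open_dom] by simp
qed

lemma Dg_transform:
  assumes q: "q \<in> U"
  shows "A.Dg q h x y = B.Dg (\<phi> q) (D1 q h) (D1 q x) (D1 q y) + g' (\<phi> q) (D2 q h x) (D1 q y) + g' (\<phi> q) (D1 q x) (D2 q h y)"
proof -
  have "((\<lambda>r. g' (\<phi> r) (D1 r x) w) has_derivative (\<lambda>h. B.Dg (\<phi> q) (D1 q h) (D1 q x) w + g' (\<phi> q) (D2 q h x) w)) (at q)" for w
    by (rule compose_has_derivative[where f=g' and f'="\<lambda>h v. B.Dg (\<phi> q) h v w" and x="\<lambda>r. D1 r x" and x'="\<lambda>h. D2 q h x",
          OF q B.linear_left B.g_has_derivative[OF maps[OF q]] B.linear_Dg(2)[OF maps[OF q]] map_derivatives(2)[OF q]])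
  then have "((\<lambda>r. g' (\<phi> r) (D1 r x) (D1 r y)) has_derivative
    (\<lambda>h. B.Dg (\<phi> q) (D1 q h) (D1 q x) (D1 q y) + g' (\<phi> q) (D2 q h x) (D1 q y) + g' (\<phi> q) (D1 q x) (D2 q h y))) (at q within U)"
    using has_derivative_linear_family[where F="\<lambda>r. g' (\<phi> r) (D1 r x)" and F'="\<lambda>h w. B.Dg (\<phi> q) (D1 q h) (D1 q x) w + g' (\<phi> q) (D2 q h x) w"
        and x="\<lambda>r. D1 r y" and x'="\<lambda>h. D2 q h y", OF B.linear_right[OF maps] q has_derivative_at_withinI
        linear_compose_add[OF B.linear_Dg(3)[OF maps[OF q]] B.linear_right[OF maps[OF q]]] has_derivative_at_withinI[OF map_derivatives(2)[OF q]]]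
    by blast
  then have "((\<lambda>r. g r x y) has_derivative
    (\<lambda>h. B.Dg (\<phi> q) (D1 q h) (D1 q x) (D1 q y) + g' (\<phi> q) (D2 q h x) (D1 q y) + g' (\<phi> q) (D1 q x) (D2 q h y))) (at q)"
    unfolding at_within_open[OF q A.open_dom]
    by (rule has_derivative_transform_within_open[OF _ A.open_dom q]) (simp add: pullback)
  then show ?thesis by (simp add: frechet_derivative_eqI)
qed

text \<open>Differentiating the pullback identity adds terms with \<open>D2\<close> to each
  derivative of the metric. In the Koszul combination the symmetry of \<open>D2\<close> cancels all
  of them except 2 g'(\<open>D2 q x y\<close>, z').\<close>

lemma christoffel_transform:
  assumes q: "q \<in> U"
  shows "B.\<Gamma> (\<phi> q) (D1 q x) (D1 q y) = D1 q (A.\<Gamma> q x y) - D2 q x y"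
proof (rule B.g_eqI[OF maps[OF q]])
  fix z'
  \<comment> \<open>Surjectivity of the differential makes every test vector an image, so that both
    Koszul formulas can be compared.\<close>
  obtain z where z: "z' = D1 q z" using surj_D[OF q] by (metis surjD)
  have "2 * g' (\<phi> q) (D1 q (A.\<Gamma> q x y)) z' = 2 * g q (A.\<Gamma> q x y) z"
    by (simp add: pullback[OF q] z)
  then show "g' (\<phi> q) (B.\<Gamma> (\<phi> q) (D1 q x) (D1 q y)) z' = g' (\<phi> q) (D1 q (A.\<Gamma> q x y) - D2 q x y) z'"
    using B.koszul[OF maps[OF q], of "D1 q x" "D1 q y" z'] A.koszul[OF q, of x y z]
      map_derivatives(7)[OF q, of y x] map_derivatives(7)[OF q, of z x] map_derivatives(7)[OF q, of z y]
      B.sym[OF maps[OF q], of "D1 q y" "D2 q x z"] B.sym[OF maps[OF q], of "D1 q x" "D2 q y z"]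
    by (simp add: Dg_transform[OF q] z B.lin_simps[OF maps[OF q]])
qed

lemma christoffel_derivative_transform:
  assumes q: "q \<in> U"
  shows "B.D\<Gamma> (\<phi> q) (D1 q h) (D1 q x) (D1 q y) + B.\<Gamma> (\<phi> q) (D2 q h x) (D1 q y) + B.\<Gamma> (\<phi> q) (D1 q x) (D2 q h y)
    = D2 q h (A.\<Gamma> q x y) + D1 q (A.D\<Gamma> q h x y) - D3 q h x y"
proof -
  have "((\<lambda>r. B.\<Gamma> (\<phi> r) (D1 r x) w) has_derivative (\<lambda>h. B.D\<Gamma> (\<phi> q) (D1 q h) (D1 q x) w + B.\<Gamma> (\<phi> q) (D2 q h x) w)) (at q)" for w
    by (rule compose_has_derivative[where f=B.\<Gamma> and f'="\<lambda>h v. B.D\<Gamma> (\<phi> q) h v w" and x="\<lambda>r. D1 r x" and x'="\<lambda>h. D2 q h x",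
          OF q B.linear_christoffel(1) B.christoffel_has_derivative[OF maps[OF q]] B.linear_D\<Gamma>(2)[OF maps[OF q]] map_derivatives(2)[OF q]])
  then have "((\<lambda>r. B.\<Gamma> (\<phi> r) (D1 r x) (D1 r y)) has_derivative
    (\<lambda>h. B.D\<Gamma> (\<phi> q) (D1 q h) (D1 q x) (D1 q y) + B.\<Gamma> (\<phi> q) (D2 q h x) (D1 q y) + B.\<Gamma> (\<phi> q) (D1 q x) (D2 q h y))) (at q within U)"
    using has_derivative_linear_family[where F="\<lambda>r. B.\<Gamma> (\<phi> r) (D1 r x)" and F'="\<lambda>h w. B.D\<Gamma> (\<phi> q) (D1 q h) (D1 q x) w + B.\<Gamma> (\<phi> q) (D2 q h x) w"
        and x="\<lambda>r. D1 r y" and x'="\<lambda>h. D2 q h y", OF B.linear_christoffel(2)[OF maps] q has_derivative_at_withinI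
        linear_compose_add[OF B.linear_D\<Gamma>(3)[OF maps[OF q]] B.linear_christoffel(2)[OF maps[OF q]]] has_derivative_at_withinI[OF map_derivatives(2)[OF q]]]
    by blast
  then have 1: "((\<lambda>r. D1 r (A.\<Gamma> r x y) - D2 r x y) has_derivative
    (\<lambda>h. B.D\<Gamma> (\<phi> q) (D1 q h) (D1 q x) (D1 q y) + B.\<Gamma> (\<phi> q) (D2 q h x) (D1 q y) + B.\<Gamma> (\<phi> q) (D1 q x) (D2 q h y))) (at q)"
    unfolding at_within_open[OF q A.open_dom]
    by (rule has_derivative_transform_within_open[OF _ A.open_dom q]) (simp add: christoffel_transform)
  have "((\<lambda>r. D1 r (A.\<Gamma> r x y)) has_derivative (\<lambda>h. D2 q h (A.\<Gamma> q x y) + D1 q (A.D\<Gamma> q h x y))) (at q within U)"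
    by (rule has_derivative_linear_family[where F=D1 and F'="D2 q" and x="\<lambda>r. A.\<Gamma> r x y", OF map_derivatives(4) q
          has_derivative_at_withinI[OF map_derivatives(2)[OF q]] map_derivatives(6)[OF q] has_derivative_at_withinI[OF A.christoffel_has_derivative[OF q]]])
  then have 2: "((\<lambda>r. D1 r (A.\<Gamma> r x y) - D2 r x y) has_derivative (\<lambda>h. D2 q h (A.\<Gamma> q x y) + D1 q (A.D\<Gamma> q h x y) - D3 q h x y)) (at q)"
    unfolding at_within_open[OF q A.open_dom] by (intro has_derivative_diff map_derivatives q)
  show ?thesis using fun_cong[OF has_derivative_unique[OF 1 2]] .
qed

text \<open>The inhomogeneous term of the Christoffel law disappears: third derivatives of the map
  drop out by symmetry, and the \<open>D2\<close> terms of the derivative part cancel those of the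
  quadratic part.\<close>

lemma riemann_transform:
  assumes q: "q \<in> U"
  shows "B.riem (\<phi> q) (D1 q x) (D1 q y) (D1 q z) = D1 q (A.riem q x y z)"
proof -
  note l = B.christoffel_lin_simps[OF maps[OF q]] linear_add[OF map_derivatives(4)[OF q]] linear_diff[OF map_derivatives(4)[OF q]]
  have E: "B.D\<Gamma> (\<phi> q) (D1 q h) (D1 q x) (D1 q y) = D2 q h (A.\<Gamma> q x y) + D1 q (A.D\<Gamma> q h x y) - D3 q h x y
      - B.\<Gamma> (\<phi> q) (D2 q h x) (D1 q y) - B.\<Gamma> (\<phi> q) (D1 q x) (D2 q h y)" for h x y
    using christoffel_derivative_transform[OF q, of x y h] by (simp add: algebra_simps)
  show ?thesis
    using map_derivatives(7)[OF q, of x y] map_derivatives(8)[OF q, of z y x]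
    by (simp add: riemann_of_def christoffel_transform[OF q] E l)
qed

end

section \<open>Lorentzian manifolds\<close>

lemma local_metric_subset:
  assumes "local_metric U g" "open V" "V \<subseteq> U"
  shows "local_metric V g"
proof -
  interpret local_metric U g by fact
  show ?thesis
  proof (rule local_metric.intro)
    show "smooth_on (\<lambda>q. g q x y) V" for x y by (rule smooth_on_subset[OF smooth open_dom assms(2,3)])
    fix q assume "q \<in> V"
    then have q: "q \<in> U" using assms(3) by blast
    show "g q x y = g q y x" for x y by (rule sym[OF q])
    show "linear (\<lambda>x. g q x y)" for y by (rule linear_left[OF q])
    show "(\<And>y. g q x y = 0) \<Longrightarrow> x = 0" for x by (rule nondegenerate[OF q])
  qed fact
qed

locale lorentz_manifold =
  fixes M :: "'a::topological_space lorentz_structure"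
  assumes atlas: "maximal_smooth_atlas (atlas M)" and metric: "lorentzian_metric M"
begin

abbreviation "trm c d \<equiv> chart_map d \<circ> chart_inv c"
abbreviation "TD c d p \<equiv> frechet_derivative (trm c d) (at (chart_map c p))"
abbreviation "TD2 c d p h v \<equiv> frechet_derivative (\<lambda>r. frechet_derivative (trm c d) (at r) v) (at (chart_map c p)) h"
abbreviation "overlap c d \<equiv> chart_map c ` (chart_dom c \<inter> chart_dom d)"
abbreviation "img c \<equiv> chart_map c ` chart_dom c"

lemma charts_at_iff: "c \<in> charts_at M p \<longleftrightarrow> c \<in> atlas M \<and> p \<in> chart_dom c"
  by (simp add: charts_at_def)

lemma charts_at_nonempty: obtains c where "c \<in> charts_at M p"
proof -
  have "(\<Union>c\<in>atlas M. chart_dom c) = UNIV" using atlas by (simp add: maximal_smooth_atlas_def)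
  then have "p \<in> (\<Union>c\<in>atlas M. chart_dom c)" by simp
  then show thesis using that unfolding charts_at_iff by blast
qed

lemma chart_facts:
  assumes "c \<in> atlas M"
  shows "open (chart_dom c)" "open (img c)" "continuous_on (chart_dom c) (chart_map c)"
    "continuous_on (img c) (chart_inv c)" "p \<in> chart_dom c \<Longrightarrow> chart_inv c (chart_map c p) = p"
proof -
  have "is_chart c" using assms atlas by (simp add: maximal_smooth_atlas_def)
  then show "open (chart_dom c)" "open (img c)" "continuous_on (chart_dom c) (chart_map c)"
    "continuous_on (img c) (chart_inv c)" "p \<in> chart_dom c \<Longrightarrow> chart_inv c (chart_map c p) = p"
    by (auto simp: is_chart_def homeomorphism_def)
qed

lemma open_chart_image:
  assumes c: "c \<in> atlas M" and "open V"
  shows "open (chart_map c ` (chart_dom c \<inter> V))"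
proof -
  have "chart_map c ` (chart_dom c \<inter> V) = img c \<inter> chart_inv c -` V"
    using chart_facts(5)[OF c] by (auto simp: image_iff)
  then show ?thesis
    using continuous_open_preimage[OF chart_facts(4)[OF c] chart_facts(2)[OF c] \<open>open V\<close>] by simp
qed

lemma open_overlap: "c \<in> atlas M \<Longrightarrow> d \<in> atlas M \<Longrightarrow> open (overlap c d)"
  by (intro open_chart_image chart_facts(1))

lemma smooth_trans: "c \<in> atlas M \<Longrightarrow> d \<in> atlas M \<Longrightarrow> smooth_on (trm c d) (overlap c d)"
  using atlas unfolding maximal_smooth_atlas_def compatible_def by blast

lemma trans_has_derivative:
  assumes "c \<in> charts_at M p" "d \<in> charts_at M p"
  shows "(trm c d has_derivative TD c d p) (at (chart_map c p))"
  by (rule smooth_on_has_derivative[OF smooth_trans open_overlap]) (use assms in \<open>auto simp: charts_at_iff\<close>)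

lemma linear_TD: "c \<in> charts_at M p \<Longrightarrow> d \<in> charts_at M p \<Longrightarrow> linear (TD c d p)"
  using trans_has_derivative has_derivative_linear by blast

lemma TD_chain:
  assumes c: "c \<in> charts_at M p" and d: "d \<in> charts_at M p" and e: "e \<in> charts_at M p"
  shows "TD d e p (TD c d p x) = TD c e p x"
proof -
  let ?V = "chart_map c ` (chart_dom c \<inter> (chart_dom d \<inter> chart_dom e))"
  have at: "c \<in> atlas M" "d \<in> atlas M" "e \<in> atlas M" "p \<in> chart_dom c \<inter> (chart_dom d \<inter> chart_dom e)"
    using assms by (auto simp: charts_at_iff)
  have "open ?V" using at chart_facts(1) by (intro open_chart_image open_Int) auto
  moreover have "chart_map c p \<in> ?V" using at by auto
  moreover have "(trm d e \<circ> trm c d) r = trm c e r" if "r \<in> ?V" for r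
    using that chart_facts(5)[OF at(1)] chart_facts(5)[OF at(2)] by auto
  moreover have "(trm d e has_derivative TD d e p) (at (trm c d (chart_map c p)))"
    using trans_has_derivative[OF d e] chart_facts(5)[OF at(1)] at(4) by simp
  then have "(trm d e \<circ> trm c d has_derivative (TD d e p \<circ> TD c d p)) (at (chart_map c p))"
    by (rule diff_chain_at[OF trans_has_derivative[OF c d]])
  ultimately have "(trm c e has_derivative (TD d e p \<circ> TD c d p)) (at (chart_map c p))"
    by (elim has_derivative_transform_within_open)
  from frechet_derivative_eqI[OF this] show ?thesis by simp
qed

lemma TD_self:
  assumes c: "c \<in> charts_at M p"
  shows "TD c c p x = x"
proof -
  have at: "c \<in> atlas M" "p \<in> chart_dom c" using assms by (auto simp: charts_at_iff)
  have "(trm c c has_derivative (\<lambda>x. x)) (at (chart_map c p))"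
    by (rule has_derivative_transform_within_open[OF has_derivative_ident chart_facts(2)[OF at(1)]])
      (use at chart_facts(5)[OF at(1)] in auto)
  then show ?thesis by (simp add: frechet_derivative_eqI)
qed

lemma tvec_of_components_in: "c \<in> charts_at M p \<Longrightarrow> tvec_of_components M c p x \<in> tangent_space M p"
  by (auto simp: tangent_space_def tvec_of_components_def TD_chain)

lemma tvec_of_components_nth:
  "c \<in> charts_at M p \<Longrightarrow> d \<in> charts_at M p \<Longrightarrow> tvec_of_components M c p x d = TD c d p x"
  by (simp add: tvec_of_components_def)

lemma tvec_of_components_self: "c \<in> charts_at M p \<Longrightarrow> tvec_of_components M c p x c = x"
  by (simp add: tvec_of_components_def TD_self)

lemma tangent_nth: "v \<in> tangent_space M p \<Longrightarrow> c \<in> charts_at M p \<Longrightarrow> d \<in> charts_at M p \<Longrightarrow> v d = TD c d p (v c)"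
  unfolding tangent_space_def by blast

lemma tangent_outside: "v \<in> tangent_space M p \<Longrightarrow> c \<notin> charts_at M p \<Longrightarrow> v c = 0"
  unfolding tangent_space_def by blast

lemma tangent_eqI:
  assumes "v \<in> tangent_space M p" "w \<in> tangent_space M p" "c \<in> charts_at M p" "v c = w c"
  shows "v = w"
proof
  fix d show "v d = w d"
    using assms tangent_nth[of v p c d] tangent_nth[of w p c d] tangent_outside[of v p d] tangent_outside[of w p d]
    by (cases "d \<in> charts_at M p") auto
qed

lemma tvec_of_components_eq: "v \<in> tangent_space M p \<Longrightarrow> c \<in> charts_at M p \<Longrightarrow> tvec_of_components M c p (v c) = v"
  by (rule tangent_eqI[OF tvec_of_components_in]) (auto simp: tvec_of_components_self)

lemma tvec_of_components_change:
  assumes "c \<in> charts_at M p" "d \<in> charts_at M p"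
  shows "tvec_of_components M d p (TD c d p x) = tvec_of_components M c p x"
  using tvec_of_components_eq[OF tvec_of_components_in[OF assms(1)] assms(2), of x] unfolding tvec_of_components_nth[OF assms, of x] .

lemma tangent_lin: "u \<in> tangent_space M p \<Longrightarrow> v \<in> tangent_space M p \<Longrightarrow> (\<lambda>c. a *\<^sub>R u c + b *\<^sub>R v c) \<in> tangent_space M p"
proof -
  assume u: "u \<in> tangent_space M p" and v: "v \<in> tangent_space M p"
  have "a *\<^sub>R u d + b *\<^sub>R v d = TD c d p (a *\<^sub>R u c + b *\<^sub>R v c)" if "c \<in> charts_at M p" "d \<in> charts_at M p" for c d
    using tangent_nth[OF u that] tangent_nth[OF v that] linear_TD[OF that] by (simp add: linear_add linear_scale)
  moreover have "a *\<^sub>R u c + b *\<^sub>R v c = 0" if "c \<notin> charts_at M p" for c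
    using tangent_outside[OF u that] tangent_outside[OF v that] by simp
  ultimately show ?thesis unfolding tangent_space_def by blast
qed

lemma zero_tangent: "zero_tvec \<in> tangent_space M p"
  unfolding tangent_space_def zero_tvec_def by (simp add: linear_0[OF linear_TD])

lemma metric_lin:
  assumes "u \<in> tangent_space M p" "v \<in> tangent_space M p" "w \<in> tangent_space M p"
  shows "metric M p (\<lambda>c. a *\<^sub>R u c + b *\<^sub>R v c) w = a * metric M p u w + b * metric M p v w"
    "metric M p w (\<lambda>c. a *\<^sub>R u c + b *\<^sub>R v c) = a * metric M p w u + b * metric M p w v"
proof -
  have ax: "metric M p (\<lambda>c. a *\<^sub>R u c + v c) w = a * metric M p u w + metric M p v w"
    if "u \<in> tangent_space M p" "v \<in> tangent_space M p" "w \<in> tangent_space M p" for u v w a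
    using metric[unfolded lorentzian_metric_def, THEN conjunct2, THEN conjunct1] that by blast
  have sy: "metric M p u v = metric M p v u"
    if "u \<in> tangent_space M p" "v \<in> tangent_space M p" for u v
    using metric[unfolded lorentzian_metric_def, THEN conjunct1] that by blast
  have z: "(\<lambda>c. b *\<^sub>R v c) = (\<lambda>c. b *\<^sub>R v c + zero_tvec c)" by (simp add: zero_tvec_def)
  have "metric M p zero_tvec w = 0"
    using ax[OF zero_tangent zero_tangent assms(3), of 1] by (simp add: zero_tvec_def)
  then have "metric M p (\<lambda>c. b *\<^sub>R v c) w = b * metric M p v w"
    unfolding z using ax[OF assms(2) zero_tangent assms(3), of b] by simp
  moreover have "(\<lambda>c. b *\<^sub>R v c) \<in> tangent_space M p"
    using tangent_lin[OF assms(2,2), of b 0] by simp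
  ultimately show *: "metric M p (\<lambda>c. a *\<^sub>R u c + b *\<^sub>R v c) w = a * metric M p u w + b * metric M p v w"
    using ax[OF assms(1) _ assms(3)] by simp
  then show "metric M p w (\<lambda>c. a *\<^sub>R u c + b *\<^sub>R v c) = a * metric M p w u + b * metric M p w v"
    by (simp add: sy[OF assms(3) tangent_lin[OF assms(1,2)]] sy[OF assms(3,1)] sy[OF assms(3,2)])
qed

lemma metric_eq_coord:
  assumes "u \<in> tangent_space M p" "v \<in> tangent_space M p" "c \<in> charts_at M p"
  shows "metric M p u v = metric_coord M c (chart_map c p) (u c) (v c)"
  using assms chart_facts(5)[of c p] by (simp add: metric_coord_def tvec_of_components_eq charts_at_iff)

lemma tvec_of_components_lin:
  assumes "c \<in> charts_at M p"
  shows "tvec_of_components M c p (a *\<^sub>R x + b *\<^sub>R y) = (\<lambda>d. a *\<^sub>R tvec_of_components M c p x d + b *\<^sub>R tvec_of_components M c p y d)"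
  by (rule tangent_eqI[OF tvec_of_components_in tangent_lin])
    (use assms in \<open>auto simp: tvec_of_components_self intro: tvec_of_components_in\<close>)

text \<open>The Lorentz frame demanded at each point is the source of nondegeneracy.\<close>

lemma local_metric_chart:
  assumes c: "c \<in> atlas M"
  shows "local_metric (img c) (metric_coord M c)"
proof (rule local_metric.intro)
  show "open (img c)" by (rule chart_facts(2)[OF c])
  show "smooth_on (\<lambda>q. metric_coord M c q x y) (img c)" for x y
    using metric c unfolding lorentzian_metric_def by blast
  fix q assume "q \<in> img c"
  then obtain p where p: "q = chart_map c p" "p \<in> chart_dom c" by blast
  have cp: "c \<in> charts_at M p" using c p by (simp add: charts_at_iff)
  have g: "metric_coord M c q x y = metric M p (tvec_of_components M c p x) (tvec_of_components M c p y)" for x y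
    using p chart_facts(5)[OF c] by (simp add: metric_coord_def)
  note T = tvec_of_components_in[OF cp]
  show sym: "metric_coord M c q x y = metric_coord M c q y x" for x y
    unfolding g using metric T unfolding lorentzian_metric_def by blast
  show lin: "linear (\<lambda>x. metric_coord M c q x y)" for y
  proof (rule linearI)
    fix x1 x2 and a :: real
    show "metric_coord M c q (x1 + x2) y = metric_coord M c q x1 y + metric_coord M c q x2 y"
      using metric_lin(1)[OF T T T, of 1 x1 1 x2 y] tvec_of_components_lin[OF cp, of 1 x1 1 x2] by (simp add: g)
    show "metric_coord M c q (a *\<^sub>R x1) y = a *\<^sub>R metric_coord M c q x1 y"
      using metric_lin(1)[OF T T T, of a x1 0 x2 y] tvec_of_components_lin[OF cp, of a x1 0 x2] by (simp add: g)
  qed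
  fix x assume z: "\<And>y. metric_coord M c q x y = 0"
  obtain e :: "4 \<Rightarrow> 'a tvec" where e: "\<And>i. e i \<in> tangent_space M p"
    "\<And>i j. metric M p (e i) (e j) = (if i \<noteq> j then 0 else if i = 0 then 1 else - 1)"
    using metric unfolding lorentzian_metric_def by blast
  have ge: "metric_coord M c q (e i c) (e j c) = (if i \<noteq> j then 0 else if i = 0 then 1 else - 1)" for i j
    using metric_eq_coord[OF e(1) e(1) cp] e(2) p(1) by metis
  \<comment> \<open>\<open>F\<close> assembles a vector from frame coefficients. Products with the
    frame return the coefficients up to sign, so \<open>F\<close> is injective and, by dimension,
    surjective.\<close>
  define F where "F = (\<lambda>a :: real^4. \<Sum>i\<in>UNIV. (a $ i) *\<^sub>R e i c)"
  have linF: "linear F" unfolding F_def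
    by (rule linearI) (simp_all add: scaleR_left_distrib sum.distrib scaleR_sum_right)
  have gF: "metric_coord M c q (F a) (e j c) = a $ j * (if j = 0 then 1 else - 1)" for a j
  proof -
    have "metric_coord M c q (F a) (e j c) = (\<Sum>i\<in>UNIV. a $ i * metric_coord M c q (e i c) (e j c))"
      unfolding F_def by (simp add: linear_sum[OF lin] linear_scale[OF lin])
    also have "\<dots> = (\<Sum>i\<in>UNIV. if i = j then a $ j * (if j = 0 then 1 else - 1) else 0)"
      by (intro sum.cong) (auto simp: ge)
    finally show ?thesis by simp
  qed
  have "inj F"
  proof (subst linear_inj_iff_eq_0[OF linF], intro allI impI)
    fix a assume "F a = 0"
    then have "a $ j = 0" for j
      using gF[of a j] linear_0[OF lin[of "e j c"]] by (simp split: if_splits)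
    then show "a = 0" by (simp add: vec_eq_iff)
  qed
  then obtain a where a: "x = F a"
    using linear_injective_imp_surjective[OF linF] by (metis order_refl surjD)
  have "a $ j = 0" for j
    using gF[of a j] z[of "e j c"] by (simp add: a split: if_splits)
  then show "x = 0" by (simp add: a F_def)
qed

lemma metric_sym: "u \<in> tangent_space M p \<Longrightarrow> v \<in> tangent_space M p \<Longrightarrow> metric M p u v = metric M p v u"
  using metric unfolding lorentzian_metric_def by blast

lemma metric_nondegenerate:
  assumes "u \<in> tangent_space M p" "\<And>v. v \<in> tangent_space M p \<Longrightarrow> metric M p u v = 0"
  shows "u = zero_tvec"
proof -
  obtain c where c: "c \<in> charts_at M p" using charts_at_nonempty .
  then interpret local_metric "img c" "metric_coord M c" by (intro local_metric_chart) (simp add: charts_at_iff)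
  have "u c = 0"
  proof (rule nondegenerate)
    show "chart_map c p \<in> img c" using c by (auto simp: charts_at_iff)
    fix y
    show "metric_coord M c (chart_map c p) (u c) y = 0"
      using assms(2)[OF tvec_of_components_in[OF c, of y]]
      by (simp add: metric_eq_coord[OF assms(1) tvec_of_components_in[OF c] c] tvec_of_components_self[OF c])
  qed
  then show ?thesis using tangent_eqI[OF assms(1) zero_tangent c] by (simp add: zero_tvec_def)
qed

lemma metric_transform_charts:
  assumes c: "c \<in> atlas M" and d: "d \<in> atlas M"
  shows "metric_transform (overlap c d) (metric_coord M c) (img d) (metric_coord M d) (trm c d)"
proof -
  have ov: "overlap c d \<subseteq> img c" by blast
  interpret A: local_metric "overlap c d" "metric_coord M c"
    by (rule local_metric_subset[OF local_metric_chart[OF c] open_overlap[OF c d] ov])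
  interpret B: local_metric "img d" "metric_coord M d" by (rule local_metric_chart[OF d])
  show ?thesis
  proof
    show "smooth_on (trm c d) (overlap c d)" by (rule smooth_trans[OF c d])
    fix q assume "q \<in> overlap c d"
    then obtain p where p: "q = chart_map c p" "p \<in> chart_dom c" "p \<in> chart_dom d" by blast
    have cp: "c \<in> charts_at M p" and dp: "d \<in> charts_at M p" using c d p by (auto simp: charts_at_iff)
    show "trm c d q \<in> img d" using p chart_facts(5)[OF c] by simp
    \<comment> \<open>The opposite transition map provides the preimages.\<close>
    have "frechet_derivative (trm c d) (at q) (TD d c p x) = x" for x
      using TD_chain[OF dp cp dp] TD_self[OF dp] p by simp
    then show "surj (frechet_derivative (trm c d) (at q))" by (metis surjI)
    show "metric_coord M c q x y = metric_coord M d (trm c d q) (frechet_derivative (trm c d) (at q) x) (frechet_derivative (trm c d) (at q) y)" for x y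
      using tvec_of_components_change[OF cp dp] chart_facts(5)[OF c p(2)] chart_facts(5)[OF d p(3)]
      by (simp add: metric_coord_def p(1))
  qed
qed

lemma christoffel_change:
  assumes c: "c \<in> charts_at M p" and d: "d \<in> charts_at M p"
  shows "christoffel M d (chart_map d p) (TD c d p x) (TD c d p y) =
    TD c d p (christoffel M c (chart_map c p) x y) - TD2 c d p x y"
proof -
  have at: "c \<in> atlas M" "d \<in> atlas M" "p \<in> chart_dom c" "p \<in> chart_dom d" using assms by (auto simp: charts_at_iff)
  interpret metric_transform "overlap c d" "metric_coord M c" "img d" "metric_coord M d" "trm c d"
    by (rule metric_transform_charts[OF at(1,2)])
  have "chart_map c p \<in> overlap c d" using at by blast
  from christoffel_transform[OF this, of x y] show ?thesis
    using chart_facts(5)[OF at(1,3)] by (simp add: christoffel_eq)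
qed

lemma TD2_has_derivative:
  assumes c: "c \<in> charts_at M p" and d: "d \<in> charts_at M p"
  shows "((\<lambda>r. frechet_derivative (trm c d) (at r) v) has_derivative (\<lambda>h. TD2 c d p h v)) (at (chart_map c p))"
    "linear (TD2 c d p h)" "linear (\<lambda>h. TD2 c d p h v)"
proof -
  have at: "c \<in> atlas M" "d \<in> atlas M" "p \<in> chart_dom c" "p \<in> chart_dom d" using assms by (auto simp: charts_at_iff)
  interpret metric_transform "overlap c d" "metric_coord M c" "img d" "metric_coord M d" "trm c d"
    by (rule metric_transform_charts[OF at(1,2)])
  have *: "chart_map c p \<in> overlap c d" using at by blast
  show "((\<lambda>r. frechet_derivative (trm c d) (at r) v) has_derivative (\<lambda>h. TD2 c d p h v)) (at (chart_map c p))"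
    "linear (TD2 c d p h)" "linear (\<lambda>h. TD2 c d p h v)"
    using map_derivatives(2,5,6)[OF *] by auto
qed

lemma riemann_tangent:
  assumes "X \<in> tangent_space M p" "Y \<in> tangent_space M p" "Z \<in> tangent_space M p"
  shows "riemann M p X Y Z \<in> tangent_space M p"
  unfolding tangent_space_def
proof (intro CollectI conjI allI ballI impI)
  fix c d assume c: "c \<in> charts_at M p" and d: "d \<in> charts_at M p"
  have at: "c \<in> atlas M" "d \<in> atlas M" "p \<in> chart_dom c" "p \<in> chart_dom d" using c d by (auto simp: charts_at_iff)
  interpret metric_transform "overlap c d" "metric_coord M c" "img d" "metric_coord M d" "trm c d"
    by (rule metric_transform_charts[OF at(1,2)])
  have "chart_map c p \<in> overlap c d" using at by blast
  from riemann_transform[OF this, of "X c" "Y c" "Z c"]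
  show "riemann M p X Y Z d = TD c d p (riemann M p X Y Z c)"
    using chart_facts(5)[OF at(1,3)] tangent_nth[OF assms(1) c d] tangent_nth[OF assms(2) c d] tangent_nth[OF assms(3) c d] c d
    by (simp add: riemann_def riemann_coord_eq)
qed (simp add: riemann_def)

text \<open>Neither summand of \<open>nabla\<close> transforms as a vector. The second derivative of
  the transition map produced by the first is cancelled by the inhomogeneous term in the Christoffel
  law.\<close>

lemma nabla_tangent:
  assumes v: "v \<in> tangent_space M p" and W: "smooth_vector_field_on M V W" and V: "open V" "p \<in> V"
  shows "nabla M p v W \<in> tangent_space M p"
  unfolding tangent_space_def
proof (intro CollectI conjI allI ballI impI)
  fix c d assume c: "c \<in> charts_at M p" and d: "d \<in> charts_at M p"
  have at: "c \<in> atlas M" "d \<in> atlas M" "p \<in> chart_dom c" "p \<in> chart_dom d" using c d by (auto simp: charts_at_iff)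
  let ?q = "chart_map c p"
  let ?S = "chart_map c ` (chart_dom c \<inter> (chart_dom d \<inter> V))"
  have oS: "open ?S" by (intro open_chart_image open_Int chart_facts(1) at V)
  have qS: "?q \<in> ?S" using at V by auto
  have inv: "chart_inv c ?q = p" by (rule chart_facts(5)[OF at(1,3)])
  have Wd: "((\<lambda>q. W (chart_inv e q) e) has_derivative frechet_derivative (\<lambda>q. W (chart_inv e q) e) (at (chart_map e p))) (at (chart_map e p))"
    if "e \<in> charts_at M p" for e
    by (rule smooth_on_has_derivative[of _ "chart_map e ` (chart_dom e \<inter> V)"])
      (use W V that open_chart_image in \<open>auto simp: smooth_vector_field_on_def charts_at_iff\<close>)
  have WT: "W r \<in> tangent_space M r" if "r \<in> V" for r using W that by (simp add: smooth_vector_field_on_def)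
  let ?Dc = "frechet_derivative (\<lambda>q. W (chart_inv c q) c) (at ?q)"
  let ?Dd = "frechet_derivative (\<lambda>q. W (chart_inv d q) d) (at (chart_map d p))"
  have "((\<lambda>r. frechet_derivative (trm c d) (at r) (W (chart_inv c r) c)) has_derivative
      (\<lambda>h. TD2 c d p h (W (chart_inv c ?q) c) + TD c d p (?Dc h))) (at ?q within ?S)"
  proof (rule has_derivative_linear_family[where F="\<lambda>r. frechet_derivative (trm c d) (at r)" and F'="TD2 c d p"])
    fix s assume "s \<in> ?S"
    then show "linear (frechet_derivative (trm c d) (at s))" using at by (auto simp: charts_at_iff intro!: linear_TD)
  qed (use qS TD2_has_derivative[OF c d] Wd[OF c] in \<open>auto intro: has_derivative_at_withinI\<close>)
  then have 1: "((\<lambda>r. frechet_derivative (trm c d) (at r) (W (chart_inv c r) c)) has_derivative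
      (\<lambda>h. TD2 c d p h (W p c) + TD c d p (?Dc h))) (at ?q)"
    unfolding at_within_open[OF qS oS] inv .
  have "((\<lambda>q. W (chart_inv d q) d) has_derivative ?Dd) (at (trm c d ?q))"
    using Wd[OF d] inv by simp
  from has_derivative_compose[OF trans_has_derivative[OF c d] this]
  have "((\<lambda>r. W (chart_inv d (trm c d r)) d) has_derivative (\<lambda>h. ?Dd (TD c d p h))) (at ?q)" .
  \<comment> \<open>The same function, now differentiated through the components in
    \<open>d\<close>. Uniqueness of the derivative yields the transformation of the first
    summand.\<close>
  then have 2: "((\<lambda>r. frechet_derivative (trm c d) (at r) (W (chart_inv c r) c)) has_derivative (\<lambda>h. ?Dd (TD c d p h))) (at ?q)"
  proof (rule has_derivative_transform_within_open[OF _ oS qS])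
    fix r assume "r \<in> ?S"
    then obtain s where s: "r = chart_map c s" "s \<in> chart_dom c" "s \<in> chart_dom d" "s \<in> V" by blast
    then have "W s d = TD c d s (W s c)"
      using at by (intro tangent_nth[OF WT]) (auto simp: charts_at_iff)
    then show "W (chart_inv d (trm c d r)) d = frechet_derivative (trm c d) (at r) (W (chart_inv c r) c)"
      using s chart_facts(5)[OF at(1) s(2)] chart_facts(5)[OF at(2) s(3)] by simp
  qed
  have "?Dd (v d) = TD2 c d p (v c) (W p c) + TD c d p (?Dc (v c))"
    using fun_cong[OF has_derivative_unique[OF 1 2], of "v c"] tangent_nth[OF v c d] by simp
  then show "nabla M p v W d = TD c d p (nabla M p v W c)"
    using c d christoffel_change[OF c d, of "v c" "W p c"] tangent_nth[OF v c d] tangent_nth[OF WT[OF V(2)] c d]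
    by (simp add: nabla_def linear_add[OF linear_TD[OF c d]])
qed (simp add: nabla_def)

lemma ricci_eq_trace:
  assumes "Y \<in> tangent_space M p" "Z \<in> tangent_space M p"
  obtains c where "c \<in> charts_at M p" "ricci M p Y Z = trace (matrix (\<lambda>x. riemann_coord M c (chart_map c p) x (Y c) (Z c)))"
  using charts_at_nonempty[of p] someI[of "\<lambda>c. c \<in> charts_at M p"] unfolding ricci_def Let_def by blast

end

section \<open>Parallel transport and Jacobi fields along a geodesic\<close>

lemma has_vector_derivative_compose_has_derivative:
  assumes "(x has_vector_derivative x') (at t within S)" "(f has_derivative f') (at (x t))"
  shows "((\<lambda>s. f (x s)) has_vector_derivative f' x') (at t within S)"
  using has_derivative_compose[OF assms(1)[unfolded has_vector_derivative_def] assms(2)]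
  unfolding has_vector_derivative_def linear_scale[OF has_derivative_linear[OF assms(2)]] .

text \<open>Derivatives along the curve are taken within the whole interval; this passes to the
  parameters at which the curve lies in one given chart, where component formulas hold.\<close>

lemma at_within_preimage:
  fixes \<gamma> :: "real \<Rightarrow> 'a::topological_space"
  assumes "continuous_on J \<gamma>" "open W" "t \<in> J" "\<gamma> t \<in> W"
  shows "at t within {s \<in> J. \<gamma> s \<in> W} = at t within J"
proof -
  obtain A where A: "open A" "A \<inter> J = \<gamma> -` W \<inter> J"
    using assms(1)[unfolded continuous_on_open_invariant, rule_format, OF assms(2)] by metis
  then have "t \<in> A" using assms(3,4) by blast
  then show ?thesis using A by (intro at_within_nhd[of t A]) auto
qed

context lorentz_manifold
begin

lemma tangent_sum:
  assumes "finite A" "\<And>i. i \<in> A \<Longrightarrow> E i \<in> tangent_space M p"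
  shows "(\<lambda>c. \<Sum>i\<in>A. y i *\<^sub>R E i c) \<in> tangent_space M p"
  using assms
proof (induction A rule: finite_induct)
  case empty
  then show ?case using zero_tangent[of p] by (simp add: zero_tvec_def)
next
  case (insert i A)
  then have "(\<lambda>c. y i *\<^sub>R E i c + 1 *\<^sub>R (\<Sum>i\<in>A. y i *\<^sub>R E i c)) \<in> tangent_space M p"
    by (intro tangent_lin) blast+
  then show ?case using insert.hyps by simp
qed

lemma metric_sum_left:
  assumes "finite A" "\<And>i. i \<in> A \<Longrightarrow> E i \<in> tangent_space M p" "w \<in> tangent_space M p"
  shows "metric M p (\<lambda>c. \<Sum>i\<in>A. y i *\<^sub>R E i c) w = (\<Sum>i\<in>A. y i * metric M p (E i) w)"
  using assms(1,2)
proof (induction A rule: finite_induct)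
  case empty
  then show ?case using metric_lin(1)[OF zero_tangent zero_tangent assms(3), of 0 0] by (simp add: zero_tvec_def)
next
  case (insert i A)
  have T: "E j \<in> tangent_space M p" if "j \<in> A" for j using insert.prems that by blast
  have "metric M p (\<lambda>c. y i *\<^sub>R E i c + 1 *\<^sub>R (\<Sum>i\<in>A. y i *\<^sub>R E i c)) w
      = y i * metric M p (E i) w + 1 * metric M p (\<lambda>c. \<Sum>i\<in>A. y i *\<^sub>R E i c) w"
    by (rule metric_lin(1)[OF insert.prems tangent_sum[OF insert.hyps(1) T] assms(3)]) simp
  then show ?case using insert.hyps insert.IH[OF T] by simp
qed

end

locale lorentz_geodesic = lorentz_manifold M for M :: "'a::topological_space lorentz_structure" +
  fixes \<gamma> :: "real \<Rightarrow> 'a" and a b :: real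
  assumes ab: "a < b" and geodesic: "geodesic M {a..b} \<gamma>"
begin

abbreviation "k \<equiv> velocity M {a..b} \<gamma>"

text \<open>The equation is posed on a part \<open>J\<close> of the interval, but the velocity
  \<open>k\<close> is always that of the whole curve. Pieces over adjacent intervals thus satisfy
  one and the same equation and can be glued.\<close>

definition parallel_on :: "real set \<Rightarrow> (real \<Rightarrow> 'a tvec) \<Rightarrow> bool" where
  "parallel_on J V \<longleftrightarrow> (\<forall>t\<in>J. V t \<in> tangent_space M (\<gamma> t) \<and>
     (\<forall>c\<in>charts_at M (\<gamma> t). ((\<lambda>s. V s c) has_vector_derivative
        - christoffel M c (chart_map c (\<gamma> t)) (k t c) (V t c)) (at t within J)))"

lemma continuous_curve: "continuous_on {a..b} \<gamma>"
  using geodesic by (simp add: geodesic_def differentiable_curve_def)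

lemma curve_has_vector_derivative:
  assumes "t \<in> {a..b}" "c \<in> charts_at M (\<gamma> t)"
  shows "((\<lambda>s. chart_map c (\<gamma> s)) has_vector_derivative k t c) (at t within {a..b})"
proof -
  have "(chart_map c \<circ> \<gamma>) differentiable (at t within {a..b})"
    using geodesic assms by (simp add: geodesic_def differentiable_curve_def)
  then show ?thesis
    using assms(2) by (simp add: vector_derivative_works velocity_def o_def)
qed

lemma parallel_along_imp_parallel_on:
  assumes "parallel_along M {a..b} \<gamma> V"
  shows "parallel_on {a..b} V"
  unfolding parallel_on_def
proof (intro ballI conjI)
  fix t c assume t: "t \<in> {a..b}"
  show "V t \<in> tangent_space M (\<gamma> t)"
    using assms t by (simp add: parallel_along_def differentiable_field_along_def)
  assume c: "c \<in> charts_at M (\<gamma> t)"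
  have "((\<lambda>s. V s c) has_vector_derivative vector_derivative (\<lambda>s. V s c) (at t within {a..b})) (at t within {a..b})"
    using assms t c by (simp add: parallel_along_def differentiable_field_along_def vector_derivative_works)
  moreover have "cov_deriv_along M {a..b} \<gamma> V t c = 0"
    using assms t by (simp add: parallel_along_def zero_tvec_def)
  then have "vector_derivative (\<lambda>s. V s c) (at t within {a..b}) = - christoffel M c (chart_map c (\<gamma> t)) (k t c) (V t c)"
    using c by (simp add: cov_deriv_along_def eq_neg_iff_add_eq_0)
  ultimately show "((\<lambda>s. V s c) has_vector_derivative - christoffel M c (chart_map c (\<gamma> t)) (k t c) (V t c)) (at t within {a..b})"
    by simp
qed

lemma parallel_velocity: "parallel_on {a..b} k"
  using geodesic by (intro parallel_along_imp_parallel_on) (simp add: geodesic_def)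

lemma parallel_tangent: "parallel_on J V \<Longrightarrow> t \<in> J \<Longrightarrow> V t \<in> tangent_space M (\<gamma> t)"
  by (simp add: parallel_on_def)

lemma parallel_has_vector_derivative:
  "parallel_on J V \<Longrightarrow> t \<in> J \<Longrightarrow> c \<in> charts_at M (\<gamma> t) \<Longrightarrow>
    ((\<lambda>s. V s c) has_vector_derivative - christoffel M c (chart_map c (\<gamma> t)) (k t c) (V t c)) (at t within J)"
  by (simp add: parallel_on_def)

lemma at_within_chart:
  assumes "J \<subseteq> {a..b}" "t \<in> J" "c \<in> charts_at M (\<gamma> t)"
  shows "at t within {s \<in> J. \<gamma> s \<in> chart_dom c} = at t within J"
  by (rule at_within_preimage[OF continuous_on_subset[OF continuous_curve assms(1)]])
    (use assms chart_facts(1) in \<open>auto simp: charts_at_iff\<close>)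

lemma continuous_parallel_component:
  assumes "parallel_on {a..b} V" "c \<in> atlas M"
  shows "continuous_on {s \<in> {a..b}. \<gamma> s \<in> chart_dom c} (\<lambda>s. V s c)"
  unfolding continuous_on_eq_continuous_within
proof
  fix t assume t: "t \<in> {s \<in> {a..b}. \<gamma> s \<in> chart_dom c}"
  then have c: "c \<in> charts_at M (\<gamma> t)" using assms(2) by (simp add: charts_at_iff)
  have "continuous (at t within {a..b}) (\<lambda>s. V s c)"
    using t c by (intro has_vector_derivative_continuous[OF parallel_has_vector_derivative[OF assms(1)]]) auto
  then show "continuous (at t within {s \<in> {a..b}. \<gamma> s \<in> chart_dom c}) (\<lambda>s. V s c)"
    by (rule continuous_within_subset) auto
qed

lemma continuous_curve_component:
  assumes "c \<in> atlas M"
  shows "continuous_on {s \<in> {a..b}. \<gamma> s \<in> chart_dom c} (\<lambda>s. chart_map c (\<gamma> s))"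
  by (rule continuous_on_compose2[OF chart_facts(3)[OF assms] continuous_on_subset[OF continuous_curve]]) auto

lemma TD_has_vector_derivative:
  assumes "J \<subseteq> {a..b}" "t \<in> J" "c \<in> charts_at M (\<gamma> t)" "d \<in> charts_at M (\<gamma> t)"
  shows "((\<lambda>s. TD c d (\<gamma> s) v) has_vector_derivative TD2 c d (\<gamma> t) (k t c) v) (at t within J)"
  by (rule has_vector_derivative_compose_has_derivative[OF has_vector_derivative_within_subset[OF curve_has_vector_derivative assms(1)]
        TD2_has_derivative(1)]) (use assms in auto)

text \<open>The linear equation is solved for the components in \<open>c\<close> only; the
  transformation laws then give the equation in every other chart.\<close>

lemma parallel_transport_in_chart:
  assumes c: "c \<in> atlas M" and J: "{t1..t2} \<subseteq> {a..b}" "\<And>s. s \<in> {t1..t2} \<Longrightarrow> \<gamma> s \<in> chart_dom c"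
    and t0: "t0 \<in> {t1..t2}" and v: "v \<in> tangent_space M (\<gamma> t0)"
  obtains V where "V t0 = v" "parallel_on {t1..t2} V"
proof -
  let ?J = "{t1..t2}"
  have cs: "c \<in> charts_at M (\<gamma> s)" if "s \<in> ?J" for s using J that c by (simp add: charts_at_iff)
  interpret local_metric "img c" "metric_coord M c" by (rule local_metric_chart[OF c])
  have q: "chart_map c (\<gamma> s) \<in> img c" if "s \<in> ?J" for s using J that by blast
  have sub: "?J \<subseteq> {s \<in> {a..b}. \<gamma> s \<in> chart_dom c}" using J by blast
  let ?A = "\<lambda>s x. - christoffel M c (chart_map c (\<gamma> s)) (k s c) x"
  have lin: "linear (?A s)" if "s \<in> ?J" for s
    unfolding christoffel_eq by (rule linear_compose_neg[OF linear_christoffel(2)[OF q[OF that]]])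
  have c\<Gamma>: "continuous_on ?J (\<lambda>s. christoffel M c (chart_map c (\<gamma> s)) x y)" for x y
    unfolding christoffel_eq
    by (rule continuous_on_compose2[OF smooth_on_imp_continuous_on[OF smooth_christoffel open_dom]
          continuous_on_subset[OF continuous_curve_component[OF c] sub]]) (use q in auto)
  have cont: "continuous_on ?J (\<lambda>s. ?A s x)" for x
    by (rule continuous_on_minus[OF continuous_on_linear_family[where F="\<lambda>s y. christoffel M c (chart_map c (\<gamma> s)) y x" and x="\<lambda>s. k s c",
            OF _ c\<Gamma> continuous_on_subset[OF continuous_parallel_component[OF parallel_velocity c] sub]]])
      (unfold christoffel_eq, rule linear_christoffel(1)[OF q])
  have "t1 \<le> t2" using t0 by simp
  from linear_ode_solution[OF this lin cont t0, of "v c"] obtain x where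
    x: "x t0 = v c" "\<And>t. t \<in> ?J \<Longrightarrow> (x has_vector_derivative ?A t (x t)) (at t within ?J)" by metis
  define V where "V = (\<lambda>s. tvec_of_components M c (\<gamma> s) (x s))"
  have "V t0 = v" using x(1) tvec_of_components_eq[OF v cs[OF t0]] by (simp add: V_def)
  moreover have "parallel_on ?J V"
    unfolding parallel_on_def
  proof (intro ballI conjI)
    fix t assume t: "t \<in> ?J"
    show "V t \<in> tangent_space M (\<gamma> t)" unfolding V_def by (rule tvec_of_components_in[OF cs[OF t]])
    fix d assume d: "d \<in> charts_at M (\<gamma> t)"
    let ?T = "{s \<in> ?J. \<gamma> s \<in> chart_dom d}"
    have ds: "d \<in> charts_at M (\<gamma> s)" if "s \<in> ?T" for s using that d by (simp add: charts_at_iff)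
    have tT: "t \<in> ?T" using t d by (simp add: charts_at_iff)
    have Vd: "V s d = TD c d (\<gamma> s) (x s)" if "s \<in> ?T" for s
      unfolding V_def by (rule tvec_of_components_nth[OF cs ds]) (use that in auto)
    have kd: "k t d = TD c d (\<gamma> t) (k t c)"
      by (rule tangent_nth[OF parallel_tangent[OF parallel_velocity] cs[OF t] d]) (use J t in auto)
    \<comment> \<open>The transition map itself moves with the curve. Its contribution
      \<open>TD2\<close> is the inhomogeneous term that turns the Christoffel symbols of
      \<open>c\<close> into those of \<open>d\<close>.\<close>
    have "((\<lambda>s. TD c d (\<gamma> s) (x s)) has_vector_derivative (TD2 c d (\<gamma> t) (k t c) (x t) + TD c d (\<gamma> t) (?A t (x t)))) (at t within ?T)"
    proof (rule has_vector_derivative_linear_family[where F="\<lambda>s. TD c d (\<gamma> s)" and F'="TD2 c d (\<gamma> t) (k t c)"])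
      fix s assume "s \<in> ?T" then show "linear (TD c d (\<gamma> s))" using cs ds by (intro linear_TD) auto
    next
      fix v show "((\<lambda>s. TD c d (\<gamma> s) v) has_vector_derivative TD2 c d (\<gamma> t) (k t c) v) (at t within ?T)"
        by (rule TD_has_vector_derivative) (use J tT cs[OF t] d in auto)
    next
      show "(x has_vector_derivative ?A t (x t)) (at t within ?T)"
        by (rule has_vector_derivative_within_subset[OF x(2)[OF t]]) auto
    qed (rule tT, rule TD2_has_derivative(2)[OF cs[OF t] d])
    also have "TD2 c d (\<gamma> t) (k t c) (x t) + TD c d (\<gamma> t) (?A t (x t)) = - christoffel M d (chart_map d (\<gamma> t)) (k t d) (V t d)"
      using christoffel_change[OF cs[OF t] d, of "k t c" "x t"]
      by (simp add: kd Vd[OF tT] linear_neg[OF linear_TD[OF cs[OF t] d]])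
    finally have "((\<lambda>s. V s d) has_vector_derivative - christoffel M d (chart_map d (\<gamma> t)) (k t d) (V t d)) (at t within ?T)"
      by (rule has_vector_derivative_transform[OF tT, rotated]) (rule Vd)
    then show "((\<lambda>s. V s d) has_vector_derivative - christoffel M d (chart_map d (\<gamma> t)) (k t d) (V t d)) (at t within ?J)"
      unfolding at_within_chart[OF J(1) t d] .
  qed
  ultimately show thesis by (rule that)
qed

lemma parallel_on_glue:
  assumes "t1 \<le> t2" "t2 \<le> t3" "parallel_on {t1..t2} Y" "parallel_on {t2..t3} Z" "Y t2 = Z t2"
  shows "parallel_on {t1..t3} (\<lambda>s. if s \<le> t2 then Y s else Z s)"
  unfolding parallel_on_def
proof (intro ballI conjI)
  let ?W = "\<lambda>s. if s \<le> t2 then Y s else Z s"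
  have WZ: "?W s = Z s" if "s \<in> {t2..t3}" for s using that assms(5) by (cases "s = t2") simp_all
  fix t assume t: "t \<in> {t1..t3}"
  show "?W t \<in> tangent_space M (\<gamma> t)"
  proof (cases "t \<le> t2")
    case True
    then show ?thesis using parallel_tangent[OF assms(3), of t] t by simp
  next
    case False
    then show ?thesis using parallel_tangent[OF assms(4), of t] t by simp
  qed
  fix c assume c: "c \<in> charts_at M (\<gamma> t)"
  show "((\<lambda>s. ?W s c) has_vector_derivative - christoffel M c (chart_map c (\<gamma> t)) (k t c) (?W t c)) (at t within {t1..t3})"
  proof (rule has_vector_derivative_within_Icc_Un[OF assms(1,2) t])
    assume t': "t \<in> {t1..t2}"
    then have W: "?W t = Y t" by simp
    show "((\<lambda>s. ?W s c) has_vector_derivative - christoffel M c (chart_map c (\<gamma> t)) (k t c) (?W t c)) (at t within {t1..t2})"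
      unfolding W
      by (rule has_vector_derivative_transform[OF t' _ parallel_has_vector_derivative[OF assms(3) t' c]]) simp
  next
    assume t': "t \<in> {t2..t3}"
    show "((\<lambda>s. ?W s c) has_vector_derivative - christoffel M c (chart_map c (\<gamma> t)) (k t c) (?W t c)) (at t within {t2..t3})"
      unfolding WZ[OF t']
      by (rule has_vector_derivative_transform[OF t' _ parallel_has_vector_derivative[OF assms(4) t' c]]) (simp only: WZ)
  qed
qed

text \<open>By continuity the curve stays in one chart for a short time around each parameter;
  bisection glues the solutions obtained there.\<close>

lemma parallel_transport:
  assumes "t0 \<in> {a..b}" "v \<in> tangent_space M (\<gamma> t0)"
  obtains V where "V t0 = v" "parallel_on {a..b} V"
proof -
  define P where "P = (\<lambda>t1 t2. {t1..t2} \<subseteq> {a..b} \<longrightarrow>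
    (\<forall>t0\<in>{t1..t2}. \<forall>v\<in>tangent_space M (\<gamma> t0). \<exists>V. V t0 = v \<and> parallel_on {t1..t2} V))"
  have "a \<le> b" using ab by simp
  then have "P a b"
  proof (induction rule: Bolzano)
    case (trans t1 t2 t3)
    show ?case unfolding P_def
    proof (intro impI ballI)
      fix t0 v assume sub: "{t1..t3} \<subseteq> {a..b}" and t0: "t0 \<in> {t1..t3}" and v: "v \<in> tangent_space M (\<gamma> t0)"
      have P1: "\<exists>V. V t0 = v \<and> parallel_on {t1..t2} V" if "t0 \<in> {t1..t2}" "v \<in> tangent_space M (\<gamma> t0)" for t0 v
      proof -
        have "{t1..t2} \<subseteq> {a..b}" using sub trans(3,4) by auto
        then show ?thesis using trans(1) that unfolding P_def by blast
      qed
      have P2: "\<exists>V. V t0 = v \<and> parallel_on {t2..t3} V" if "t0 \<in> {t2..t3}" "v \<in> tangent_space M (\<gamma> t0)" for t0 v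
      proof -
        have "{t2..t3} \<subseteq> {a..b}" using sub trans(3,4) by auto
        then show ?thesis using trans(2) that unfolding P_def by blast
      qed
      have t2: "t2 \<in> {t1..t2}" "t2 \<in> {t2..t3}" using trans by auto
      show "\<exists>V. V t0 = v \<and> parallel_on {t1..t3} V"
      proof (cases "t0 \<le> t2")
        case True
        with t0 obtain Y where Y: "Y t0 = v" "parallel_on {t1..t2} Y" using P1[of t0 v] v by auto
        obtain Z where Z: "Z t2 = Y t2" "parallel_on {t2..t3} Z"
          using P2[OF t2(2) parallel_tangent[OF Y(2) t2(1)]] by blast
        from parallel_on_glue[OF trans(3,4) Y(2) Z(2) Z(1)[symmetric]] Y(1) True
        show ?thesis by (intro exI[of _ "\<lambda>s. if s \<le> t2 then Y s else Z s"] conjI) simp_all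
      next
        case False
        with t0 obtain Z where Z: "Z t0 = v" "parallel_on {t2..t3} Z" using P2[of t0 v] v by auto
        obtain Y where Y: "Y t2 = Z t2" "parallel_on {t1..t2} Y"
          using P1[OF t2(1) parallel_tangent[OF Z(2) t2(2)]] by blast
        from parallel_on_glue[OF trans(3,4) Y(2) Z(2) Y(1)] Z(1) False
        show ?thesis by (intro exI[of _ "\<lambda>s. if s \<le> t2 then Y s else Z s"] conjI) simp_all
      qed
    qed
  next
    case (local x)
    then have x: "x \<in> {a..b}" by simp
    obtain c where c: "c \<in> charts_at M (\<gamma> x)" using charts_at_nonempty .
    then have cM: "c \<in> atlas M" "\<gamma> x \<in> chart_dom c" by (auto simp: charts_at_iff)
    obtain A where A: "open A" "A \<inter> {a..b} = \<gamma> -` chart_dom c \<inter> {a..b}"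
      using continuous_curve[unfolded continuous_on_open_invariant, rule_format, OF chart_facts(1)[OF cM(1)]] by metis
    then have "x \<in> A" using x cM(2) by blast
    then obtain e where e: "e > 0" "ball x e \<subseteq> A" using A(1) open_contains_ball by blast
    show ?case
    proof (intro exI[of _ e] conjI allI impI)
      fix t1 t2 assume t: "t1 \<le> x \<and> x \<le> t2 \<and> t2 - t1 < e"
      show "P t1 t2" unfolding P_def
      proof (intro impI ballI)
        fix t0 v assume sub: "{t1..t2} \<subseteq> {a..b}" and t0: "t0 \<in> {t1..t2}" and v: "v \<in> tangent_space M (\<gamma> t0)"
        have "\<gamma> s \<in> chart_dom c" if s: "s \<in> {t1..t2}" for s
        proof -
          have "s \<in> ball x e" using s t by (auto simp: dist_real_def)
          then have "s \<in> A \<inter> {a..b}" using e(2) s sub by blast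
          then show ?thesis using A(2) by blast
        qed
        from parallel_transport_in_chart[OF cM(1) sub this t0 v]
        show "\<exists>V. V t0 = v \<and> parallel_on {t1..t2} V" by metis
      qed
    qed (rule e(1))
  qed
  then show thesis using assms that unfolding P_def by blast
qed

text \<open>In a chart, \<open>metric_compatible\<close> makes the derivative of the metric along
  the curve cancel the Christoffel terms of the two fields.\<close>

lemma metric_parallel_const:
  assumes V: "parallel_on {a..b} V" and W: "parallel_on {a..b} W" and s: "s \<in> {a..b}" and t: "t \<in> {a..b}"
  shows "metric M (\<gamma> s) (V s) (W s) = metric M (\<gamma> t) (V t) (W t)"
proof -
  have "((\<lambda>s. metric M (\<gamma> s) (V s) (W s)) has_vector_derivative 0) (at t within {a..b})" if t: "t \<in> {a..b}" for t
  proof -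
    obtain c where c: "c \<in> charts_at M (\<gamma> t)" using charts_at_nonempty .
    then have cM: "c \<in> atlas M" by (simp add: charts_at_iff)
    let ?T = "{s \<in> {a..b}. \<gamma> s \<in> chart_dom c}"
    have tT: "t \<in> ?T" using c t by (simp add: charts_at_iff)
    have cs: "c \<in> charts_at M (\<gamma> s)" if "s \<in> ?T" for s using that cM by (simp add: charts_at_iff)
    interpret local_metric "img c" "metric_coord M c" by (rule local_metric_chart[OF cM])
    have q: "chart_map c (\<gamma> s) \<in> img c" if "s \<in> ?T" for s using that by blast
    let ?q = "\<lambda>s. chart_map c (\<gamma> s)" and ?g = "metric_coord M c"
    have sub: "?T \<subseteq> {a..b}" by blast
    note dV = has_vector_derivative_within_subset[OF parallel_has_vector_derivative[OF V t c] sub]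
    note dW = has_vector_derivative_within_subset[OF parallel_has_vector_derivative[OF W t c] sub]
    note dc = has_vector_derivative_within_subset[OF curve_has_vector_derivative[OF t c] sub]
    let ?F' = "\<lambda>w. Dg (?q t) (k t c) (V t c) w + ?g (?q t) (- christoffel M c (?q t) (k t c) (V t c)) w"
    have 1: "((\<lambda>s. ?g (?q s) (V s c) w) has_vector_derivative ?F' w) (at t within ?T)" for w
      by (rule has_vector_derivative_linear_family[where F="\<lambda>s x. ?g (?q s) x w" and F'="\<lambda>x. Dg (?q t) (k t c) x w",
            OF linear_left[OF q] tT has_vector_derivative_compose_has_derivative[OF dc g_has_derivative[OF q[OF tT]]]
              linear_Dg(2)[OF q[OF tT]] dV])
    have "((\<lambda>s. ?g (?q s) (V s c) (W s c)) has_vector_derivative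
        (?F' (W t c) + ?g (?q t) (V t c) (- christoffel M c (?q t) (k t c) (W t c)))) (at t within ?T)"
      by (rule has_vector_derivative_linear_family[where F="\<lambda>s w. ?g (?q s) (V s c) w" and F'="?F'",
            OF linear_right[OF q] tT 1 linear_compose_add[OF linear_Dg(3)[OF q[OF tT]] linear_right[OF q[OF tT]]] dW])
    also have "?F' (W t c) + ?g (?q t) (V t c) (- christoffel M c (?q t) (k t c) (W t c)) = 0"
      by (simp add: metric_compatible[OF q[OF tT]] christoffel_eq lin_simps[OF q[OF tT]])
    finally have "((\<lambda>s. metric M (\<gamma> s) (V s) (W s)) has_vector_derivative 0) (at t within ?T)"
      by (rule has_vector_derivative_transform[OF tT, rotated])
        (rule metric_eq_coord[OF parallel_tangent[OF V] parallel_tangent[OF W] cs], auto)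
    then show ?thesis unfolding at_within_chart[OF order_refl t c] .
  qed
  from has_vector_derivative_zero_constant[OF _ this] obtain C
    where "\<And>t. t \<in> {a..b} \<Longrightarrow> metric M (\<gamma> t) (V t) (W t) = C" by auto
  then show ?thesis using s t by simp
qed

text \<open>By multilinearity the moving arguments are inserted one at a time, beginning with
  continuity for fixed vectors.\<close>

lemma continuous_curvature_component:
  assumes "parallel_on {a..b} X" "parallel_on {a..b} Y" "parallel_on {a..b} Z" "parallel_on {a..b} W"
  shows "continuous_on {a..b} (\<lambda>t. metric M (\<gamma> t) (riemann M (\<gamma> t) (X t) (Y t) (Z t)) (W t))"
  unfolding continuous_on_eq_continuous_within
proof
  fix t assume t: "t \<in> {a..b}"
  obtain c where c: "c \<in> charts_at M (\<gamma> t)" using charts_at_nonempty .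
  then have cM: "c \<in> atlas M" by (simp add: charts_at_iff)
  let ?T = "{s \<in> {a..b}. \<gamma> s \<in> chart_dom c}"
  have tT: "t \<in> ?T" using c t by (simp add: charts_at_iff)
  have cs: "c \<in> charts_at M (\<gamma> s)" if "s \<in> ?T" for s using that cM by (simp add: charts_at_iff)
  interpret local_metric "img c" "metric_coord M c" by (rule local_metric_chart[OF cM])
  have q: "chart_map c (\<gamma> s) \<in> img c" if "s \<in> ?T" for s using that by blast
  let ?q = "\<lambda>s. chart_map c (\<gamma> s)"
  note cc = continuous_parallel_component[OF _ cM]
  have r: "continuous_on ?T (\<lambda>s. riem (?q s) x y z)" for x y z
    by (rule continuous_on_compose2[OF continuous_riem continuous_curve_component[OF cM]]) auto
  have r1: "continuous_on ?T (\<lambda>s. riem (?q s) (X s c) y z)" for y z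
    by (rule continuous_on_linear_family[where F="\<lambda>s x. riem (?q s) x y z", OF linear_riem(1)[OF q] r cc[OF assms(1)]])
  have r2: "continuous_on ?T (\<lambda>s. riem (?q s) (X s c) (Y s c) z)" for z
    by (rule continuous_on_linear_family[where F="\<lambda>s y. riem (?q s) (X s c) y z", OF linear_riem(2)[OF q] r1 cc[OF assms(2)]])
  have r3: "continuous_on ?T (\<lambda>s. riem (?q s) (X s c) (Y s c) (Z s c))"
    by (rule continuous_on_linear_family[where F="\<lambda>s z. riem (?q s) (X s c) (Y s c) z", OF linear_riem(3)[OF q] r2 cc[OF assms(3)]])
  have g: "continuous_on ?T (\<lambda>s. metric_coord M c (?q s) x y)" for x y
    by (rule continuous_on_compose2[OF smooth_on_imp_continuous_on[OF smooth open_dom] continuous_curve_component[OF cM]]) auto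
  have g1: "continuous_on ?T (\<lambda>s. metric_coord M c (?q s) (riem (?q s) (X s c) (Y s c) (Z s c)) y)" for y
    by (rule continuous_on_linear_family[where F="\<lambda>s x. metric_coord M c (?q s) x y", OF linear_left[OF q] g r3])
  have "continuous_on ?T (\<lambda>s. metric_coord M c (?q s) (riem (?q s) (X s c) (Y s c) (Z s c)) (W s c))"
    by (rule continuous_on_linear_family[where F="\<lambda>s y. metric_coord M c (?q s) (riem (?q s) (X s c) (Y s c) (Z s c)) y", OF linear_right[OF q] g1 cc[OF assms(4)]])
  then have "continuous_on ?T (\<lambda>t. metric M (\<gamma> t) (riemann M (\<gamma> t) (X t) (Y t) (Z t)) (W t))"
  proof (rule continuous_on_eq)
    fix s assume s: "s \<in> ?T"
    then have T: "X s \<in> tangent_space M (\<gamma> s)" "Y s \<in> tangent_space M (\<gamma> s)" "Z s \<in> tangent_space M (\<gamma> s)" "W s \<in> tangent_space M (\<gamma> s)"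
      using parallel_tangent assms by auto
    show "metric_coord M c (?q s) (riem (?q s) (X s c) (Y s c) (Z s c)) (W s c) = metric M (\<gamma> s) (riemann M (\<gamma> s) (X s) (Y s) (Z s)) (W s)"
      unfolding metric_eq_coord[OF riemann_tangent[OF T(1,2,3)] T(4) cs[OF s]]
      by (simp add: riemann_def cs[OF s] riemann_coord_eq)
  qed
  then have "continuous (at t within ?T) (\<lambda>t. metric M (\<gamma> t) (riemann M (\<gamma> t) (X t) (Y t) (Z t)) (W t))"
    using tT unfolding continuous_on_eq_continuous_within by blast
  then show "continuous (at t within {a..b}) (\<lambda>t. metric M (\<gamma> t) (riemann M (\<gamma> t) (X t) (Y t) (Z t)) (W t))"
    unfolding at_within_chart[OF order_refl t c] .
qed

lemma combination_has_vector_derivative: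
  assumes "finite A" "\<And>i. i \<in> A \<Longrightarrow> parallel_on {a..b} (E i)" "t \<in> {a..b}" "c \<in> charts_at M (\<gamma> t)"
    and "\<And>i. i \<in> A \<Longrightarrow> (y i has_vector_derivative y' i) (at t within {a..b})"
  shows "((\<lambda>s. \<Sum>i\<in>A. y i s *\<^sub>R E i s c) has_vector_derivative
    ((\<Sum>i\<in>A. y' i *\<^sub>R E i t c) - christoffel M c (chart_map c (\<gamma> t)) (k t c) (\<Sum>i\<in>A. y i t *\<^sub>R E i t c))) (at t within {a..b})"
proof -
  have cM: "c \<in> atlas M" and q: "chart_map c (\<gamma> t) \<in> img c" using assms(4) by (auto simp: charts_at_iff)
  interpret local_metric "img c" "metric_coord M c" by (rule local_metric_chart[OF cM])
  have "((\<lambda>s. \<Sum>i\<in>A. y i s *\<^sub>R E i s c) has_vector_derivative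
     (\<Sum>i\<in>A. y i t *\<^sub>R (- christoffel M c (chart_map c (\<gamma> t)) (k t c) (E i t c)) + y' i *\<^sub>R E i t c)) (at t within {a..b})"
    by (intro has_vector_derivative_sum has_vector_derivative_scaleR parallel_has_vector_derivative assms
        has_real_derivative_iff_has_vector_derivative[THEN iffD2])
  also have "(\<Sum>i\<in>A. y i t *\<^sub>R (- christoffel M c (chart_map c (\<gamma> t)) (k t c) (E i t c)) + y' i *\<^sub>R E i t c)
     = (\<Sum>i\<in>A. y' i *\<^sub>R E i t c) - christoffel M c (chart_map c (\<gamma> t)) (k t c) (\<Sum>i\<in>A. y i t *\<^sub>R E i t c)"
    by (simp add: christoffel_eq sum.distrib sum_negf sum_subtractf linear_sum[OF linear_christoffel(2)[OF q]] linear_scale[OF linear_christoffel(2)[OF q]])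
  finally show ?thesis .
qed

text \<open>Along a parallel frame the Christoffel terms cancel and covariant differentiation acts
  on the scalar coefficients alone.\<close>

lemma cov_deriv_along_combination:
  assumes "finite A" "\<And>i. i \<in> A \<Longrightarrow> parallel_on {a..b} (E i)" "t \<in> {a..b}"
    and "\<And>s. s \<in> {a..b} \<Longrightarrow> V s = (\<lambda>c. \<Sum>i\<in>A. y i s *\<^sub>R E i s c)"
    and "\<And>i. i \<in> A \<Longrightarrow> (y i has_vector_derivative y' i) (at t within {a..b})"
  shows "cov_deriv_along M {a..b} \<gamma> V t = (\<lambda>c. \<Sum>i\<in>A. y' i *\<^sub>R E i t c)"
    "c \<in> charts_at M (\<gamma> t) \<Longrightarrow> (\<lambda>s. V s c) differentiable (at t within {a..b})"
proof -
  have V: "((\<lambda>s. V s c) has_vector_derivative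
    ((\<Sum>i\<in>A. y' i *\<^sub>R E i t c) - christoffel M c (chart_map c (\<gamma> t)) (k t c) (V t c))) (at t within {a..b})"
    if c: "c \<in> charts_at M (\<gamma> t)" for c
    unfolding assms(4)[OF assms(3)]
    by (rule has_vector_derivative_transform[OF assms(3) _ combination_has_vector_derivative[OF assms(1,2,3) c assms(5)]])
      (simp_all add: assms(4))
  then show "c \<in> charts_at M (\<gamma> t) \<Longrightarrow> (\<lambda>s. V s c) differentiable (at t within {a..b})"
    by (rule differentiableI_vector)
  show "cov_deriv_along M {a..b} \<gamma> V t = (\<lambda>c. \<Sum>i\<in>A. y' i *\<^sub>R E i t c)"
  proof
    fix c
    show "cov_deriv_along M {a..b} \<gamma> V t c = (\<Sum>i\<in>A. y' i *\<^sub>R E i t c)"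
    proof (cases "c \<in> charts_at M (\<gamma> t)")
      case True
      have "vector_derivative (\<lambda>s. V s c) (at t within {a..b}) = (\<Sum>i\<in>A. y' i *\<^sub>R E i t c) - christoffel M c (chart_map c (\<gamma> t)) (k t c) (V t c)"
        using vector_derivative_within_cbox[OF ab, of t "\<lambda>s. V s c"] V[OF True] assms(3) unfolding cbox_interval by blast
      then show ?thesis using True by (simp add: cov_deriv_along_def)
    next
      case False
      then have "E i t c = 0" if "i \<in> A" for i
        using tangent_outside[OF parallel_tangent[OF assms(2)[OF that] assms(3)]] by blast
      then show ?thesis using False by (simp add: cov_deriv_along_def)
    qed
  qed
qed

text \<open>Two covariant derivatives become two ordinary ones, so that the Jacobi equation is a
  second order system for the coefficients.\<close>

lemma jacobi_field_combination:
  assumes A: "finite A" "\<And>i. i \<in> A \<Longrightarrow> parallel_on {a..b} (E i)"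
    and y: "\<And>i t. i \<in> A \<Longrightarrow> t \<in> {a..b} \<Longrightarrow> (y i has_vector_derivative z i t) (at t within {a..b})"
    and z: "\<And>i t. i \<in> A \<Longrightarrow> t \<in> {a..b} \<Longrightarrow> (z i has_vector_derivative w i t) (at t within {a..b})"
    and J: "J = (\<lambda>s c. \<Sum>i\<in>A. y i s *\<^sub>R E i s c)"
    and eq: "\<And>t c. t \<in> {a..b} \<Longrightarrow> (\<Sum>i\<in>A. w i t *\<^sub>R E i t c) = - riemann M (\<gamma> t) (J t) (k t) (k t) c"
  shows "jacobi_field M {a..b} \<gamma> J"
    "t \<in> {a..b} \<Longrightarrow> cov_deriv_along M {a..b} \<gamma> J t = (\<lambda>c. \<Sum>i\<in>A. z i t *\<^sub>R E i t c)"
proof -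
  have J': "J s = (\<lambda>c. \<Sum>i\<in>A. y i s *\<^sub>R E i s c)" for s by (simp add: J)
  have ET: "(\<lambda>c. \<Sum>i\<in>A. x i *\<^sub>R E i t c) \<in> tangent_space M (\<gamma> t)" if "t \<in> {a..b}" for x t
    by (rule tangent_sum[OF A(1) parallel_tangent[OF A(2) that]])
  show 1: "cov_deriv_along M {a..b} \<gamma> J t = (\<lambda>c. \<Sum>i\<in>A. z i t *\<^sub>R E i t c)" if "t \<in> {a..b}" for t
    by (rule cov_deriv_along_combination(1)[OF A that J' y[OF _ that]])
  show "jacobi_field M {a..b} \<gamma> J"
    unfolding jacobi_field_def differentiable_field_along_def
  proof (intro conjI ballI allI)
    fix t assume t: "t \<in> {a..b}"
    show "J t \<in> tangent_space M (\<gamma> t)" unfolding J' by (rule ET[OF t])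
    show "cov_deriv_along M {a..b} \<gamma> J t \<in> tangent_space M (\<gamma> t)" unfolding 1[OF t] by (rule ET[OF t])
    show "(\<lambda>s. J s c) differentiable (at t within {a..b})" if "c \<in> charts_at M (\<gamma> t)" for c
      by (rule cov_deriv_along_combination(2)[OF A t J' y[OF _ t] that])
    show "(\<lambda>s. cov_deriv_along M {a..b} \<gamma> J s c) differentiable (at t within {a..b})" if "c \<in> charts_at M (\<gamma> t)" for c
      by (rule cov_deriv_along_combination(2)[OF A t 1 z[OF _ t] that])
    show "cov_deriv_along M {a..b} \<gamma> (cov_deriv_along M {a..b} \<gamma> J) t c = - riemann M (\<gamma> t) (J t) (k t) (k t) c" for c
      using cov_deriv_along_combination(1)[where y=z and y'="\<lambda>i. w i t", OF A t 1 z[OF _ t]] eq[OF t] by simp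
  qed
qed

end

section \<open>Spacelike surfaces\<close>

text \<open>Each vector orthogonal to \<open>S\<close> yields a scalar function that vanishes along
  the line. So the derivative lies in the double orthogonal complement, which is
  \<open>S\<close>.\<close>

lemma derivative_in_subspace:
  fixes f :: "'a::real_normed_vector \<Rightarrow> 'b::euclidean_space"
  assumes f: "(f has_derivative f') (at q)" and S: "subspace S" and \<delta>: "\<delta> > 0" "\<And>t. \<bar>t\<bar> < \<delta> \<Longrightarrow> f (q + t *\<^sub>R x) \<in> S"
  shows "f' x \<in> S"
proof -
  have "f' x \<bullet> y = 0" if y: "\<And>s. s \<in> S \<Longrightarrow> s \<bullet> y = 0" for y
  proof -
    have "((\<lambda>z. f z \<bullet> y) has_derivative (\<lambda>h. f' h \<bullet> y)) (at (q + 0 *\<^sub>R x))"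
      using has_derivative_inner_left[OF f] by simp
    from has_real_derivative_along_line[OF this]
    have 1: "((\<lambda>t. f (q + t *\<^sub>R x) \<bullet> y) has_real_derivative f' x \<bullet> y) (at 0)" .
    have "((\<lambda>t. f (q + t *\<^sub>R x) \<bullet> y) has_real_derivative 0) (at 0)"
    proof (rule has_field_derivative_transform_within_open[of "\<lambda>_. 0"])
      show "((\<lambda>_. 0) has_real_derivative 0) (at (0::real))" by simp
      show "open (ball (0::real) \<delta>)" "0 \<in> ball (0::real) \<delta>" using \<delta>(1) by auto
      show "0 = f (q + t *\<^sub>R x) \<bullet> y" if "t \<in> ball 0 \<delta>" for t using y[OF \<delta>(2)] that by simp
    qed
    from DERIV_unique[OF 1 this] show ?thesis .
  qed
  then have "f' x \<in> orthogonal_comp (orthogonal_comp S)"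
    by (auto simp: orthogonal_comp_def orthogonal_def inner_commute)
  then show ?thesis using orthogonal_comp_self[OF S] by simp
qed

lemma line_in_open:
  fixes q x :: "'a::real_normed_vector"
  assumes "open W" "q \<in> W"
  obtains \<delta> where "\<delta> > 0" "\<And>t. \<bar>t\<bar> < \<delta> \<Longrightarrow> q + t *\<^sub>R x \<in> W"
proof -
  obtain e where e: "e > 0" "ball q e \<subseteq> W" using assms open_contains_ball by blast
  have "q + t *\<^sub>R x \<in> W" if t: "\<bar>t\<bar> < e / (norm x + 1)" for t
  proof -
    have N: "norm x + 1 > 0" by (simp add: add_nonneg_pos)
    have "\<bar>t\<bar> * norm x \<le> \<bar>t\<bar> * (norm x + 1)" by (simp add: mult_left_mono)
    also have "\<dots> < e" using t N by (simp add: pos_less_divide_eq)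
    finally have "q + t *\<^sub>R x \<in> ball q e" by (simp add: dist_norm)
    then show ?thesis using e by blast
  qed
  moreover have "e / (norm x + 1) > 0" using e(1) by (simp add: add_nonneg_pos)
  ultimately show thesis using that by blast
qed

context lorentz_manifold
begin

text \<open>A slice chart straightens \<open>P\<close>: short segments in directions of
  \<open>S\<close> lift to \<open>P\<close>. The set \<open>V\<close> keeps the lifted points where
  another chart or an extended field is available.\<close>

lemma slice_chart_line:
  assumes sl: "slice_chart M P p c S" and p: "p \<in> P" and x: "x \<in> S" and V: "open V" "p \<in> V"
  obtains \<delta> where "\<delta> > 0" "\<And>t. \<bar>t\<bar> < \<delta> \<Longrightarrow> \<exists>r. r \<in> P \<and> r \<in> chart_dom c \<and> r \<in> V \<and> chart_map c r = chart_map c p + t *\<^sub>R x"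
proof -
  have c: "c \<in> atlas M" "p \<in> chart_dom c" and S: "subspace S"
    and eq: "chart_map c ` (P \<inter> chart_dom c) = img c \<inter> S"
    using sl by (auto simp: slice_chart_def charts_at_iff)
  have pS: "chart_map c p \<in> S" using eq p c by blast
  let ?W = "chart_map c ` (chart_dom c \<inter> V)"
  have oW: "open ?W" by (rule open_chart_image[OF c(1) V(1)])
  have pW: "chart_map c p \<in> ?W" using c V by blast
  obtain \<delta> where \<delta>: "\<delta> > 0" "\<And>t. \<bar>t\<bar> < \<delta> \<Longrightarrow> chart_map c p + t *\<^sub>R x \<in> ?W"
    using line_in_open[OF oW pW, of x] by metis
  have "\<exists>r. r \<in> P \<and> r \<in> chart_dom c \<and> r \<in> V \<and> chart_map c r = chart_map c p + t *\<^sub>R x" if t: "\<bar>t\<bar> < \<delta>" for t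
  proof -
    obtain r where r: "r \<in> chart_dom c" "r \<in> V" "chart_map c p + t *\<^sub>R x = chart_map c r" using \<delta>(2)[OF t] by blast
    have "chart_map c r \<in> S" unfolding r(3)[symmetric] by (intro subspace_add subspace_scale S pS x)
    then have "chart_map c r \<in> chart_map c ` (P \<inter> chart_dom c)" unfolding eq using r(1) by blast
    then obtain r' where r': "r' \<in> P" "r' \<in> chart_dom c" "chart_map c r = chart_map c r'" by blast
    have "r = r'" using r'(3) chart_facts(5)[OF c(1) r(1)] chart_facts(5)[OF c(1) r'(2)] by metis
    then show ?thesis using r r' by metis
  qed
  with \<delta>(1) show thesis using that by blast
qed

text \<open>Segments of \<open>P\<close> that are straight in one slice chart remain in the slice of
  the other, and so do their velocities. This makes the tangent space of \<open>P\<close>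
  independent of the slice chart.\<close>

lemma TD_slice:
  assumes c: "slice_chart M P p c S" and d: "slice_chart M P p d S'" and p: "p \<in> P" and x: "x \<in> S"
  shows "TD c d p x \<in> S'"
proof -
  have cd: "c \<in> charts_at M p" "d \<in> charts_at M p" and S': "subspace S'"
    and eq: "chart_map d ` (P \<inter> chart_dom d) = img d \<inter> S'"
    using c d by (auto simp: slice_chart_def)
  have at: "c \<in> atlas M" "d \<in> atlas M" "p \<in> chart_dom c" "p \<in> chart_dom d" using cd by (auto simp: charts_at_iff)
  obtain \<delta> where \<delta>: "\<delta> > 0" "\<And>t. \<bar>t\<bar> < \<delta> \<Longrightarrow> \<exists>r. r \<in> P \<and> r \<in> chart_dom c \<and> r \<in> chart_dom d \<and> chart_map c r = chart_map c p + t *\<^sub>R x"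
    using slice_chart_line[OF c p x chart_facts(1)[OF at(2)] at(4)] by metis
  show ?thesis
  proof (rule derivative_in_subspace[OF trans_has_derivative[OF cd] S' \<delta>(1)])
    fix t :: real assume "\<bar>t\<bar> < \<delta>"
    then obtain r where r: "r \<in> P" "r \<in> chart_dom c" "r \<in> chart_dom d" "chart_map c r = chart_map c p + t *\<^sub>R x"
      using \<delta>(2) by blast
    have "chart_map d r \<in> S'" using eq r(1,3) by blast
    then show "trm c d (chart_map c p + t *\<^sub>R x) \<in> S'"
      using chart_facts(5)[OF at(1) r(2)] by (simp add: r(4)[symmetric])
  qed
qed

lemma sub_tangent_space_iff:
  assumes c: "slice_chart M P p c S" and p: "p \<in> P"
  shows "v \<in> sub_tangent_space M P p \<longleftrightarrow> v \<in> tangent_space M p \<and> v c \<in> S"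
proof
  assume "v \<in> sub_tangent_space M P p"
  then obtain d S' where d: "slice_chart M P p d S'" "v d \<in> S'" and v: "v \<in> tangent_space M p"
    by (auto simp: sub_tangent_space_def)
  have "v c = TD d c p (v d)"
    by (rule tangent_nth[OF v]) (use c d in \<open>auto simp: slice_chart_def\<close>)
  then show "v \<in> tangent_space M p \<and> v c \<in> S" using TD_slice[OF d(1) c p d(2)] v by simp
next
  assume "v \<in> tangent_space M p \<and> v c \<in> S"
  then show "v \<in> sub_tangent_space M P p" unfolding sub_tangent_space_def using c by blast
qed

lemma slice_chart_other_point:
  assumes "slice_chart M P p c S" "r \<in> chart_dom c"
  shows "slice_chart M P r c S"
  using assms by (simp add: slice_chart_def charts_at_iff)

end

locale spacelike_surface = lorentz_manifold M for M :: "'a::topological_space lorentz_structure" +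
  fixes P :: "'a set" and p :: 'a
  assumes spacelike: "spacelike_submanifold_codim2 M P" and p: "p \<in> P"
begin

abbreviation "TP \<equiv> sub_tangent_space M P p"
abbreviation "NP \<equiv> sub_normal_space M P p"
abbreviation "TM \<equiv> tangent_space M p"
abbreviation "g \<equiv> metric M p"
abbreviation "II \<equiv> second_fundamental_form M P p"

lemma slice_exists: obtains c S where "slice_chart M P p c S"
  using spacelike p by (auto simp: spacelike_submanifold_codim2_def submanifold_codim2_def)

lemma TP_sub: "v \<in> TP \<Longrightarrow> v \<in> TM"
  by (simp add: sub_tangent_space_def)

lemma NP_sub: "v \<in> NP \<Longrightarrow> v \<in> TM"
  by (simp add: sub_normal_space_def)

lemma NP_orth: "n \<in> NP \<Longrightarrow> v \<in> TP \<Longrightarrow> g n v = 0"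
  by (simp add: sub_normal_space_def)

lemma TP_lin: "u \<in> TP \<Longrightarrow> v \<in> TP \<Longrightarrow> (\<lambda>c. x *\<^sub>R u c + y *\<^sub>R v c) \<in> TP"
proof -
  assume uv: "u \<in> TP" "v \<in> TP"
  obtain c S where c: "slice_chart M P p c S" using slice_exists .
  then have S: "subspace S" by (simp add: slice_chart_def)
  show ?thesis
    using uv tangent_lin[of u p v x y] subspace_add[OF S] subspace_scale[OF S]
    unfolding sub_tangent_space_iff[OF c p] by blast
qed

lemma TP_neg: "v \<in> TP \<Longrightarrow> v \<noteq> zero_tvec \<Longrightarrow> g v v < 0"
  using spacelike p by (simp add: spacelike_submanifold_codim2_def)

lemma g_zero_right: "u \<in> TM \<Longrightarrow> g u zero_tvec = 0"
  using metric_lin(2)[OF zero_tangent zero_tangent, of u p 0 0] by (simp add: zero_tvec_def)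

lemma TP_normalize:
  assumes "v \<in> TP" "v \<noteq> zero_tvec"
  obtains e x where "e = (\<lambda>c. x *\<^sub>R v c)" "e \<in> TP" "g e e = - 1" "\<And>w. w \<in> TM \<Longrightarrow> g e w = x * g v w"
proof -
  define x where "x = 1 / sqrt (- g v v)"
  define e where "e = (\<lambda>c. x *\<^sub>R v c)"
  have neg: "- g v v > 0" using TP_neg[OF assms] by simp
  have e: "e = (\<lambda>c. x *\<^sub>R v c + 0 *\<^sub>R v c)" by (simp add: e_def)
  have eT: "e \<in> TP" unfolding e by (rule TP_lin[OF assms(1,1)])
  have ew: "g e w = x * g v w" if "w \<in> TM" for w
    unfolding e using metric_lin(1)[OF TP_sub TP_sub that, of v v x 0] assms by simp
  have "g e v = g v e" using metric_sym[OF TP_sub[OF eT] TP_sub[OF assms(1)]] .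
  then have "g e e = x * (x * g v v)"
    using ew[OF TP_sub[OF eT]] ew[OF TP_sub[OF assms(1)]] by simp
  also have "\<dots> = (x * x) * g v v" by (simp add: mult.assoc)
  also have "x * x = 1 / (- g v v)" using neg by (simp add: x_def)
  finally have "g e e = - 1" using neg by (simp add: field_simps)
  then show thesis using that[OF e_def eT _ ew] by blast
qed

lemma orthonormal_basis_exists: obtains e1 e2 where "orthonormal_basis M P p e1 e2"
proof -
  obtain c S where sl: "slice_chart M P p c S" using slice_exists .
  then have c: "c \<in> charts_at M p" and S: "subspace S" "dim S = 2" by (auto simp: slice_chart_def)
  obtain B where B: "B \<subseteq> S" "independent B" "card B = 2"
    using basis_exists[of S] S(2) by metis
  then obtain x y where xy: "B = {x, y}" "x \<noteq> y" by (auto simp: card_2_iff)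
  let ?u = "tvec_of_components M c p x" and ?v = "tvec_of_components M c p y"
  have u: "?u \<in> TP" and v: "?v \<in> TP"
    using B xy by (auto simp: sub_tangent_space_iff[OF sl p] tvec_of_components_in[OF c] tvec_of_components_self[OF c])
  have nd: "a *\<^sub>R x + b *\<^sub>R y = 0 \<Longrightarrow> b = 0" "x \<noteq> 0" for a b
  proof -
    show "x \<noteq> 0" using B(2) xy dependent_zero by blast
    assume *: "a *\<^sub>R x + b *\<^sub>R y = 0"
    have "y \<notin> span {x}" using B(2) xy by (simp add: independent_insert insert_commute[of x y])
    moreover have "y = (- a / b) *\<^sub>R x" if "b \<noteq> 0"
    proof -
      have "b *\<^sub>R y = - (a *\<^sub>R x)" using * by (simp add: eq_neg_iff_add_eq_0 add.commute)
      then have "(1 / b) *\<^sub>R b *\<^sub>R y = (1 / b) *\<^sub>R (- (a *\<^sub>R x))" by simp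
      then show ?thesis using that by simp
    qed
    ultimately show "b = 0" using span_mul[OF span_base[of x "{x}"]] by blast
  qed
  have "?u \<noteq> zero_tvec" using nd(2) tvec_of_components_self[OF c, of x] by (auto simp: zero_tvec_def)
  from TP_normalize[OF u this] obtain e1 a where e1: "e1 = (\<lambda>c. a *\<^sub>R ?u c)" "e1 \<in> TP" "g e1 e1 = - 1" by metis
  \<comment> \<open>A Gram-Schmidt step; the sign is + because \<open>e1\<close> has square
    -1.\<close>
  define v' where "v' = (\<lambda>c. 1 *\<^sub>R ?v c + g ?v e1 *\<^sub>R e1 c)"
  have v': "v' \<in> TP" unfolding v'_def by (rule TP_lin[OF v e1(2)])
  have v'e: "g v' e1 = 0"
    unfolding v'_def using metric_lin(1)[OF TP_sub[OF v] TP_sub[OF e1(2)] TP_sub[OF e1(2)], of 1 "g ?v e1"] e1(3) by simp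
  have "v' c = (g ?v e1 * a) *\<^sub>R x + 1 *\<^sub>R y"
    by (simp add: v'_def e1(1) tvec_of_components_self[OF c] add.commute)
  then have "v' \<noteq> zero_tvec" using nd(1)[of "g ?v e1 * a" 1] by (auto simp: zero_tvec_def)
  from TP_normalize[OF v' this] obtain e2 b where
    e2: "e2 \<in> TP" "g e2 e2 = - 1" "\<And>w. w \<in> TM \<Longrightarrow> g e2 w = b * g v' w" by metis
  have "g e1 e2 = 0"
    using e2(3)[OF TP_sub[OF e1(2)]] v'e metric_sym[OF TP_sub[OF e1(2)] TP_sub[OF e2(1)]] by simp
  then have "orthonormal_basis M P p e1 e2"
    using e1 e2 by (simp add: orthonormal_basis_def)
  then show thesis by (rule that)
qed

text \<open>Two orthonormal vectors are independent and hence span the slice, whose dimension is 2.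
  The minus signs reflect the squares -1.\<close>

lemma TP_expansion:
  assumes e: "orthonormal_basis M P p e1 e2" and w: "w \<in> TP"
  shows "w = (\<lambda>c. (- g w e1) *\<^sub>R e1 c + (- g w e2) *\<^sub>R e2 c)"
proof -
  have e1: "e1 \<in> TP" "g e1 e1 = - 1" and e2: "e2 \<in> TP" "g e2 e2 = - 1" and e12: "g e1 e2 = 0" "g e2 e1 = 0"
    using e metric_sym[of e1 p e2] by (auto simp: orthonormal_basis_def TP_sub)
  obtain c S where sl: "slice_chart M P p c S" using slice_exists .
  then have c: "c \<in> charts_at M p" and S: "subspace S" "dim S = 2" by (auto simp: slice_chart_def)
  note inS = sub_tangent_space_iff[OF sl p]
  have "e1 c \<noteq> 0"
  proof
    assume "e1 c = 0"
    then have "e1 = zero_tvec" by (intro tangent_eqI[OF TP_sub[OF e1(1)] zero_tangent c]) (simp add: zero_tvec_def)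
    then show False using e1(2) g_zero_right[OF TP_sub[OF e1(1)]] by simp
  qed
  moreover have notin: "e2 c \<notin> span {e1 c}"
  proof
    assume "e2 c \<in> span {e1 c}"
    then obtain r where r: "e2 c = r *\<^sub>R e1 c" by (auto simp: span_singleton)
    have "e2 = (\<lambda>d. r *\<^sub>R e1 d + 0 *\<^sub>R e1 d)"
      by (rule tangent_eqI[OF TP_sub[OF e2(1)] tangent_lin[OF TP_sub[OF e1(1)] TP_sub[OF e1(1)]] c]) (simp add: r)
    then have "g e2 w = r * g e1 w + 0 * g e1 w" if "w \<in> TM" for w
      using metric_lin(1)[OF TP_sub[OF e1(1)] TP_sub[OF e1(1)] that, of r 0] by simp
    from this[OF TP_sub[OF e1(1)]] this[OF TP_sub[OF e2(1)]] show False using e1 e2 e12 by simp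
  qed
  moreover have "e1 c \<noteq> e2 c"
    using notin span_base by fastforce
  ultimately have ind: "independent {e2 c, e1 c}" "card {e2 c, e1 c} = 2"
    by (simp_all add: independent_insert)
  have "S \<subseteq> span {e2 c, e1 c}"
    by (rule card_ge_dim_independent) (use ind S e1(1) e2(1) inS in auto)
  then have "w c \<in> span {e2 c, e1 c}" using w inS by blast
  then obtain y x where "w c - y *\<^sub>R e2 c = x *\<^sub>R e1 c"
    by (auto simp: span_breakdown_eq[of _ "e2 c"] span_singleton)
  then have wc: "w c = x *\<^sub>R e1 c + y *\<^sub>R e2 c" by (simp add: algebra_simps)
  have w_eq: "w = (\<lambda>d. x *\<^sub>R e1 d + y *\<^sub>R e2 d)"
    by (rule tangent_eqI[OF TP_sub[OF w] tangent_lin[OF TP_sub[OF e1(1)] TP_sub[OF e2(1)]] c]) (rule wc)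
  have "g w v = x * g e1 v + y * g e2 v" if "v \<in> TM" for v
    unfolding w_eq by (rule metric_lin(1)[OF TP_sub[OF e1(1)] TP_sub[OF e2(1)] that])
  from this[OF TP_sub[OF e1(1)]] this[OF TP_sub[OF e2(1)]] have "g w e1 = - x" "g w e2 = - y"
    using e1 e2 e12 by auto
  then show ?thesis using w_eq by simp
qed

text \<open>Justifies the definite description in \<open>normal_part\<close>. Definiteness of the
  metric on \<open>TP\<close> is what makes the tangential and normal spaces complementary.\<close>

lemma normal_part_unique:
  assumes x: "x \<in> TM"
  shows "\<exists>!n. n \<in> NP \<and> (\<lambda>c. x c - n c) \<in> TP"
proof -
  obtain e1 e2 where e: "orthonormal_basis M P p e1 e2" using orthonormal_basis_exists .
  have e1: "e1 \<in> TP" "g e1 e1 = - 1" and e2: "e2 \<in> TP" "g e2 e2 = - 1" and e12: "g e1 e2 = 0" "g e2 e1 = 0"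
    using e metric_sym[of e1 p e2] by (auto simp: orthonormal_basis_def TP_sub)
  define t where "t = (\<lambda>c. (- g x e1) *\<^sub>R e1 c + (- g x e2) *\<^sub>R e2 c)"
  have t: "t \<in> TP" unfolding t_def by (rule TP_lin[OF e1(1) e2(1)])
  have gt: "g t w = - g x e1 * g e1 w + - g x e2 * g e2 w" if "w \<in> TM" for w
    unfolding t_def by (rule metric_lin(1)[OF TP_sub[OF e1(1)] TP_sub[OF e2(1)] that])
  define n where "n = (\<lambda>c. 1 *\<^sub>R x c + (- 1) *\<^sub>R t c)"
  have nT: "n \<in> TM" unfolding n_def by (rule tangent_lin[OF x TP_sub[OF t]])
  have gn: "g n w = 1 * g x w + (- 1) * g t w" if "w \<in> TM" for w
    unfolding n_def by (rule metric_lin(1)[OF x TP_sub[OF t] that])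
  have n1: "g n e1 = 0" using gn[OF TP_sub[OF e1(1)]] gt[OF TP_sub[OF e1(1)]] e1 e12 by simp
  have n2: "g n e2 = 0" using gn[OF TP_sub[OF e2(1)]] gt[OF TP_sub[OF e2(1)]] e2 e12 by simp
  have nN: "n \<in> NP"
    unfolding sub_normal_space_def
  proof (intro CollectI conjI ballI nT)
    fix w assume w: "w \<in> TP"
    have "g n (\<lambda>c. (- g w e1) *\<^sub>R e1 c + (- g w e2) *\<^sub>R e2 c) = 0"
      using metric_lin(2)[OF TP_sub[OF e1(1)] TP_sub[OF e2(1)] nT, of "- g w e1" "- g w e2"] n1 n2 by simp
    then show "g n w = 0" unfolding TP_expansion[OF e w, symmetric] .
  qed
  have xn: "(\<lambda>c. x c - n c) = t" by (simp add: n_def)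
  show ?thesis
  proof (rule ex1I[of _ n])
    show "n \<in> NP \<and> (\<lambda>c. x c - n c) \<in> TP" using nN t xn by simp
    fix m assume m: "m \<in> NP \<and> (\<lambda>c. x c - m c) \<in> TP"
    \<comment> \<open>The difference of two candidates is both tangential and normal, so its square
      is 0, which definiteness on \<open>TP\<close> permits only for the zero vector.\<close>
    define d where "d = (\<lambda>c. 1 *\<^sub>R (x c - m c) + (- 1) *\<^sub>R t c)"
    have dT: "d \<in> TP" unfolding d_def by (rule TP_lin) (use m t in auto)
    have d: "d = (\<lambda>c. 1 *\<^sub>R n c + (- 1) *\<^sub>R m c)" by (simp add: d_def n_def algebra_simps)
    have "g d d = 1 * g n d + (- 1) * g m d"
      using metric_lin(1)[OF nT NP_sub TP_sub[OF dT], of m 1 "-1"] m unfolding d by blast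
    then have "g d d = 0" using NP_orth[OF nN dT] NP_orth[OF _ dT] m by simp
    then have "d = zero_tvec" using TP_neg[OF dT] by force
    then show "m = n" unfolding d by (simp add: fun_eq_iff zero_tvec_def)
  qed
qed

lemma normal_part:
  assumes "x \<in> TM"
  shows "normal_part M P p x \<in> NP" "m \<in> NP \<Longrightarrow> g (normal_part M P p x) m = g x m"
proof -
  let ?n = "normal_part M P p x"
  have n: "?n \<in> NP \<and> (\<lambda>c. x c - ?n c) \<in> TP"
    unfolding normal_part_def by (rule theI'[OF normal_part_unique[OF assms]])
  then show "?n \<in> NP" ..
  assume m: "m \<in> NP"
  have "g n (\<lambda>c. 1 *\<^sub>R x c + (- 1) *\<^sub>R ?n c) = 1 * g n x + (- 1) * g n ?n" if "n \<in> NP" for n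
    using metric_lin(2)[OF assms NP_sub NP_sub[OF that], of ?n 1 "- 1"] n by blast
  moreover have "g n (\<lambda>c. 1 *\<^sub>R x c + (- 1) *\<^sub>R ?n c) = 0" if "n \<in> NP" for n
    using NP_orth[OF that] n by simp
  ultimately show "g ?n m = g x m"
    using m metric_sym[OF NP_sub assms, of m] metric_sym[OF NP_sub NP_sub, of ?n m] n by fastforce
qed

text \<open>Constant components in a slice chart give an extension tangent to \<open>P\<close>.
  Without one, the choice in \<open>second_fundamental_form\<close> would be unspecified.\<close>

lemma tangent_extension_exists:
  assumes w: "w \<in> TP"
  shows "\<exists>W. tangent_extension M P p w W"
proof -
  obtain c S where sl: "slice_chart M P p c S" using slice_exists .
  then have c: "c \<in> atlas M" "p \<in> chart_dom c" and cp: "c \<in> charts_at M p" by (auto simp: slice_chart_def charts_at_iff)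
  have wS: "w c \<in> S" using w by (simp add: sub_tangent_space_iff[OF sl p])
  have cs: "c \<in> charts_at M q" if "q \<in> chart_dom c" for q using that c by (simp add: charts_at_iff)
  let ?W = "\<lambda>q. tvec_of_components M c q (w c)"
  have "smooth_vector_field_on M (chart_dom c) ?W"
    unfolding smooth_vector_field_on_def
  proof (intro conjI ballI)
    fix q assume "q \<in> chart_dom c" then show "?W q \<in> tangent_space M q" by (intro tvec_of_components_in cs)
  next
    fix d assume d: "d \<in> atlas M"
    show "smooth_on (\<lambda>q. ?W (chart_inv d q) d) (overlap d c)"
      unfolding smooth_on_def
    proof
      fix n
      have "Ck_on n (\<lambda>q. frechet_derivative (trm c d) (at (trm d c q)) (w c)) (overlap d c)"
        by (rule Ck_on_compose[where f="\<lambda>r. frechet_derivative (trm c d) (at r) (w c)" and g="trm d c",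
              OF open_overlap[OF d c(1)] open_overlap[OF c(1) d] _
              smooth_on_Ck[OF smooth_on_frechet_derivative[OF smooth_trans[OF c(1) d]]] smooth_on_Ck[OF smooth_trans[OF d c(1)]]])
          (use chart_facts(5)[OF d] in auto)
      then show "Ck_on n (\<lambda>q. ?W (chart_inv d q) d) (overlap d c)"
      proof (rule Ck_on_cong[OF open_overlap[OF d c(1)], rotated])
        fix q assume "q \<in> overlap d c"
        then obtain r where r: "q = chart_map d r" "r \<in> chart_dom d" "r \<in> chart_dom c" by blast
        then have "d \<in> charts_at M r" using d by (simp add: charts_at_iff)
        then show "?W (chart_inv d q) d = frechet_derivative (trm c d) (at (trm d c q)) (w c)"
          using tvec_of_components_nth[OF cs[OF r(3)]] chart_facts(5)[OF d r(2)] r(1) by simp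
      qed
    qed
  qed
  moreover have "?W q \<in> sub_tangent_space M P q" if "q \<in> P \<inter> chart_dom c" for q
  proof -
    have q: "q \<in> P" "q \<in> chart_dom c" using that by auto
    show ?thesis
      unfolding sub_tangent_space_iff[OF slice_chart_other_point[OF sl q(2)] q(1)]
      using tvec_of_components_in[OF cs[OF q(2)]] tvec_of_components_self[OF cs[OF q(2)]] wS by simp
  qed
  moreover have "?W p = w" by (rule tvec_of_components_eq[OF TP_sub[OF w] cp])
  ultimately have "tangent_extension M P p w ?W"
    unfolding tangent_extension_def using chart_facts(1)[OF c(1)] c(2) by blast
  then show ?thesis by blast
qed

text \<open>In a slice chart the derivative of an extension of w along P stays in the slice, so only the
  Christoffel term contributes to the normal part.\<close>

lemma second_fundamental_form:
  assumes sl: "slice_chart M P p c S" and v: "v \<in> TP" and w: "w \<in> TP"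
  shows "II v w \<in> NP"
    "n \<in> NP \<Longrightarrow> g (II v w) n = metric_coord M c (chart_map c p) (christoffel M c (chart_map c p) (v c) (w c)) (n c)"
proof -
  have c: "c \<in> atlas M" "p \<in> chart_dom c" and cp: "c \<in> charts_at M p" and S: "subspace S"
    using sl by (auto simp: slice_chart_def charts_at_iff)
  define W where "W = (SOME W. tangent_extension M P p w W)"
  have "tangent_extension M P p w W"
    unfolding W_def by (rule someI_ex[OF tangent_extension_exists[OF w]])
  then obtain V where Wp: "W p = w" and V: "open V" "p \<in> V" "smooth_vector_field_on M V W"
    and WV: "\<And>q. q \<in> P \<inter> V \<Longrightarrow> W q \<in> sub_tangent_space M P q"
    unfolding tangent_extension_def by blast
  let ?N = "nabla M p v W"
  have II: "II v w = normal_part M P p ?N" by (simp add: second_fundamental_form_def W_def)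
  have N: "?N \<in> TM" by (rule nabla_tangent[OF TP_sub[OF v] V(3,1,2)])
  show "II v w \<in> NP" unfolding II by (rule normal_part(1)[OF N])
  assume n: "n \<in> NP"
  let ?q = "chart_map c p"
  let ?D = "frechet_derivative (\<lambda>q. W (chart_inv c q) c) (at ?q) (v c)"
  have vS: "v c \<in> S" using v by (simp add: sub_tangent_space_iff[OF sl p])
  have dW: "((\<lambda>q. W (chart_inv c q) c) has_derivative frechet_derivative (\<lambda>q. W (chart_inv c q) c) (at ?q)) (at ?q)"
    by (rule smooth_on_has_derivative[OF _ open_chart_image[OF c(1) V(1)]])
      (use V c in \<open>auto simp: smooth_vector_field_on_def\<close>)
  obtain \<delta> where \<delta>: "\<delta> > 0" "\<And>t. \<bar>t\<bar> < \<delta> \<Longrightarrow> \<exists>r. r \<in> P \<and> r \<in> chart_dom c \<and> r \<in> V \<and> chart_map c r = ?q + t *\<^sub>R v c"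
    using slice_chart_line[OF sl p vS V(1,2)] by metis
  have DS: "?D \<in> S"
  proof (rule derivative_in_subspace[OF dW S \<delta>(1)])
    fix t :: real assume "\<bar>t\<bar> < \<delta>"
    then obtain r where r: "r \<in> P" "r \<in> chart_dom c" "r \<in> V" "chart_map c r = ?q + t *\<^sub>R v c" using \<delta>(2) by blast
    have "W r c \<in> S"
      using WV[of r] r unfolding sub_tangent_space_iff[OF slice_chart_other_point[OF sl r(2)] r(1)] by blast
    then show "W (chart_inv c (?q + t *\<^sub>R v c)) c \<in> S"
      unfolding r(4)[symmetric] chart_facts(5)[OF c(1) r(2)] .
  qed
  let ?T = "tvec_of_components M c p ?D"
  have T: "?T \<in> TP"
    unfolding sub_tangent_space_iff[OF sl p] using tvec_of_components_in[OF cp] tvec_of_components_self[OF cp] DS by simp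
  have nT: "n \<in> TM" by (rule NP_sub[OF n])
  interpret L: local_metric "img c" "metric_coord M c" by (rule local_metric_chart[OF c(1)])
  have q: "?q \<in> img c" using c by blast
  have "g (II v w) n = g ?N n" unfolding II by (rule normal_part(2)[OF N n])
  also have "\<dots> = metric_coord M c ?q (?N c) (n c)" by (rule metric_eq_coord[OF N nT cp])
  also have "?N c = ?D + christoffel M c ?q (v c) (w c)" using cp by (simp add: nabla_def Wp)
  also have "metric_coord M c ?q (?D + christoffel M c ?q (v c) (w c)) (n c)
     = metric_coord M c ?q ?D (n c) + metric_coord M c ?q (christoffel M c ?q (v c) (w c)) (n c)"
    by (simp add: L.lin_simps[OF q])
  also have "metric_coord M c ?q ?D (n c) = g ?T n"
    using metric_eq_coord[OF TP_sub[OF T] nT cp] tvec_of_components_self[OF cp] by simp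
  also have "g ?T n = 0" using NP_orth[OF n T] metric_sym[OF nT TP_sub[OF T]] by simp
  finally show "g (II v w) n = metric_coord M c ?q (christoffel M c ?q (v c) (w c)) (n c)" by simp
qed

lemma second_fundamental_form_sym:
  assumes "v \<in> TP" "w \<in> TP" "n \<in> NP"
  shows "g (II v w) n = g (II w v) n"
proof -
  obtain c S where sl: "slice_chart M P p c S" using slice_exists .
  then have c: "c \<in> atlas M" "p \<in> chart_dom c" by (auto simp: slice_chart_def charts_at_iff)
  interpret L: local_metric "img c" "metric_coord M c" by (rule local_metric_chart[OF c(1)])
  show ?thesis
    using second_fundamental_form(2)[OF sl assms] second_fundamental_form(2)[OF sl assms(2,1,3)]
      L.christoffel_sym[of "chart_map c p" "v c" "w c"] c by (simp add: christoffel_eq)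
qed

lemma second_fundamental_form_lin:
  assumes "u \<in> TP" "v \<in> TP" "w \<in> TP" "n \<in> NP"
  shows "g (II (\<lambda>c. x *\<^sub>R u c + y *\<^sub>R v c) w) n = x * g (II u w) n + y * g (II v w) n"
proof -
  obtain c S where sl: "slice_chart M P p c S" using slice_exists .
  then have c: "c \<in> atlas M" "chart_map c p \<in> img c" by (auto simp: slice_chart_def charts_at_iff)
  interpret L: local_metric "img c" "metric_coord M c" by (rule local_metric_chart[OF c(1)])
  show ?thesis
    unfolding second_fundamental_form(2)[OF sl assms(1,3,4)] second_fundamental_form(2)[OF sl assms(2,3,4)]
      second_fundamental_form(2)[OF sl TP_lin[OF assms(1,2)] assms(3,4)]
    by (simp add: christoffel_eq L.christoffel_lin_simps[OF c(2)] L.lin_simps[OF c(2)])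
qed

text \<open>Exposes the very basis chosen by the definition. The parallel frame used later starts
  from this basis, so independence of the basis need not be shown.\<close>

lemma mean_normal_curvature:
  obtains e1 e2 where "orthonormal_basis M P p e1 e2"
    "\<And>n. n \<in> NP \<Longrightarrow> 2 * g (mean_normal_curvature M P p) n = g (II e1 e1) n + g (II e2 e2) n"
proof -
  define e where "e = (SOME (e1, e2). orthonormal_basis M P p e1 e2)"
  have "\<exists>e. case e of (e1, e2) \<Rightarrow> orthonormal_basis M P p e1 e2"
  proof -
    obtain e1 e2 where "orthonormal_basis M P p e1 e2" using orthonormal_basis_exists .
    then show ?thesis by (intro exI[of _ "(e1, e2)"]) simp
  qed
  then have "case e of (e1, e2) \<Rightarrow> orthonormal_basis M P p e1 e2" unfolding e_def by (rule someI_ex)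
  then obtain e1 e2 where e: "e = (e1, e2)" "orthonormal_basis M P p e1 e2" by (cases e) auto
  have T: "e1 \<in> TP" "e2 \<in> TP" using e(2) by (auto simp: orthonormal_basis_def)
  obtain c S where sl: "slice_chart M P p c S" using slice_exists .
  note N = NP_sub[OF second_fundamental_form(1)[OF sl T(1) T(1)]] NP_sub[OF second_fundamental_form(1)[OF sl T(2) T(2)]]
  have "mean_normal_curvature M P p = (\<lambda>c. (1/2) *\<^sub>R II e1 e1 c + (1/2) *\<^sub>R II e2 e2 c)"
    unfolding mean_normal_curvature_def e_def[symmetric] e(1) by (simp add: scaleR_add_right)
  then have "2 * g (mean_normal_curvature M P p) n = g (II e1 e1) n + g (II e2 e2) n" if "n \<in> NP" for n
    using metric_lin(1)[OF N NP_sub[OF that], of "1/2" "1/2"] by simp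
  with e(2) show thesis by (rule that)
qed

end

section \<open>The Riccati inequality and tent test functions\<close>

text \<open>Raychaudhuri's argument: with \<open>\<theta> = D'/D\<close>, the symmetry of the shape operator gives
  \<open>\<theta>' \<le> - s11 - s22 - \<theta>\<^sup>2/2\<close>, which is integrated against \<open>(1 - t/l)\<^sup>2\<close>. The inequality is strict because
  equality would force \<open>\<theta> = - 2/(l - t)\<close>, which is unbounded.\<close>

lemma jacobi_determinant_bound:
  fixes a b c d a1 b1 c1 d1 s11 s12 s22 :: "real \<Rightarrow> real"
  assumes l: "0 < l"
    and der: "\<And>t. t \<in> {0..l} \<Longrightarrow> (a has_real_derivative a1 t) (at t within {0..l})"
      "\<And>t. t \<in> {0..l} \<Longrightarrow> (b has_real_derivative b1 t) (at t within {0..l})"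
      "\<And>t. t \<in> {0..l} \<Longrightarrow> (c has_real_derivative c1 t) (at t within {0..l})"
      "\<And>t. t \<in> {0..l} \<Longrightarrow> (d has_real_derivative d1 t) (at t within {0..l})"
    and der1: "\<And>t. t \<in> {0..l} \<Longrightarrow> (a1 has_real_derivative - (s11 t * a t + s12 t * b t)) (at t within {0..l})"
      "\<And>t. t \<in> {0..l} \<Longrightarrow> (b1 has_real_derivative - (s12 t * a t + s22 t * b t)) (at t within {0..l})"
      "\<And>t. t \<in> {0..l} \<Longrightarrow> (c1 has_real_derivative - (s11 t * c t + s12 t * d t)) (at t within {0..l})"
      "\<And>t. t \<in> {0..l} \<Longrightarrow> (d1 has_real_derivative - (s12 t * c t + s22 t * d t)) (at t within {0..l})"
    and init: "a 0 = 1" "b 0 = 0" "c 0 = 0" "d 0 = 1" "b1 0 = c1 0"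
    and cont: "continuous_on {0..l} s11" "continuous_on {0..l} s22"
    and nz: "\<And>t. t \<in> {0..l} \<Longrightarrow> a t * d t - b t * c t \<noteq> 0"
  shows "integral {0..l} (\<lambda>t. (1 - t / l)\<^sup>2 * (s11 t + s22 t)) < a1 0 + d1 0 + 2 / l"
proof -
  let ?I = "{0..l}"
  \<comment> \<open>The Wronskian of the two solutions. It is constant because S is symmetric, and
    zero by the initial symmetry; this says that A' A^(-1) is symmetric, where A has the columns (a,
    b) and (c, d).\<close>
  define W where "W = (\<lambda>t. a t * c1 t + b t * d1 t - a1 t * c t - b1 t * d t)"
  have "(W has_real_derivative 0) (at t within ?I)" if t: "t \<in> ?I" for t
    unfolding W_def
    by (rule derivative_eq_intros der[OF t] der1[OF t] refl)+ (simp add: algebra_simps)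
  from has_field_derivative_zero_constant[OF _ this] obtain C where C: "\<And>t. t \<in> ?I \<Longrightarrow> W t = C" by auto
  have "W 0 = 0" using init by (simp add: W_def)
  then have W: "W t = 0" if "t \<in> ?I" for t using C[OF that] C[of 0] l by simp
  \<comment> \<open>\<open>D\<close> is det A, \<open>D1\<close> its derivative, and
    \<open>e\<close> is det A'. Thus D1/D and e/D are the trace and the determinant of A'
    A^(-1).\<close>
  define D where "D = (\<lambda>t. a t * d t - b t * c t)"
  define D1 where "D1 = (\<lambda>t. a1 t * d t + a t * d1 t - b1 t * c t - b t * c1 t)"
  define e where "e = (\<lambda>t. a1 t * d1 t - b1 t * c1 t)"
  have dD: "(D has_real_derivative D1 t) (at t within ?I)" if t: "t \<in> ?I" for t
    unfolding D_def D1_def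
    by (rule derivative_eq_intros der[OF t] refl)+ (simp add: algebra_simps)
  have dD1: "(D1 has_real_derivative - (s11 t + s22 t) * D t + 2 * e t) (at t within ?I)" if t: "t \<in> ?I" for t
    unfolding D_def D1_def e_def
    by (rule derivative_eq_intros der[OF t] der1[OF t] refl)+ (simp add: algebra_simps)
  have D: "D t \<noteq> 0" if "t \<in> ?I" for t using nz[OF that] by (simp add: D_def)
  define \<theta> where "\<theta> = (\<lambda>t. D1 t / D t)"
  define \<theta>' where "\<theta>' = (\<lambda>t. - (s11 t + s22 t) + 2 * (e t / D t) - (\<theta> t)\<^sup>2)"
  have d\<theta>: "(\<theta> has_real_derivative \<theta>' t) (at t within ?I)" if t: "t \<in> ?I" for t
    unfolding \<theta>_def
    by (rule derivative_eq_intros dD[OF t] dD1[OF t] D[OF t] refl)+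
      (use D[OF t] in \<open>simp add: \<theta>'_def \<theta>_def power2_eq_square field_simps\<close>)
  \<comment> \<open>For a symmetric 2 by 2 matrix the discriminant trace^2 - 4 det is a sum of
    squares. It measures the shear.\<close>
  have shear: "4 * (e t / D t) \<le> (\<theta> t)\<^sup>2" if t: "t \<in> ?I" for t
  proof -
    have "(D1 t)\<^sup>2 - 4 * (D t * e t) = (a1 t * d t - b t * c1 t - (a t * d1 t - b1 t * c t))\<^sup>2
        + 4 * ((a t * c1 t - a1 t * c t) * (b1 t * d t - b t * d1 t))"
      by (simp add: D1_def D_def e_def power2_eq_square algebra_simps)
    also have "b1 t * d t - b t * d1 t = a t * c1 t - a1 t * c t"
      using W[OF t] by (simp add: W_def)
    finally have "4 * (D t * e t) \<le> (D1 t)\<^sup>2"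
      using zero_le_square[of "a t * c1 t - a1 t * c t"] by (smt (verit) zero_le_power2)
    then have "4 * (D t * e t) / (D t)\<^sup>2 \<le> (D1 t)\<^sup>2 / (D t)\<^sup>2"
      by (rule divide_right_mono) simp
    then show ?thesis using D[OF t] by (simp add: \<theta>_def power_divide power2_eq_square)
  qed
  define f where "f = (\<lambda>t. 1 - t / l)"
  define h where "h = (\<lambda>t. (f t)\<^sup>2 * \<theta> t)"
  define h' where "h' = (\<lambda>t. - 2 / l * f t * \<theta> t + (f t)\<^sup>2 * \<theta>' t)"
  have dh: "(h has_real_derivative h' t) (at t within ?I)" if t: "t \<in> ?I" for t
  proof -
    have df: "(f has_real_derivative - 1 / l) (at t within ?I)"
      unfolding f_def by (rule derivative_eq_intros refl)+ (use l in simp_all)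
    show ?thesis
      unfolding h_def by (rule derivative_eq_intros d\<theta>[OF t] df refl)+ (simp add: h'_def)
  qed
  have \<theta>c: "continuous_on ?I \<theta>"
    by (rule DERIV_continuous_on[OF d\<theta>])
  have fc: "continuous_on ?I f" unfolding f_def by (intro continuous_intros) (use l in auto)
  \<comment> \<open>Completing the square: - 2 f \<theta> / l - f^2 \<theta>^2 / 2 = 2 / l^2 - u^2 /
    2. Integrating 2 / l^2 over the interval produces the term 2 / l.\<close>
  define u where "u = (\<lambda>t. f t * \<theta> t + 2 / l)"
  have uc: "continuous_on ?I (\<lambda>t. (u t)\<^sup>2)" unfolding u_def by (intro continuous_intros \<theta>c fc)
  have \<rho>c: "continuous_on ?I (\<lambda>t. (f t)\<^sup>2 * (s11 t + s22 t))" by (intro continuous_intros fc cont)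
  have "(h' has_integral (h l - h 0)) ?I"
    by (rule fundamental_theorem_of_calculus) (use l dh has_real_derivative_iff_has_vector_derivative in auto)
  moreover have "h l - h 0 = - (a1 0 + d1 0)"
    using init l by (simp add: h_def f_def \<theta>_def D_def D1_def)
  ultimately have I1: "(h' has_integral - (a1 0 + d1 0)) ?I" by simp
  have iu: "((\<lambda>t. (u t)\<^sup>2) has_integral integral ?I (\<lambda>t. (u t)\<^sup>2)) ?I"
    by (rule integrable_integral[OF integrable_continuous_real[OF uc]])
  have i\<rho>: "((\<lambda>t. (f t)\<^sup>2 * (s11 t + s22 t)) has_integral integral ?I (\<lambda>t. (f t)\<^sup>2 * (s11 t + s22 t))) ?I"
    by (rule integrable_integral[OF integrable_continuous_real[OF \<rho>c]])
  have ic: "((\<lambda>t. 2 / l\<^sup>2) has_integral 2 / l) ?I"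
    using has_integral_const_real[of "2 / l\<^sup>2" 0 l] l by (simp add: power2_eq_square)
  have I2: "((\<lambda>t. 2 / l\<^sup>2 - (f t)\<^sup>2 * (s11 t + s22 t) - 1/2 * (u t)\<^sup>2) has_integral
      2 / l - integral ?I (\<lambda>t. (f t)\<^sup>2 * (s11 t + s22 t)) - 1/2 * integral ?I (\<lambda>t. (u t)\<^sup>2)) ?I"
    by (intro has_integral_diff ic i\<rho> has_integral_mult_right iu)
  have "- (a1 0 + d1 0) \<le> 2 / l - integral ?I (\<lambda>t. (f t)\<^sup>2 * (s11 t + s22 t)) - 1/2 * integral ?I (\<lambda>t. (u t)\<^sup>2)"
  proof (rule has_integral_le[OF I1 I2])
    fix t assume t: "t \<in> ?I"
    have "(f t)\<^sup>2 * (4 * (e t / D t)) \<le> (f t)\<^sup>2 * (\<theta> t)\<^sup>2"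
      by (rule mult_left_mono[OF shear[OF t]]) simp
    moreover have "2 / l\<^sup>2 - (f t)\<^sup>2 * (s11 t + s22 t) - 1/2 * (u t)\<^sup>2
        = - 2 / l * f t * \<theta> t - (f t)\<^sup>2 * (s11 t + s22 t) - 1/2 * ((f t)\<^sup>2 * (\<theta> t)\<^sup>2)"
      unfolding u_def using l by (simp add: power2_eq_square field_simps)
    moreover have "h' t = - 2 / l * f t * \<theta> t - (f t)\<^sup>2 * (s11 t + s22 t) + 1/2 * ((f t)\<^sup>2 * (4 * (e t / D t))) - (f t)\<^sup>2 * (\<theta> t)\<^sup>2"
      by (simp add: h'_def \<theta>'_def algebra_simps)
    moreover have "x \<le> y \<Longrightarrow> v = p - q - 1/2 * y \<Longrightarrow> z = p - q + 1/2 * x - y \<Longrightarrow> z \<le> v" for x y p q v z :: real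
      by simp
    ultimately show "h' t \<le> 2 / l\<^sup>2 - (f t)\<^sup>2 * (s11 t + s22 t) - 1/2 * (u t)\<^sup>2" by blast
  qed
  moreover have "integral ?I (\<lambda>t. (u t)\<^sup>2) > 0"
  proof -
    have "integral ?I (\<lambda>t. (u t)\<^sup>2) \<ge> 0" by (rule integral_nonneg) (use iu in auto)
    moreover have "integral ?I (\<lambda>t. (u t)\<^sup>2) \<noteq> 0"
    proof
      assume "integral ?I (\<lambda>t. (u t)\<^sup>2) = 0"
      then have "\<forall>t\<in>?I. (u t)\<^sup>2 = 0"
        using integral_eq_0_iff[OF uc l] by simp
      \<comment> \<open>At the right end f vanishes and u = 2 / l, so the discarded square has
        positive integral.\<close>
      then have "(u l)\<^sup>2 = 0" using l by (simp del: power_eq_0_iff)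
      then show False using l by (simp add: u_def f_def)
    qed
    ultimately show ?thesis by simp
  qed
  ultimately show ?thesis unfolding f_def by linarith
qed

section \<open>Test functions for the integral inequality\<close>

lemma DERIV_zero_of_quadratic_bound:
  fixes f :: "real \<Rightarrow> real"
  assumes "\<And>x. \<bar>f x\<bar> \<le> K * x\<^sup>2"
  shows "(f has_real_derivative 0) (at 0)"
proof -
  have f0: "f 0 = 0" using assms[of 0] by simp
  have "((\<lambda>y. f y / y) \<longlongrightarrow> 0) (at 0)"
  proof (rule Lim_null_comparison)
    show "\<forall>\<^sub>F y in at 0. norm (f y / y) \<le> K * \<bar>y\<bar>"
      unfolding eventually_at_filter
    proof (rule always_eventually, intro allI impI)
      fix y :: real assume "y \<noteq> 0"
      then show "norm (f y / y) \<le> K * \<bar>y\<bar>"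
        using assms[of y] by (simp add: abs_divide divide_le_eq power2_eq_square abs_mult_self_eq mult.assoc)
    qed
    have "((\<lambda>y. K * \<bar>y\<bar>) \<longlongrightarrow> K * \<bar>0\<bar>) (at (0::real))" by (intro tendsto_intros)
    then show "((\<lambda>y. K * \<bar>y\<bar>) \<longlongrightarrow> 0) (at (0::real))" by simp
  qed
  then show ?thesis by (simp add: has_field_derivative_iff f0)
qed

text \<open>A \<open>C\<^sup>1\<close> stand-in for \<open>max 0\<close>, to which it tends as \<open>e\<close> goes to \<open>0\<close>.\<close>

definition ramp :: "real \<Rightarrow> real \<Rightarrow> real" where
  "ramp e x = (max 0 x)\<^sup>2 / (max 0 x + e)"

text \<open>One expression serves both sides: for x \<le> 0 the quotient is e / e = 1 and the value
  is 0, while for x > 0 this is the derivative of x^2 / (x + e).\<close>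

definition ramp_deriv :: "real \<Rightarrow> real \<Rightarrow> real" where
  "ramp_deriv e x = 1 - (e / (max 0 x + e))\<^sup>2"

lemma ramp_has_derivative:
  assumes e: "e > 0"
  shows "(ramp e has_real_derivative ramp_deriv e x) (at x)"
proof -
  consider "x < 0" | "x = 0" | "x > 0" by linarith
  then show ?thesis
  proof cases
    case 1
    have "(ramp e has_real_derivative 0) (at x)"
      by (rule has_field_derivative_transform_within_open[of "\<lambda>_. 0" _ _ "{..<0}"]) (use 1 in \<open>auto simp: ramp_def\<close>)
    then show ?thesis using 1 e by (simp add: ramp_deriv_def)
  next
    case 2
    \<comment> \<open>At the junction of the two formulas a quadratic bound from both sides replaces
      a computation.\<close>
    have "(ramp e has_real_derivative 0) (at 0)"
    proof (rule DERIV_zero_of_quadratic_bound[of _ "1 / e"])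
      fix x :: real
      have "ramp e x \<le> (max 0 x)\<^sup>2 / e" unfolding ramp_def using e by (intro divide_left_mono) auto
      also have "\<dots> \<le> x\<^sup>2 / e" using e by (intro divide_right_mono) (auto simp: max_def)
      finally show "\<bar>ramp e x\<bar> \<le> 1 / e * x\<^sup>2" using e by (simp add: ramp_def)
    qed
    then show ?thesis using 2 e by (simp add: ramp_deriv_def)
  next
    case 3
    have nz: "x + e \<noteq> 0" using 3 e by simp
    have "((\<lambda>x. x\<^sup>2 / (x + e)) has_real_derivative (2 * x * (x + e) - x\<^sup>2) / (x + e)\<^sup>2) (at x)"
      by (rule derivative_eq_intros refl nz)+ (simp add: power2_eq_square)
    moreover have "(2 * x * (x + e) - x\<^sup>2) / (x + e)\<^sup>2 = ((x + e)\<^sup>2 - e\<^sup>2) / (x + e)\<^sup>2"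
      by (rule arg_cong[of _ _ "\<lambda>y. y / _"]) (simp add: power2_eq_square algebra_simps)
    moreover have "\<dots> = ramp_deriv e x"
      using 3 nz by (simp add: ramp_deriv_def power_divide diff_divide_distrib)
    ultimately have "((\<lambda>x. x\<^sup>2 / (x + e)) has_real_derivative ramp_deriv e x) (at x)" by simp
    then show ?thesis
      by (rule has_field_derivative_transform_within_open[of _ _ _ "{0<..}"]) (use 3 in \<open>auto simp: ramp_def\<close>)
  qed
qed

lemma ramp_bounds:
  assumes e: "e > 0"
  shows "0 \<le> ramp e x" "ramp e x \<le> max 0 x" "max 0 x - e \<le> ramp e x" "\<bar>ramp_deriv e x\<bar> \<le> 1"
proof -
  define m where "m = max 0 x"
  have m: "m \<ge> 0" by (simp add: m_def)
  show "0 \<le> ramp e x" using e by (simp add: ramp_def)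
  have "m\<^sup>2 / (m + e) \<le> m" using m e by (simp add: divide_le_eq power2_eq_square algebra_simps)
  then show "ramp e x \<le> max 0 x" by (simp add: ramp_def m_def)
  have "m - e \<le> m\<^sup>2 / (m + e)" using m e by (simp add: le_divide_eq power2_eq_square algebra_simps)
  then show "max 0 x - e \<le> ramp e x" by (simp add: ramp_def m_def)
  have "0 \<le> e / (m + e)" "e / (m + e) \<le> 1" using m e by auto
  then have "(e / (m + e))\<^sup>2 \<le> 1" "0 \<le> (e / (m + e))\<^sup>2" by (auto simp: power_le_one)
  then show "\<bar>ramp_deriv e x\<bar> \<le> 1" by (simp add: ramp_deriv_def m_def)
qed

text \<open>The tent \<open>min p q\<close> with \<open>p = 1 + t/L\<close> and \<open>q = 1 - t/l\<close> is only Lipschitz and its support may touch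
  the endpoints. It is approximated by applying \<^const>\<open>ramp\<close> to \<open>(p + q - sqrt ((p - q)\<^sup>2 + \<epsilon>\<^sup>2)) / 2 - \<epsilon>\<close>, which
  lies below \<open>min p q - \<epsilon>\<close>, so that the supports become compact.\<close>

lemma tent_test_function:
  fixes \<rho> :: "real \<Rightarrow> real"
  assumes L: "0 < L" "L \<le> l0" and l: "0 < l" and \<rho>: "continuous_on {- l0..l} \<rho>"
    and ineq: "\<And>g. g C1_differentiable_on UNIV \<Longrightarrow> compact (closure {t. g t \<noteq> 0}) \<Longrightarrow>
      closure {t. g t \<noteq> 0} \<subseteq> {- l0<..<l} \<Longrightarrow>
      integral {- l0..l} (\<lambda>t. (g t)\<^sup>2 * \<rho> t) \<ge> - Q * integral {- l0..l} (\<lambda>t. (deriv g t)\<^sup>2)"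
  shows "- Q * (1 / L + 1 / l) \<le> integral {- L..0} (\<lambda>t. (1 + t / L)\<^sup>2 * \<rho> t) + integral {0..l} (\<lambda>t. (1 - t / l)\<^sup>2 * \<rho> t)"
proof -
  \<comment> \<open>The two linear pieces of the tent have difference \<kappa> t and sum 2 + \<mu>
    t; its slopes are (\<mu> + \<kappa>) / 2 = 1 / L and (\<mu> - \<kappa>) / 2 = - 1 / l.\<close>
  define \<kappa> where "\<kappa> = 1 / L + 1 / l"
  define \<mu> where "\<mu> = 1 / L - 1 / l"
  have "1 / L > 0" "1 / l > 0" using L l by simp_all
  then have \<kappa>: "\<kappa> > 0" "\<bar>\<mu>\<bar> \<le> \<kappa>" unfolding \<kappa>_def \<mu>_def by linarith+
  define \<epsilon> where "\<epsilon> = (\<lambda>n. 1 / real (Suc n))"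
  have \<epsilon>: "\<epsilon> n > 0" for n by (auto simp: \<epsilon>_def)
  then have \<epsilon>n0: "\<epsilon> n \<noteq> 0" for n by (simp add: less_imp_neq[symmetric])
  have \<epsilon>0: "\<epsilon> \<longlonglongrightarrow> 0" unfolding \<epsilon>_def by (rule LIMSEQ_Suc[OF lim_1_over_n])
  define m where "m = (\<lambda>n t. (2 + \<mu> * t - sqrt ((\<kappa> * t)\<^sup>2 + (\<epsilon> n)\<^sup>2)) / 2 - \<epsilon> n)"
  define m' where "m' = (\<lambda>n t. (\<mu> - \<kappa> * (\<kappa> * t) / sqrt ((\<kappa> * t)\<^sup>2 + (\<epsilon> n)\<^sup>2)) / 2)"
  define g where "g = (\<lambda>n t. ramp (\<epsilon> n) (m n t))"
  define g' where "g' = (\<lambda>n t. ramp_deriv (\<epsilon> n) (m n t) * m' n t)"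
  define tent where "tent = (\<lambda>t. min (1 + t / L) (1 - t / l))"
  have tent_eq: "tent t = (2 + \<mu> * t - \<bar>\<kappa> * t\<bar>) / 2" for t
  proof -
    have e: "\<kappa> * t = (1 + t / L) - (1 - t / l)" "2 + \<mu> * t = (1 + t / L) + (1 - t / l)"
      by (simp_all add: \<kappa>_def \<mu>_def algebra_simps)
    have "min x y = (x + y - \<bar>x - y\<bar>) / 2" for x y :: real by (auto simp: min_def)
    then show ?thesis unfolding tent_def e .
  qed
  have pos: "(\<kappa> * t)\<^sup>2 + (\<epsilon> n)\<^sup>2 > 0" for n t using \<epsilon>[of n] by (simp add: add_nonneg_pos)
  have sq: "\<bar>\<kappa> * t\<bar> \<le> sqrt ((\<kappa> * t)\<^sup>2 + (\<epsilon> n)\<^sup>2)" for n t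
    using real_sqrt_le_mono[of "(\<kappa> * t)\<^sup>2" "(\<kappa> * t)\<^sup>2 + (\<epsilon> n)\<^sup>2"] by simp
  have m_le: "m n t \<le> tent t - \<epsilon> n" for n t using sq[of t n] by (simp add: m_def tent_eq)
  have dm: "(m n has_real_derivative m' n t) (at t)" for n t
  proof -
    have "((\<lambda>t. (\<kappa> * t)\<^sup>2 + (\<epsilon> n)\<^sup>2) has_real_derivative 2 * (\<kappa> * (\<kappa> * t))) (at t)"
      by (rule derivative_eq_intros refl)+ simp
    from DERIV_chain2[OF DERIV_real_sqrt[OF pos] this]
    have d: "((\<lambda>t. sqrt ((\<kappa> * t)\<^sup>2 + (\<epsilon> n)\<^sup>2)) has_real_derivative \<kappa> * (\<kappa> * t) / sqrt ((\<kappa> * t)\<^sup>2 + (\<epsilon> n)\<^sup>2)) (at t)"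
      by (simp add: field_simps)
    have "((\<lambda>t. (2 + \<mu> * t - r t) / 2 - \<epsilon> n) has_real_derivative (\<mu> - r') / 2) (at t)"
      if "(r has_real_derivative r') (at t)" for r r'
      using that by (auto intro!: derivative_eq_intros)
    from this[OF d] show ?thesis unfolding m_def m'_def .
  qed
  have dg: "(g n has_real_derivative g' n t) (at t)" for n t
    unfolding g_def g'_def by (rule DERIV_chain2[OF ramp_has_derivative[OF \<epsilon>] dm])
  have cm: "continuous_on UNIV (m n)" for n unfolding m_def by (intro continuous_intros) simp
  have cm': "continuous_on UNIV (m' n)" for n unfolding m'_def by (intro continuous_intros) (simp_all add: \<epsilon>n0)
  have cg': "continuous_on UNIV (g' n)" for n
  proof -
    have "max 0 (m n t) + \<epsilon> n > 0" for t using \<epsilon>[of n] by (intro add_nonneg_pos) simp_all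
    then have "max 0 (m n t) + \<epsilon> n \<noteq> 0" for t by (metis less_irrefl)
    then show ?thesis unfolding g'_def ramp_deriv_def by (intro continuous_intros cm cm') auto
  qed
  have cg: "continuous_on UNIV (g n)" for n by (rule DERIV_continuous_on) (rule DERIV_subset[OF dg], simp)
  have C1: "g n C1_differentiable_on UNIV" for n
    unfolding C1_differentiable_on_def
    using dg cg' by (intro exI[of _ "g' n"]) (auto simp: has_real_derivative_iff_has_vector_derivative)
  \<comment> \<open>Where \<open>g n\<close> is nonzero, both linear pieces exceed
    \<open>\<epsilon> n\<close>; this shrinks the interval from - L to l by the factor 1 -
    \<open>\<epsilon> n\<close>.\<close>
  have supp: "closure {t. g n t \<noteq> 0} \<subseteq> {- L * (1 - \<epsilon> n)..l * (1 - \<epsilon> n)}" for n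
  proof (rule closure_minimal)
    show "{t. g n t \<noteq> 0} \<subseteq> {- L * (1 - \<epsilon> n)..l * (1 - \<epsilon> n)}"
    proof
      fix t assume "t \<in> {t. g n t \<noteq> 0}"
      then have "m n t > 0" by (auto simp: g_def ramp_def max_def split: if_splits)
      then have "tent t > \<epsilon> n" using m_le[of n t] by linarith
      then have "1 + t / L > \<epsilon> n" "1 - t / l > \<epsilon> n" by (auto simp: tent_def)
      then show "t \<in> {- L * (1 - \<epsilon> n)..l * (1 - \<epsilon> n)}" using L l by (auto simp: field_simps)
    qed
  qed simp
  have "compact (closure {t. g n t \<noteq> 0})" for n
    using supp[of n] by (meson bounded_closed_interval bounded_subset closed_closure compact_eq_bounded_closed)
  moreover have "closure {t. g n t \<noteq> 0} \<subseteq> {- l0<..<l}" for n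
  proof -
    have "L * \<epsilon> n > 0" "l * \<epsilon> n > 0" using L l \<epsilon>[of n] by simp_all
    then have "- l0 < - L * (1 - \<epsilon> n)" "l * (1 - \<epsilon> n) < l"
      using L by (simp_all add: algebra_simps)
    then have "{- L * (1 - \<epsilon> n)..l * (1 - \<epsilon> n)} \<subseteq> {- l0<..<l}" by auto
    then show ?thesis using supp[of n] by blast
  qed
  ultimately have "integral {- l0..l} (\<lambda>t. (g n t)\<^sup>2 * \<rho> t) \<ge> - Q * integral {- l0..l} (\<lambda>t. (deriv (g n) t)\<^sup>2)" for n
    using ineq[OF C1] by blast
  moreover have "deriv (g n) = g' n" for n using DERIV_imp_deriv[OF dg] by blast
  ultimately have key: "- Q * integral {- l0..l} (\<lambda>t. (g' n t)\<^sup>2) \<le> integral {- l0..l} (\<lambda>t. (g n t)\<^sup>2 * \<rho> t)" for n by simp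
  have m_lim: "(\<lambda>n. m n t) \<longlonglongrightarrow> tent t" for t
  proof -
    have "(\<lambda>n. m n t) \<longlonglongrightarrow> (2 + \<mu> * t - sqrt ((\<kappa> * t)\<^sup>2 + 0\<^sup>2)) / 2 - 0"
      unfolding m_def by (intro tendsto_intros \<epsilon>0) auto
    then show ?thesis by (simp add: tent_eq)
  qed
  have g_lim: "(\<lambda>n. g n t) \<longlonglongrightarrow> max 0 (tent t)" for t
  proof (rule tendsto_sandwich)
    show "\<forall>\<^sub>F n in sequentially. max 0 (m n t) - \<epsilon> n \<le> g n t" "\<forall>\<^sub>F n in sequentially. g n t \<le> max 0 (m n t)"
      unfolding g_def using ramp_bounds(2,3)[OF \<epsilon>] by auto
    have "(\<lambda>n. max 0 (m n t) - \<epsilon> n) \<longlonglongrightarrow> max 0 (tent t) - 0" by (intro tendsto_intros m_lim \<epsilon>0)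
    then show "(\<lambda>n. max 0 (m n t) - \<epsilon> n) \<longlonglongrightarrow> max 0 (tent t)" by simp
    show "(\<lambda>n. max 0 (m n t)) \<longlonglongrightarrow> max 0 (tent t)" by (intro tendsto_intros m_lim)
  qed
  \<comment> \<open>The pointwise limit of the derivatives. At 0 it is the mean of the two slopes,
    and 0 at the feet of the tent; such single points do not affect the integrals.\<close>
  define s where "s = (\<lambda>t. if 0 < tent t then (\<mu> - \<kappa> * sgn t) / 2 else 0)"
  have m'_lim: "(\<lambda>n. m' n t) \<longlonglongrightarrow> (\<mu> - \<kappa> * sgn t) / 2" for t
  proof (cases "t = 0")
    case True then show ?thesis by (simp add: m'_def)
  next
    case False
    then have "sqrt ((\<kappa> * t)\<^sup>2 + 0\<^sup>2) \<noteq> 0" using \<kappa> by simp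
    then have "(\<lambda>n. m' n t) \<longlonglongrightarrow> (\<mu> - \<kappa> * (\<kappa> * t) / sqrt ((\<kappa> * t)\<^sup>2 + 0\<^sup>2)) / 2"
      unfolding m'_def by (intro tendsto_intros \<epsilon>0) auto
    also have "(\<mu> - \<kappa> * (\<kappa> * t) / sqrt ((\<kappa> * t)\<^sup>2 + 0\<^sup>2)) / 2 = (\<mu> - \<kappa> * sgn t) / 2"
      using False \<kappa>(1) by (simp add: abs_mult sgn_real_def)
    finally show ?thesis .
  qed
  have g'_lim: "(\<lambda>n. g' n t) \<longlonglongrightarrow> s t" for t
  proof (cases "0 < tent t")
    case True
    have "(\<lambda>n. ramp_deriv (\<epsilon> n) (m n t)) \<longlonglongrightarrow> 1 - (0 / (max 0 (tent t) + 0))\<^sup>2"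
      unfolding ramp_deriv_def using True by (intro tendsto_intros m_lim \<epsilon>0) auto
    from tendsto_mult[OF this m'_lim[of t]] show ?thesis using True by (simp add: g'_def s_def)
  next
    case False
    \<comment> \<open>Outside the tent the ramp is evaluated at a nonpositive number for every n, so
      the derivative is exactly 0 and no limit is involved.\<close>
    have "g' n t = 0" for n
    proof -
      have "m n t \<le> 0" using m_le[of n t] False \<epsilon>[of n] by linarith
      then show ?thesis using \<epsilon>[of n] by (simp add: g'_def ramp_deriv_def)
    qed
    then show ?thesis using False by (simp add: s_def)
  qed
  let ?I = "{- l0..l}"
  \<comment> \<open>Bounds uniform in n, which serve as majorants for dominated convergence.\<close>
  have m'_bound: "\<bar>m' n t\<bar> \<le> \<kappa>" for n t
  proof -
    have "\<bar>\<kappa> * t / sqrt ((\<kappa> * t)\<^sup>2 + (\<epsilon> n)\<^sup>2)\<bar> \<le> 1"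
      using sq[of t n] real_sqrt_gt_zero[OF pos[of t n]] by (simp add: divide_le_eq)
    then have "\<bar>\<kappa> * (\<kappa> * t / sqrt ((\<kappa> * t)\<^sup>2 + (\<epsilon> n)\<^sup>2))\<bar> \<le> \<kappa> * 1"
      unfolding abs_mult using \<kappa>(1) by (intro mult_mono) auto
    then have "\<bar>\<mu> - \<kappa> * (\<kappa> * t) / sqrt ((\<kappa> * t)\<^sup>2 + (\<epsilon> n)\<^sup>2)\<bar> \<le> \<kappa> + \<kappa>"
      using \<kappa>(2) abs_triangle_ineq4[of \<mu> "\<kappa> * (\<kappa> * t) / sqrt ((\<kappa> * t)\<^sup>2 + (\<epsilon> n)\<^sup>2)"] by simp
    then show ?thesis by (simp add: m'_def abs_divide)
  qed
  have g'_bound: "\<bar>g' n t\<bar> \<le> \<kappa>" for n t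
    unfolding g'_def abs_mult
    using mult_mono[OF ramp_bounds(4)[OF \<epsilon>[of n], of "m n t"] m'_bound[of n t]] by simp
  have g_bound: "\<bar>g n t\<bar> \<le> 1" if "t \<in> ?I" for n t
  proof -
    have "tent t \<le> 1"
    proof (cases "t \<ge> 0")
      case True then have "1 - t / l \<le> 1" using l by simp then show ?thesis unfolding tent_def by linarith
    next
      case False then have "1 + t / L \<le> 1" using L by (simp add: divide_nonpos_pos) then show ?thesis unfolding tent_def by linarith
    qed
    then have "max 0 (m n t) \<le> 1" using m_le[of n t] \<epsilon>[of n] by simp
    then show ?thesis using ramp_bounds(1,2)[OF \<epsilon>[of n], of "m n t"] by (simp add: g_def)
  qed
  have "bounded (\<rho> ` ?I)" by (intro compact_imp_bounded compact_continuous_image \<rho> compact_Icc)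
  then obtain R where "\<forall>x\<in>\<rho> ` ?I. norm x \<le> R" unfolding bounded_iff by blast
  then have R: "\<bar>\<rho> t\<bar> \<le> R" if "t \<in> ?I" for t using that by simp
  have sub: "continuous_on ?I (g n)" "continuous_on ?I (g' n)" for n
    using cg cg' continuous_on_subset by blast+
  have "(\<lambda>t. (g' n t)\<^sup>2) integrable_on ?I" for n
    by (intro integrable_continuous_real continuous_intros sub)
  moreover have "norm ((g' n t)\<^sup>2) \<le> \<kappa>\<^sup>2" for n t
    using power_mono[OF g'_bound[of n t], of 2] by simp
  moreover have "(\<lambda>n. (g' n t)\<^sup>2) \<longlonglongrightarrow> (s t)\<^sup>2" for t by (intro tendsto_intros g'_lim)
  ultimately have lim1: "(\<lambda>t. (s t)\<^sup>2) integrable_on ?I"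
      "(\<lambda>n. integral ?I (\<lambda>t. (g' n t)\<^sup>2)) \<longlonglongrightarrow> integral ?I (\<lambda>t. (s t)\<^sup>2)"
    using dominated_convergence[of "\<lambda>n t. (g' n t)\<^sup>2" ?I "\<lambda>_. \<kappa>\<^sup>2" "\<lambda>t. (s t)\<^sup>2"] integrable_const_ivl by blast+
  have "(\<lambda>t. (g n t)\<^sup>2 * \<rho> t) integrable_on ?I" for n
    by (intro integrable_continuous_real continuous_intros sub \<rho>)
  moreover have "norm ((g n t)\<^sup>2 * \<rho> t) \<le> R" if t: "t \<in> ?I" for n t
  proof -
    have "(g n t)\<^sup>2 \<le> 1" using power_mono[OF g_bound[OF t, of n], of 2] by simp
    then have "(g n t)\<^sup>2 * \<bar>\<rho> t\<bar> \<le> 1 * R" using R[OF t] by (intro mult_mono) auto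
    then show ?thesis by (simp add: abs_mult)
  qed
  moreover have "(\<lambda>n. (g n t)\<^sup>2 * \<rho> t) \<longlonglongrightarrow> (max 0 (tent t))\<^sup>2 * \<rho> t" for t by (intro tendsto_intros g_lim)
  ultimately have lim2: "(\<lambda>n. integral ?I (\<lambda>t. (g n t)\<^sup>2 * \<rho> t)) \<longlonglongrightarrow> integral ?I (\<lambda>t. (max 0 (tent t))\<^sup>2 * \<rho> t)"
    using dominated_convergence(2)[of "\<lambda>n t. (g n t)\<^sup>2 * \<rho> t" ?I "\<lambda>_. R" "\<lambda>t. (max 0 (tent t))\<^sup>2 * \<rho> t"] integrable_const_ivl by blast
  have main: "- Q * integral ?I (\<lambda>t. (s t)\<^sup>2) \<le> integral ?I (\<lambda>t. (max 0 (tent t))\<^sup>2 * \<rho> t)"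
    by (rule LIMSEQ_le[OF tendsto_mult[OF tendsto_const lim1(2)] lim2]) (use key in auto)
  have tent_neg: "tent t = 1 + t / L" if "t \<le> 0" for t
  proof -
    have "t / L \<le> 0" "t / l \<le> 0" using that L l by (simp_all add: divide_nonpos_pos)
    then show ?thesis unfolding tent_def by linarith
  qed
  have tent_pos: "tent t = 1 - t / l" if "t \<ge> 0" for t
  proof -
    have "0 \<le> t / L" "0 \<le> t / l" using that L l by auto
    then show ?thesis unfolding tent_def by linarith
  qed
  have ct: "continuous_on UNIV tent" unfolding tent_def by (intro continuous_intros) (use L l in auto)
  have c1: "continuous_on ?I (\<lambda>t. (max 0 (tent t))\<^sup>2 * \<rho> t)"
    by (intro continuous_intros \<rho> continuous_on_subset[OF ct]) auto
  have i1: "(\<lambda>t. (max 0 (tent t))\<^sup>2 * \<rho> t) integrable_on ?I" by (rule integrable_continuous_real[OF c1])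
  have split: "integral ?I F = integral {- l0..- L} F + integral {- L..0} F + integral {0..l} F"
    if "F integrable_on ?I" for F :: "real \<Rightarrow> real"
  proof -
    have "integral {- l0..0} F + integral {0..l} F = integral ?I F"
      by (rule Henstock_Kurzweil_Integration.integral_combine[OF _ _ that]) (use L l in auto)
    moreover have "integral {- l0..- L} F + integral {- L..0} F = integral {- l0..0} F"
      by (rule Henstock_Kurzweil_Integration.integral_combine[OF _ _ integrable_subinterval_real[OF that]]) (use L l in auto)
    ultimately show ?thesis by simp
  qed
  have z: "tent t \<le> 0" if "t \<in> {- l0..- L}" for t
    using that L by (subst tent_neg) (auto simp: field_simps)
  have A: "integral ?I (\<lambda>t. (max 0 (tent t))\<^sup>2 * \<rho> t)
      = integral {- L..0} (\<lambda>t. (1 + t / L)\<^sup>2 * \<rho> t) + integral {0..l} (\<lambda>t. (1 - t / l)\<^sup>2 * \<rho> t)"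
  proof -
    have "integral {- l0..- L} (\<lambda>t. (max 0 (tent t))\<^sup>2 * \<rho> t) = integral {- l0..- L} (\<lambda>t. 0)"
      by (rule integral_cong) (simp add: max_absorb1[OF z])
    moreover have "integral {- L..0} (\<lambda>t. (max 0 (tent t))\<^sup>2 * \<rho> t) = integral {- L..0} (\<lambda>t. (1 + t / L)\<^sup>2 * \<rho> t)"
    proof (rule integral_cong)
      fix t assume t: "t \<in> {- L..0}"
      then have "0 \<le> 1 + t / L" using L by (simp add: field_simps)
      then show "(max 0 (tent t))\<^sup>2 * \<rho> t = (1 + t / L)\<^sup>2 * \<rho> t" using t by (simp add: tent_neg)
    qed
    moreover have "integral {0..l} (\<lambda>t. (max 0 (tent t))\<^sup>2 * \<rho> t) = integral {0..l} (\<lambda>t. (1 - t / l)\<^sup>2 * \<rho> t)"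
    proof (rule integral_cong)
      fix t assume t: "t \<in> {0..l}"
      then have "0 \<le> 1 - t / l" using l by simp
      then show "(max 0 (tent t))\<^sup>2 * \<rho> t = (1 - t / l)\<^sup>2 * \<rho> t" using t by (simp add: tent_pos)
    qed
    ultimately show ?thesis unfolding split[OF i1] by simp
  qed
  \<comment> \<open>The energy of the tent: squared slope times length, that is L / L^2 on the left
    and l / l^2 on the right. The spikes remove the points where \<open>s\<close> may differ from
    the slope.\<close>
  have B: "integral ?I (\<lambda>t. (s t)\<^sup>2) = 1 / L + 1 / l"
  proof -
    have "integral {- l0..- L} (\<lambda>t. (s t)\<^sup>2) = integral {- l0..- L} (\<lambda>t. 0)"
      by (rule integral_cong) (simp add: s_def z[THEN leD])
    moreover have "integral {- L..0} (\<lambda>t. (s t)\<^sup>2) = integral {- L..0} (\<lambda>t. 1 / L\<^sup>2)"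
    proof (rule integral_spike[of "{- L, 0}"])
      fix t assume t: "t \<in> {- L..0} - {- L, 0}"
      then have "0 < 1 + t / L" using L by (simp add: field_simps)
      then have "0 < tent t" using t by (simp add: tent_neg)
      then have "s t = 1 / L" using t by (simp add: s_def \<kappa>_def \<mu>_def)
      then show "1 / L\<^sup>2 = (s t)\<^sup>2" by (simp add: power_divide)
    qed simp
    moreover have "integral {0..l} (\<lambda>t. (s t)\<^sup>2) = integral {0..l} (\<lambda>t. 1 / l\<^sup>2)"
    proof (rule integral_spike[of "{0, l}"])
      fix t assume t: "t \<in> {0..l} - {0, l}"
      then have "0 < 1 - t / l" using l by simp
      then have "0 < tent t" using t by (simp add: tent_pos)
      then have "s t = - 1 / l" using t by (simp add: s_def \<kappa>_def \<mu>_def)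
      then show "1 / l\<^sup>2 = (s t)\<^sup>2" by (simp add: power_divide)
    qed simp
    ultimately show ?thesis unfolding split[OF lim1(1)] using L l by (simp add: power2_eq_square)
  qed
  show ?thesis using main unfolding A B .
qed

text \<open>The integral of (1 + t / L)^2 over the left half is L / 3, which is the origin of the
  factor 1/3 in \<open>Lhat2\<close>. The weight is nonnegative, so the sign of \<open>R\<close> is
  arbitrary.\<close>

lemma integral_tent_left_le:
  fixes \<rho> :: "real \<Rightarrow> real"
  assumes L: "0 < L" and \<rho>: "continuous_on {- L..0} \<rho>" and le: "\<And>t. t \<in> {- L..0} \<Longrightarrow> \<rho> t \<le> R"
  shows "integral {- L..0} (\<lambda>t. (1 + t / L)\<^sup>2 * \<rho> t) \<le> R * L / 3"
proof -
  have "((\<lambda>t. (1 + t / L)\<^sup>2 * R) has_integral ((\<lambda>t. R * L / 3 * (1 + t / L) ^ 3) 0 - (\<lambda>t. R * L / 3 * (1 + t / L) ^ 3) (- L))) {- L..0}"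
  proof (rule fundamental_theorem_of_calculus)
    fix t
    have d: "((\<lambda>t. 1 + t / L) has_real_derivative 1 / L) (at t within {- L..0})"
      by (rule derivative_eq_intros refl)+ (use L in simp_all)
    show "((\<lambda>t. R * L / 3 * (1 + t / L) ^ 3) has_vector_derivative (1 + t / L)\<^sup>2 * R) (at t within {- L..0})"
      unfolding has_real_derivative_iff_has_vector_derivative[symmetric]
      by (rule derivative_eq_intros d refl)+ (use L in simp)
  qed (use L in simp)
  then have i: "((\<lambda>t. (1 + t / L)\<^sup>2 * R) has_integral R * L / 3) {- L..0}" using L by simp
  have "(\<lambda>t. (1 + t / L)\<^sup>2 * \<rho> t) integrable_on {- L..0}"
    by (intro integrable_continuous_real continuous_intros \<rho>) (use L in auto)
  show ?thesis
    by (rule has_integral_le[OF integrable_integral[OF \<open>_ integrable_on _\<close>] i]) (intro mult_left_mono le zero_le_power2)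
qed

section \<open>Null geodesics normal to a spacelike surface\<close>

context local_metric
begin

text \<open>The products recover the coefficients of a combination of the four vectors, so these are
  a basis by dimension. The trace formula is then invariance of the trace under conjugation.\<close>

lemma null_frame:
  assumes q: "q \<in> U"
    and gram: "g q e1 e1 = - 1" "g q e2 e2 = - 1" "g q e1 e2 = 0" "g q e1 k = 0" "g q e2 k = 0" "g q k k = 0"
      "g q n k = 1" "g q n n = 0" "g q n e1 = 0" "g q n e2 = 0"
  shows "x = (- g q x e1) *\<^sub>R e1 + (- g q x e2) *\<^sub>R e2 + g q x n *\<^sub>R k + g q x k *\<^sub>R n"
    "linear L \<Longrightarrow> trace (matrix L) = - g q (L e1) e1 - g q (L e2) e2 + g q (L k) n + g q (L n) k"
proof -
  define \<Phi> where "\<Phi> = (\<lambda>a :: real^4. (a $ 1) *\<^sub>R e1 + (a $ 2) *\<^sub>R e2 + (a $ 3) *\<^sub>R k + (a $ 4) *\<^sub>R n)"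
  \<comment> \<open>The dual coordinates. Since \<open>k\<close> and \<open>n\<close> are null with
    product 1, the coefficient of each is read off by pairing with the other.\<close>
  define \<Psi> where "\<Psi> = (\<lambda>x. \<chi> i :: 4. if i = 1 then - g q x e1 else if i = 2 then - g q x e2 else if i = 3 then g q x n else g q x k)"
  have gram': "g q e2 e1 = 0" "g q k e1 = 0" "g q k e2 = 0" "g q k n = 1" "g q e1 n = 0" "g q e2 n = 0"
    using gram sym[OF q] by metis+
  note lin = lin_simps[OF q]
  have l\<Phi>: "linear \<Phi>" unfolding \<Phi>_def by (rule linearI) (simp_all add: algebra_simps)
  have l\<Psi>: "linear \<Psi>" unfolding \<Psi>_def by (rule linearI) (auto simp: vec_eq_iff lin)
  have \<Psi>\<Phi>: "\<Psi> (\<Phi> a) = a" for a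
    unfolding \<Psi>_def \<Phi>_def by (simp add: vec_eq_iff forall_4 lin gram gram')
  then have "inj \<Phi>" by (metis injI)
  then have "surj \<Phi>" using linear_injective_imp_surjective[OF l\<Phi>] by simp
  then have \<Phi>\<Psi>: "\<Phi> (\<Psi> x) = x" for x using \<Psi>\<Phi> by (metis surjD)
  then show "x = (- g q x e1) *\<^sub>R e1 + (- g q x e2) *\<^sub>R e2 + g q x n *\<^sub>R k + g q x k *\<^sub>R n"
    using \<Phi>\<Psi>[of x, symmetric] by (simp add: \<Phi>_def \<Psi>_def)
  assume L: "linear L"
  have ax: "\<Phi> (axis 1 1) = e1" "\<Phi> (axis 2 1) = e2" "\<Phi> (axis 3 1) = k" "\<Phi> (axis 4 1) = n"
    by (simp_all add: \<Phi>_def axis_def)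
  have id: "matrix \<Phi> ** matrix \<Psi> = mat 1"
    using matrix_compose[OF l\<Psi> l\<Phi>] \<Phi>\<Psi> by (simp add: o_def matrix_id_mat_1[unfolded id_def])
  have "trace (matrix L) = trace ((matrix L ** matrix \<Phi>) ** matrix \<Psi>)"
    using id by (simp add: matrix_mul_assoc[symmetric])
  also have "\<dots> = trace (matrix \<Psi> ** (matrix L ** matrix \<Phi>))" by (rule trace_mul_sym)
  also have "matrix \<Psi> ** (matrix L ** matrix \<Phi>) = matrix (\<Psi> \<circ> (L \<circ> \<Phi>))"
    by (simp add: matrix_compose[OF l\<Phi> L] matrix_compose[OF linear_compose[OF l\<Phi> L] l\<Psi>])
  also have "trace \<dots> = - g q (L e1) e1 - g q (L e2) e2 + g q (L k) n + g q (L n) k"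
    by (simp add: trace_def matrix_def sum_4 ax) (simp add: \<Psi>_def)
  finally show "trace (matrix L) = - g q (L e1) e1 - g q (L e2) e2 + g q (L k) n + g q (L n) k" .
qed

text \<open>Pair symmetry moves \<open>x\<close> behind, skewness in the last pair and antisymmetry
  in the first restore the original shape with \<open>x\<close> and \<open>y\<close>
  exchanged.\<close>

lemma riem_jacobi_sym: "q \<in> U \<Longrightarrow> g q (riem q x k k) y = g q (riem q y k k) x"
  using riem_pair_sym[of q x k k y] riem_skew[of q k y x k] riem_antisym[of q k y k]
  by (simp add: lin_simps)

lemma riem_same: "riem q x x y = 0"
  by (simp add: riemann_of_def)

end

context lorentz_manifold
begin

definition null_frame :: "'a \<Rightarrow> 'a tvec \<Rightarrow> 'a tvec \<Rightarrow> 'a tvec \<Rightarrow> 'a tvec \<Rightarrow> bool" where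
  "null_frame p e1 e2 k n \<longleftrightarrow>
     e1 \<in> tangent_space M p \<and> e2 \<in> tangent_space M p \<and> k \<in> tangent_space M p \<and> n \<in> tangent_space M p \<and>
     metric M p e1 e1 = - 1 \<and> metric M p e2 e2 = - 1 \<and> metric M p e1 e2 = 0 \<and>
     metric M p e1 k = 0 \<and> metric M p e2 k = 0 \<and> metric M p k k = 0 \<and>
     metric M p n k = 1 \<and> metric M p n n = 0 \<and> metric M p n e1 = 0 \<and> metric M p n e2 = 0"

lemma null_frame_expansion:
  assumes f: "null_frame p e1 e2 k n" and v: "v \<in> tangent_space M p"
  shows "v c = (- metric M p v e1) *\<^sub>R e1 c + (- metric M p v e2) *\<^sub>R e2 c + metric M p v n *\<^sub>R k c + metric M p v k *\<^sub>R n c"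
proof (cases "c \<in> charts_at M p")
  case True
  then have c: "c \<in> atlas M" "chart_map c p \<in> img c" by (auto simp: charts_at_iff)
  interpret local_metric "img c" "metric_coord M c" by (rule local_metric_chart[OF c(1)])
  have T: "e1 \<in> tangent_space M p" "e2 \<in> tangent_space M p" "k \<in> tangent_space M p" "n \<in> tangent_space M p"
    using f by (auto simp: null_frame_def)
  note gc = metric_eq_coord[OF _ _ True]
  have G: "metric_coord M c (chart_map c p) (u c) (w c) = metric M p u w"
    if "u \<in> tangent_space M p" "w \<in> tangent_space M p" for u w using gc[OF that] by simp
  show ?thesis
    using null_frame(1)[OF c(2), of "e1 c" "e2 c" "k c" "n c" "v c"] f
    unfolding G[OF T(1) T(1)] G[OF T(2) T(2)] G[OF T(1) T(2)] G[OF T(1) T(3)] G[OF T(2) T(3)] G[OF T(3) T(3)]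
      G[OF T(4) T(3)] G[OF T(4) T(4)] G[OF T(4) T(1)] G[OF T(4) T(2)] G[OF v T(1)] G[OF v T(2)] G[OF v T(3)] G[OF v T(4)]
      null_frame_def by blast
next
  case False
  have T: "e1 \<in> tangent_space M p" "e2 \<in> tangent_space M p" "k \<in> tangent_space M p" "n \<in> tangent_space M p"
    using f by (auto simp: null_frame_def)
  show ?thesis
    using T[THEN tangent_outside, OF False] tangent_outside[OF v False] by simp
qed

text \<open>Symmetry makes the Jacobi system self-adjoint. The other two identities keep the
  component along the null partner of \<open>k\<close> free of forcing and remove any influence of
  the component along \<open>k\<close>, which reduces the system to two dimensions.\<close>

lemma jacobi_operator:
  assumes "x \<in> tangent_space M p" "y \<in> tangent_space M p" "k \<in> tangent_space M p"
  shows "metric M p (riemann M p x k k) y = metric M p (riemann M p y k k) x"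
    "metric M p (riemann M p x k k) k = 0" "riemann M p k k k = zero_tvec"
proof -
  obtain c where cp: "c \<in> charts_at M p" using charts_at_nonempty .
  then have c: "c \<in> atlas M" "chart_map c p \<in> img c" by (auto simp: charts_at_iff)
  interpret local_metric "img c" "metric_coord M c" by (rule local_metric_chart[OF c(1)])
  note R = riemann_tangent[OF assms(1,3,3)] riemann_tangent[OF assms(2,3,3)] riemann_tangent[OF assms(3,3,3)]
  have rc: "riemann M p u k k c = riem (chart_map c p) (u c) (k c) (k c)" for u
    using cp by (simp add: riemann_def riemann_coord_eq)
  show "metric M p (riemann M p x k k) y = metric M p (riemann M p y k k) x"
    unfolding metric_eq_coord[OF R(1) assms(2) cp] metric_eq_coord[OF R(2) assms(1) cp] rc by (rule riem_jacobi_sym[OF c(2)])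
  show "metric M p (riemann M p x k k) k = 0"
    unfolding metric_eq_coord[OF R(1) assms(3) cp] rc by (rule riem_skew_diag[OF c(2)])
  show "riemann M p k k k = zero_tvec"
    by (rule tangent_eqI[OF R(3) zero_tangent cp]) (simp add: rc riem_same zero_tvec_def)
qed

text \<open>In the trace over a null frame the term of \<open>k\<close> contains R(k,k)k and the
  term of \<open>n\<close> the product g(R(n,k)k, k); both vanish, and only the two spacelike
  directions remain.\<close>

lemma ricci_null_frame:
  assumes f: "null_frame p e1 e2 k n"
  shows "ricci M p k k = - metric M p (riemann M p e1 k k) e1 - metric M p (riemann M p e2 k k) e2"
proof -
  have T: "e1 \<in> tangent_space M p" "e2 \<in> tangent_space M p" "k \<in> tangent_space M p" "n \<in> tangent_space M p"
    using f by (auto simp: null_frame_def)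
  obtain c where cp: "c \<in> charts_at M p"
    and ric: "ricci M p k k = trace (matrix (\<lambda>x. riemann_coord M c (chart_map c p) x (k c) (k c)))"
    using ricci_eq_trace[OF T(3,3)] .
  then have c: "c \<in> atlas M" "chart_map c p \<in> img c" by (auto simp: charts_at_iff)
  interpret local_metric "img c" "metric_coord M c" by (rule local_metric_chart[OF c(1)])
  have G: "metric_coord M c (chart_map c p) (u c) (w c) = metric M p u w"
    if "u \<in> tangent_space M p" "w \<in> tangent_space M p" for u w using metric_eq_coord[OF that cp] by simp
  have rc: "riem (chart_map c p) (u c) (k c) (k c) = riemann M p u k k c" for u
    using cp by (simp add: riemann_def riemann_coord_eq)
  note R = riemann_tangent[OF _ T(3,3)]
  have "ricci M p k k = - metric_coord M c (chart_map c p) (riem (chart_map c p) (e1 c) (k c) (k c)) (e1 c)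
      - metric_coord M c (chart_map c p) (riem (chart_map c p) (e2 c) (k c) (k c)) (e2 c)
      + metric_coord M c (chart_map c p) (riem (chart_map c p) (k c) (k c) (k c)) (n c)
      + metric_coord M c (chart_map c p) (riem (chart_map c p) (n c) (k c) (k c)) (k c)"
    unfolding ric riemann_coord_eq
    by (rule null_frame(2)[OF c(2) _ _ _ _ _ _ _ _ _ _ linear_riem(1)[OF c(2)]]) (use f G T in \<open>simp_all add: null_frame_def\<close>)
  also have "\<dots> = - metric M p (riemann M p e1 k k) e1 - metric M p (riemann M p e2 k k) e2
      + metric M p (riemann M p k k k) n + metric M p (riemann M p n k k) k"
    unfolding rc G[OF R[OF T(1)] T(1)] G[OF R[OF T(2)] T(2)] G[OF R[OF T(3)] T(4)] G[OF R[OF T(4)] T(3)] ..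
  also have "metric M p (riemann M p k k k) n = 0"
    using metric_sym[OF zero_tangent T(4)] metric_lin(2)[OF zero_tangent zero_tangent T(4), of 0 0]
    unfolding jacobi_operator(3)[OF T(3,3,3)] by (simp add: zero_tvec_def)
  also have "metric M p (riemann M p n k k) k = 0" by (rule jacobi_operator(2)[OF T(4,3,3)])
  finally show ?thesis by simp
qed

end

context spacelike_surface
begin

text \<open>Nondegeneracy gives a vector not orthogonal to \<open>k\<close>. Its normal part has the
  same product with \<open>k\<close>, and a multiple of \<open>k\<close> can be added to make it
  null.\<close>

lemma null_frame_exists:
  assumes e: "orthonormal_basis M P p e1 e2" and k: "k \<in> NP" "g k k = 0" "k \<noteq> zero_tvec"
  obtains n where "null_frame p e1 e2 k n"
proof -
  have eT: "e1 \<in> TP" "e2 \<in> TP" using e by (auto simp: orthonormal_basis_def)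
  obtain u where u: "u \<in> TM" "g k u \<noteq> 0" using metric_nondegenerate[OF NP_sub[OF k(1)]] k(3) by blast
  define m where "m = normal_part M P p u"
  have m: "m \<in> NP" unfolding m_def by (rule normal_part(1)[OF u(1)])
  have mk: "g m k \<noteq> 0"
    unfolding m_def normal_part(2)[OF u(1) k(1)] using u metric_sym[OF u(1) NP_sub[OF k(1)]] by simp
  \<comment> \<open>The factor \<open>x\<close> normalizes the product with \<open>k\<close> to 1;
    then g(n,n) = x^2 g(m,m) + 2 y, which determines \<open>y\<close> on the next line.\<close>
  define x where "x = 1 / g m k"
  define y where "y = - (x * x * g m m) / 2"
  define n where "n = (\<lambda>c. x *\<^sub>R m c + y *\<^sub>R k c)"
  have nT: "n \<in> TM" unfolding n_def by (rule tangent_lin[OF NP_sub[OF m] NP_sub[OF k(1)]])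
  have gn: "g n w = x * g m w + y * g k w" if "w \<in> TM" for w
    unfolding n_def by (rule metric_lin(1)[OF NP_sub[OF m] NP_sub[OF k(1)] that])
  have nk: "g n k = 1" using gn[OF NP_sub[OF k(1)]] k(2) mk by (simp add: x_def)
  have nm: "g n m = x * g m m + y * g m k"
    using gn[OF NP_sub[OF m]] metric_sym[OF NP_sub[OF m] NP_sub[OF k(1)]] by simp
  have "g n n = x * g n m + y * g n k"
    using gn[OF nT] metric_sym[OF nT NP_sub[OF m]] metric_sym[OF nT NP_sub[OF k(1)]] by simp
  also have "\<dots> = x * x * g m m + y * (x * g m k) + y" by (simp add: nm nk algebra_simps)
  also have "x * g m k = 1" using mk by (simp add: x_def)
  finally have nn: "g n n = 0" by (simp add: y_def)
  have ne: "g n w = 0" if "w \<in> TP" for w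
    using gn[OF TP_sub[OF that]] NP_orth[OF m that] NP_orth[OF k(1) that] by simp
  have ke: "g w k = 0" if "w \<in> TP" for w
    using NP_orth[OF k(1) that] metric_sym[OF TP_sub[OF that] NP_sub[OF k(1)]] by simp
  have "null_frame p e1 e2 k n"
    unfolding null_frame_def
    using e k(2) NP_sub[OF k(1)] TP_sub[OF eT(1)] TP_sub[OF eT(2)] nT nk nn ne[OF eT(1)] ne[OF eT(2)] ke[OF eT(1)] ke[OF eT(2)]
    by (simp add: orthonormal_basis_def)
  then show thesis by (rule that)
qed

end

text \<open>Supplies the coefficients of a combination of two solutions that vanishes where their
  determinant does.\<close>

lemma kernel_of_singular_2x2:
  fixes a b c d :: real
  assumes "a * d - b * c = 0"
  obtains x y where "x \<noteq> 0 \<or> y \<noteq> 0" "x * a + y * c = 0" "x * b + y * d = 0"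
proof -
  consider "c \<noteq> 0 \<or> a \<noteq> 0" | "c = 0" "a = 0" "d \<noteq> 0 \<or> b \<noteq> 0" | "a = 0" "b = 0" "c = 0" "d = 0" by blast
  then show thesis
  proof cases
    case 1
    then show ?thesis using assms by (intro that[of c "- a"]) (auto simp: algebra_simps)
  next
    case 2
    then show ?thesis by (intro that[of d "- b"]) (auto simp: algebra_simps)
  next
    case 3
    then show ?thesis by (intro that[of 1 0]) auto
  qed
qed

lemma jacobi_system_solution:
  fixes s11 s12 s22 :: "real \<Rightarrow> real"
  assumes c: "continuous_on {a..b} s11" "continuous_on {a..b} s12" "continuous_on {a..b} s22" and t0: "t0 \<in> {a..b}"
  obtains y1 y2 z1 z2 where "y1 t0 = \<alpha>1" "y2 t0 = \<alpha>2" "z1 t0 = \<beta>1" "z2 t0 = \<beta>2"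
    "\<And>t. t \<in> {a..b} \<Longrightarrow> (y1 has_real_derivative z1 t) (at t within {a..b})"
    "\<And>t. t \<in> {a..b} \<Longrightarrow> (y2 has_real_derivative z2 t) (at t within {a..b})"
    "\<And>t. t \<in> {a..b} \<Longrightarrow> (z1 has_real_derivative - (s11 t * y1 t + s12 t * y2 t)) (at t within {a..b})"
    "\<And>t. t \<in> {a..b} \<Longrightarrow> (z2 has_real_derivative - (s12 t * y1 t + s22 t * y2 t)) (at t within {a..b})"
proof -
  define A :: "real \<Rightarrow> (real \<times> real) \<times> (real \<times> real) \<Rightarrow> (real \<times> real) \<times> (real \<times> real)" where
    "A = (\<lambda>t v. (snd v, (- (s11 t * fst (fst v) + s12 t * snd (fst v)), - (s12 t * fst (fst v) + s22 t * snd (fst v)))))"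
  have lin: "linear (A t)" for t
    by (rule linearI) (simp_all add: A_def algebra_simps)
  have cont: "continuous_on {a..b} (\<lambda>t. A t v)" for v
    unfolding A_def by (intro continuous_intros c)
  have "a \<le> b" using t0 by simp
  from linear_ode_solution[OF this lin cont t0] obtain x where
    x: "x t0 = ((\<alpha>1, \<alpha>2), (\<beta>1, \<beta>2))" "\<And>t. t \<in> {a..b} \<Longrightarrow> (x has_vector_derivative A t (x t)) (at t within {a..b})" by metis
  note f = bounded_linear.has_vector_derivative[OF bounded_linear_fst]
    and s = bounded_linear.has_vector_derivative[OF bounded_linear_snd]
  show thesis
  proof (rule that[of "\<lambda>t. fst (fst (x t))" "\<lambda>t. snd (fst (x t))" "\<lambda>t. fst (snd (x t))" "\<lambda>t. snd (snd (x t))"])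
    fix t assume "t \<in> {a..b}"
    note d = x(2)[OF this]
    show "((\<lambda>t. fst (fst (x t))) has_real_derivative fst (snd (x t))) (at t within {a..b})"
      using f[OF f[OF d]] by (simp add: A_def has_real_derivative_iff_has_vector_derivative)
    show "((\<lambda>t. snd (fst (x t))) has_real_derivative snd (snd (x t))) (at t within {a..b})"
      using s[OF f[OF d]] by (simp add: A_def has_real_derivative_iff_has_vector_derivative)
    show "((\<lambda>t. fst (snd (x t))) has_real_derivative - (s11 t * fst (fst (x t)) + s12 t * snd (fst (x t)))) (at t within {a..b})"
      using f[OF s[OF d]] by (simp add: A_def has_real_derivative_iff_has_vector_derivative)
    show "((\<lambda>t. snd (snd (x t))) has_real_derivative - (s12 t * fst (fst (x t)) + s22 t * snd (fst (x t)))) (at t within {a..b})"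
      using s[OF s[OF d]] by (simp add: A_def has_real_derivative_iff_has_vector_derivative)
  qed (simp_all add: x(1))
qed

locale null_normal_geodesic = lorentz_geodesic M \<gamma> "- l0" l + spacelike_surface M P "\<gamma> 0"
  for M :: "'a::topological_space lorentz_structure" and \<gamma> :: "real \<Rightarrow> 'a" and l0 l :: real and P +
  assumes l0: "0 < l0" and l: "0 < l"
    and k0: "velocity M {- l0..l} \<gamma> 0 \<in> sub_normal_space M P (\<gamma> 0)"
    and null: "metric M (\<gamma> 0) (velocity M {- l0..l} \<gamma> 0) (velocity M {- l0..l} \<gamma> 0) = 0"
    and nonzero: "velocity M {- l0..l} \<gamma> 0 \<noteq> zero_tvec"
begin

abbreviation "I \<equiv> {- l0..l}"

lemma zero_in_I: "0 \<in> I" using l0 l by simp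

lemma null_frame_parallel:
  assumes V: "parallel_on I E1" "parallel_on I E2" "parallel_on I N"
    and f: "null_frame (\<gamma> 0) (E1 0) (E2 0) (k 0) (N 0)" and t: "t \<in> I"
  shows "null_frame (\<gamma> t) (E1 t) (E2 t) (k t) (N t)"
proof -
  note c = metric_parallel_const[OF _ _ t zero_in_I]
  note K = parallel_velocity
  show ?thesis
    using f parallel_tangent[OF V(1) t] parallel_tangent[OF V(2) t] parallel_tangent[OF V(3) t] parallel_tangent[OF K t]
    unfolding null_frame_def c[OF V(1) V(1)] c[OF V(2) V(2)] c[OF V(1) V(2)] c[OF V(1) K] c[OF V(2) K] c[OF K K]
      c[OF V(3) K] c[OF V(3) V(3)] c[OF V(3) V(1)] c[OF V(3) V(2)] by blast
qed

text \<open>The plane solution is lifted to a Jacobi field by adding a component along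
  \<open>k\<close>. A field with coefficients z1, z2 has products - z1, - z2 with the frame, so the
  initial condition of a \<open>P\<close>-Jacobi field appears in \<open>z0\<close> without minus
  signs.\<close>

lemma focal_point_of_degenerate_solution:
  assumes V: "parallel_on I E1" "parallel_on I E2" "parallel_on I N"
    and f: "null_frame (\<gamma> 0) (E1 0) (E2 0) (k 0) (N 0)" and on: "orthonormal_basis M P (\<gamma> 0) (E1 0) (E2 0)"
    and s: "\<And>X Y t. s X Y t = - metric M (\<gamma> t) (riemann M (\<gamma> t) (X t) (k t) (k t)) (Y t)"
    and y: "\<And>t. t \<in> I \<Longrightarrow> (y1 has_real_derivative z1 t) (at t within I)"
      "\<And>t. t \<in> I \<Longrightarrow> (y2 has_real_derivative z2 t) (at t within I)"
    and z: "\<And>t. t \<in> I \<Longrightarrow> (z1 has_real_derivative - (s E1 E1 t * y1 t + s E1 E2 t * y2 t)) (at t within I)"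
      "\<And>t. t \<in> I \<Longrightarrow> (z2 has_real_derivative - (s E1 E2 t * y1 t + s E2 E2 t * y2 t)) (at t within I)"
    and z0: "z1 0 = y1 0 * g (II (E1 0) (E1 0)) (k 0) + y2 0 * g (II (E2 0) (E1 0)) (k 0)"
      "z2 0 = y1 0 * g (II (E1 0) (E2 0)) (k 0) + y2 0 * g (II (E2 0) (E2 0)) (k 0)"
    and ne: "y1 0 \<noteq> 0 \<or> y2 0 \<noteq> 0" and t1: "0 < t1" "t1 \<le> l" "y1 t1 = 0" "y2 t1 = 0"
  shows "focal_point M P I \<gamma> t1"
proof -
  have t1I: "t1 \<in> I" using t1 l0 by simp
  note K = parallel_velocity
  note F = null_frame_parallel[OF V f]
  have sc: "continuous_on I (s X Y)" if "parallel_on I X" "parallel_on I Y" for X Y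
  proof -
    have "s X Y = (\<lambda>t. - metric M (\<gamma> t) (riemann M (\<gamma> t) (X t) (k t) (k t)) (Y t))" by (rule ext) (rule s)
    then show ?thesis
      using continuous_on_minus[OF continuous_curvature_component[OF that(1) K K that(2)]] by simp
  qed
  \<comment> \<open>The coefficient of \<open>k\<close> in - R(J,k)k. It involves only
    \<open>y1\<close> and \<open>y2\<close>, so the component along \<open>k\<close> is obtained by
    integrating twice.\<close>
  define h where "h = (\<lambda>t. s E1 N t * y1 t + s E2 N t * y2 t)"
  have yc: "continuous_on I y1" "continuous_on I y2" by (rule DERIV_continuous_on[OF y(1)], assumption) (rule DERIV_continuous_on[OF y(2)])
  have hc: "continuous_on I h" unfolding h_def by (intro continuous_on_add continuous_on_mult sc V yc)
  obtain G where G: "\<And>t. t \<in> I \<Longrightarrow> (G has_vector_derivative h t) (at t within I)"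
    using antiderivative_continuous[OF hc] by metis
  have Gc: "continuous_on I G"
    unfolding continuous_on_eq_continuous_within using G has_vector_derivative_continuous by blast
  obtain F' where F': "\<And>t. t \<in> I \<Longrightarrow> (F' has_vector_derivative G t) (at t within I)"
    using antiderivative_continuous[OF Gc] by metis
  text \<open>The component along \<open>k\<close> has a free initial velocity, which is used to make it vanish at \<open>t1\<close>.\<close>
  define \<kappa> where "\<kappa> = - (F' t1 - F' 0) / t1"
  define y3 where "y3 = (\<lambda>t. F' t - F' 0 + \<kappa> * t)"
  define z3 where "z3 = (\<lambda>t. G t + \<kappa>)"
  have y3: "(y3 has_real_derivative z3 t) (at t within I)" if "t \<in> I" for t
    unfolding y3_def z3_def
    by (rule derivative_eq_intros F'[OF that, folded has_real_derivative_iff_has_vector_derivative] refl)+ simp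
  have z3: "(z3 has_real_derivative h t) (at t within I)" if "t \<in> I" for t
    unfolding z3_def
    by (rule derivative_eq_intros G[OF that, folded has_real_derivative_iff_has_vector_derivative] refl)+ simp
  have y30: "y3 0 = 0" "y3 t1 = 0" using t1(1) by (simp_all add: y3_def \<kappa>_def)
  define A :: "nat set" where "A = {0, 1, 2}"
  define E where "E = (\<lambda>i::nat. if i = 0 then E1 else if i = 1 then E2 else k)"
  define y' where "y' = (\<lambda>i::nat. if i = 0 then y1 else if i = 1 then y2 else y3)"
  define z' where "z' = (\<lambda>i::nat. if i = 0 then z1 else if i = 1 then z2 else z3)"
  define w' where "w' = (\<lambda>(i::nat) t. if i = 0 then - (s E1 E1 t * y1 t + s E1 E2 t * y2 t)
    else if i = 1 then - (s E1 E2 t * y1 t + s E2 E2 t * y2 t) else h t)"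
  define J where "J = (\<lambda>t c. \<Sum>i\<in>A. y' i t *\<^sub>R E i t c)"
  have A: "finite A" by (simp add: A_def)
  have E: "parallel_on I (E i)" for i using V K by (simp add: E_def)
  have ET: "E i t \<in> tangent_space M (\<gamma> t)" if "t \<in> I" for i t by (rule parallel_tangent[OF E that])
  have dy: "(y' i has_vector_derivative z' i t) (at t within I)" if "t \<in> I" for i t
    using y[OF that] y3[OF that] by (simp add: y'_def z'_def has_real_derivative_iff_has_vector_derivative)
  have dz: "(z' i has_vector_derivative w' i t) (at t within I)" if "t \<in> I" for i t
    using z[OF that] z3[OF that] by (simp add: z'_def w'_def has_real_derivative_iff_has_vector_derivative)
  have sum3: "(\<Sum>i\<in>A. f i) = f 0 + f 1 + f 2" for f :: "nat \<Rightarrow> 'b::comm_monoid_add"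
    by (simp add: A_def add.assoc)
  have eq: "(\<Sum>i\<in>A. w' i t *\<^sub>R E i t c) = - riemann M (\<gamma> t) (J t) (k t) (k t) c" if t: "t \<in> I" for t c
  proof -
    have T: "E1 t \<in> tangent_space M (\<gamma> t)" "E2 t \<in> tangent_space M (\<gamma> t)" "k t \<in> tangent_space M (\<gamma> t)" "N t \<in> tangent_space M (\<gamma> t)"
      using F[OF t] by (auto simp: null_frame_def)
    have JT: "J t \<in> tangent_space M (\<gamma> t)" unfolding J_def by (rule tangent_sum[OF A ET[OF t]])
    let ?R = "\<lambda>x. riemann M (\<gamma> t) x (k t) (k t)"
    note RT = riemann_tangent[OF _ T(3) T(3)]
    have RJ: "metric M (\<gamma> t) (?R (J t)) x = y1 t * metric M (\<gamma> t) (?R (E1 t)) x + y2 t * metric M (\<gamma> t) (?R (E2 t)) x"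
      if x: "x \<in> tangent_space M (\<gamma> t)" for x
    proof -
      have "metric M (\<gamma> t) (?R (J t)) x = metric M (\<gamma> t) (?R x) (J t)" by (rule jacobi_operator(1)[OF JT x T(3)])
      also have "\<dots> = metric M (\<gamma> t) (J t) (?R x)" by (rule metric_sym[OF RT[OF x] JT])
      also have "\<dots> = (\<Sum>i\<in>A. y' i t * metric M (\<gamma> t) (E i t) (?R x))"
        unfolding J_def by (rule metric_sum_left[OF A ET[OF t] RT[OF x]])
      also have "\<dots> = (\<Sum>i\<in>A. y' i t * metric M (\<gamma> t) (?R (E i t)) x)"
        by (simp only: metric_sym[OF ET[OF t] RT[OF x]] jacobi_operator(1)[OF x ET[OF t] T(3)])
      also have "\<dots> = y1 t * metric M (\<gamma> t) (?R (E1 t)) x + y2 t * metric M (\<gamma> t) (?R (E2 t)) x + y3 t * metric M (\<gamma> t) (?R (k t)) x"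
        by (simp add: sum3 y'_def E_def)
      also have "metric M (\<gamma> t) (?R (k t)) x = 0"
        using metric_lin(1)[OF zero_tangent zero_tangent x, of 0 0]
        unfolding jacobi_operator(3)[OF T(3,3,3)] by (simp add: zero_tvec_def)
      finally show ?thesis by simp
    qed
    have s21: "metric M (\<gamma> t) (?R (E2 t)) (E1 t) = metric M (\<gamma> t) (?R (E1 t)) (E2 t)"
      by (rule jacobi_operator(1)[OF T(2) T(1) T(3)])
    have RK: "metric M (\<gamma> t) (?R (J t)) (k t) = 0" by (rule jacobi_operator(2)[OF JT T(3,3)])
    show ?thesis
      \<comment> \<open>In the null frame the coefficient of \<open>N\<close> is the product with
        \<open>k\<close>, which is 0 by \<open>RK\<close>; the other three are the second
        derivatives in \<open>w'\<close>.\<close>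
      unfolding null_frame_expansion[OF F[OF t] RT[OF JT], of c] RK RJ[OF T(1)] RJ[OF T(2)] RJ[OF T(4)] s21
      by (simp add: sum3 w'_def E_def s h_def algebra_simps)
  qed
  note jf = jacobi_field_combination[OF A E dy dz J_def eq]
  have jac: "jacobi_field M I \<gamma> J" by (rule jf(1))
  have cov0: "cov_deriv_along M I \<gamma> J 0 = (\<lambda>c. \<Sum>i\<in>A. z' i 0 *\<^sub>R E i 0 c)" by (rule jf(2)[OF _ _ _ zero_in_I])
  have J0: "J 0 = (\<lambda>c. y1 0 *\<^sub>R E1 0 c + y2 0 *\<^sub>R E2 0 c)"
    unfolding J_def by (simp add: sum3 y'_def E_def y30)
  have eTP: "E1 0 \<in> TP" "E2 0 \<in> TP" and gram: "g (E1 0) (E1 0) = - 1" "g (E2 0) (E2 0) = - 1" "g (E1 0) (E2 0) = 0"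
    using on by (auto simp: orthonormal_basis_def)
  have gram': "g (E2 0) (E1 0) = 0" using metric_sym[OF TP_sub[OF eTP(1)] TP_sub[OF eTP(2)]] gram(3) by simp
  have J0T: "J 0 \<in> TP" unfolding J0 by (rule TP_lin[OF eTP])
  have k0T: "k 0 \<in> TM" using NP_sub[OF k0] .
  have "metric M (\<gamma> 0) (cov_deriv_along M I \<gamma> J 0) w = - g (II (J 0) w) (k 0)" if w: "w \<in> TP" for w
  proof -
    have "g (cov_deriv_along M I \<gamma> J 0) w = (\<Sum>i\<in>A. z' i 0 * g (E i 0) w)"
      unfolding cov0 by (rule metric_sum_left[OF A ET[OF zero_in_I] TP_sub[OF w]])
    also have "\<dots> = z1 0 * g (E1 0) w + z2 0 * g (E2 0) w + z3 0 * g (k 0) w"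
      by (simp add: sum3 z'_def E_def)
    also have "g (k 0) w = 0" by (rule NP_orth[OF k0 w])
    finally have L: "g (cov_deriv_along M I \<gamma> J 0) w = z1 0 * g w (E1 0) + z2 0 * g w (E2 0)"
      using metric_sym[OF TP_sub[OF w] TP_sub[OF eTP(1)]] metric_sym[OF TP_sub[OF w] TP_sub[OF eTP(2)]] by simp
    \<comment> \<open>The hypothesis \<open>z0\<close> covers only w = E1 0 and w = E2 0; symmetry
      and linearity of the second fundamental form extend it to all tangent vectors of
      \<open>P\<close>.\<close>
    have sw: "g (II v w) (k 0) = - g w (E1 0) * g (II v (E1 0)) (k 0) + - g w (E2 0) * g (II v (E2 0)) (k 0)" if v: "v \<in> TP" for v
    proof -
      have "g (II v w) (k 0) = g (II w v) (k 0)" by (rule second_fundamental_form_sym[OF v w k0])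
      also have "\<dots> = g (II (\<lambda>c. (- g w (E1 0)) *\<^sub>R E1 0 c + (- g w (E2 0)) *\<^sub>R E2 0 c) v) (k 0)"
        using TP_expansion[OF on w] by simp
      also have "\<dots> = - g w (E1 0) * g (II (E1 0) v) (k 0) + - g w (E2 0) * g (II (E2 0) v) (k 0)"
        by (rule second_fundamental_form_lin[OF eTP v k0])
      finally show ?thesis
        unfolding second_fundamental_form_sym[OF v eTP(1) k0] second_fundamental_form_sym[OF v eTP(2) k0] .
    qed
    have "g (II (J 0) w) (k 0) = y1 0 * g (II (E1 0) w) (k 0) + y2 0 * g (II (E2 0) w) (k 0)"
      unfolding J0 by (rule second_fundamental_form_lin[OF eTP w k0])
    then show ?thesis
      unfolding L sw[OF eTP(1)] sw[OF eTP(2)] z0 by (simp add: algebra_simps)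
  qed
  then have PJ: "P_jacobi_field M P I \<gamma> J"
    unfolding P_jacobi_field_def using jac J0T by blast
  have "J 0 \<noteq> zero_tvec"
  proof
    assume z: "J 0 = zero_tvec"
    have J0g: "g (J 0) x = y1 0 * g (E1 0) x + y2 0 * g (E2 0) x" if "x \<in> TM" for x
      unfolding J0 by (rule metric_lin(1)[OF TP_sub[OF eTP(1)] TP_sub[OF eTP(2)] that])
    have "g (J 0) x = 0" if "x \<in> TM" for x
      using z metric_sym[OF zero_tangent that] g_zero_right[OF that] by simp
    then have "y1 0 = 0" "y2 0 = 0"
      using J0g[OF TP_sub[OF eTP(1)]] J0g[OF TP_sub[OF eTP(2)]] TP_sub[OF eTP(1)] TP_sub[OF eTP(2)] gram gram' by auto
    then show False using ne by simp
  qed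
  moreover have "J t1 = zero_tvec"
    unfolding J_def zero_tvec_def by (simp add: sum3 y'_def t1 y30)
  ultimately show ?thesis
    unfolding focal_point_def using PJ t1 t1I zero_in_I by blast
qed

text \<open>Without focal points the determinant of the fundamental matrix of the plane system has
  no zero up to \<open>l\<close>, since a zero would yield a nontrivial combination vanishing
  there.\<close>

lemma no_focal_point_bound:
  assumes nf: "\<not> (\<exists>t\<in>{0..l}. focal_point M P I \<gamma> t)"
  shows "continuous_on I (\<lambda>t. ricci M (\<gamma> t) (k t) (k t))"
    "integral {0..l} (\<lambda>t. (1 - t / l)\<^sup>2 * ricci M (\<gamma> t) (k t) (k t)) < 2 * g (mean_normal_curvature M P (\<gamma> 0)) (k 0) + 2 / l"
proof -
  obtain e1 e2 where on: "orthonormal_basis M P (\<gamma> 0) e1 e2"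
    and mean: "\<And>n. n \<in> NP \<Longrightarrow> 2 * g (mean_normal_curvature M P (\<gamma> 0)) n = g (II e1 e1) n + g (II e2 e2) n"
    using mean_normal_curvature by metis
  obtain n where fr: "null_frame (\<gamma> 0) e1 e2 (k 0) n" using null_frame_exists[OF on k0 null nonzero] .
  then have T: "e1 \<in> TM" "e2 \<in> TM" "n \<in> TM" by (auto simp: null_frame_def)
  obtain E1 where E1: "E1 0 = e1" "parallel_on I E1" using parallel_transport[OF zero_in_I T(1)] .
  obtain E2 where E2: "E2 0 = e2" "parallel_on I E2" using parallel_transport[OF zero_in_I T(2)] .
  obtain N where N: "N 0 = n" "parallel_on I N" using parallel_transport[OF zero_in_I T(3)] .
  note V = E1(2) E2(2) N(2)
  have f: "null_frame (\<gamma> 0) (E1 0) (E2 0) (k 0) (N 0)" using fr by (simp add: E1 E2 N)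
  have on': "orthonormal_basis M P (\<gamma> 0) (E1 0) (E2 0)" using on by (simp add: E1 E2)
  have eTP: "E1 0 \<in> TP" "E2 0 \<in> TP" using on' by (auto simp: orthonormal_basis_def)
  define s where "s = (\<lambda>X Y t. - metric M (\<gamma> t) (riemann M (\<gamma> t) (X t) (k t) (k t)) (Y t))"
  have sc: "continuous_on I (s X Y)" if "parallel_on I X" "parallel_on I Y" for X Y
    unfolding s_def by (rule continuous_on_minus[OF continuous_curvature_component[OF that(1) parallel_velocity parallel_velocity that(2)]])
  have ric: "ricci M (\<gamma> t) (k t) (k t) = s E1 E1 t + s E2 E2 t" if "t \<in> I" for t
    using ricci_null_frame[OF null_frame_parallel[OF V f that]] by (simp add: s_def)
  show "continuous_on I (\<lambda>t. ricci M (\<gamma> t) (k t) (k t))"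
    by (rule continuous_on_eq[OF continuous_on_add[OF sc[OF V(1) V(1)] sc[OF V(2) V(2)]]]) (simp add: ric)
  let ?b = "\<lambda>x y. g (II (x 0) (y 0)) (k 0)"
  note c = sc[OF V(1) V(1)] sc[OF V(1) V(2)] sc[OF V(2) V(2)]
  \<comment> \<open>The first column of the fundamental matrix A. Here A(0) is the identity and
    A'(0) is the second fundamental form paired with \<open>k\<close>; the second column
    follows.\<close>
  obtain a b a1 b1 where ab: "a 0 = 1" "b 0 = 0" "a1 0 = ?b E1 E1" "b1 0 = ?b E1 E2"
    "\<And>t. t \<in> I \<Longrightarrow> (a has_real_derivative a1 t) (at t within I)"
    "\<And>t. t \<in> I \<Longrightarrow> (b has_real_derivative b1 t) (at t within I)"
    "\<And>t. t \<in> I \<Longrightarrow> (a1 has_real_derivative - (s E1 E1 t * a t + s E1 E2 t * b t)) (at t within I)"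
    "\<And>t. t \<in> I \<Longrightarrow> (b1 has_real_derivative - (s E1 E2 t * a t + s E2 E2 t * b t)) (at t within I)"
    using jacobi_system_solution[OF c zero_in_I, of 1 0 "?b E1 E1" "?b E1 E2"] by metis
  obtain c d c1 d1 where cd: "c 0 = 0" "d 0 = 1" "c1 0 = ?b E2 E1" "d1 0 = ?b E2 E2"
    "\<And>t. t \<in> I \<Longrightarrow> (c has_real_derivative c1 t) (at t within I)"
    "\<And>t. t \<in> I \<Longrightarrow> (d has_real_derivative d1 t) (at t within I)"
    "\<And>t. t \<in> I \<Longrightarrow> (c1 has_real_derivative - (s E1 E1 t * c t + s E1 E2 t * d t)) (at t within I)"
    "\<And>t. t \<in> I \<Longrightarrow> (d1 has_real_derivative - (s E1 E2 t * c t + s E2 E2 t * d t)) (at t within I)"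
    using jacobi_system_solution[OF c zero_in_I, of 0 1 "?b E2 E1" "?b E2 E2"] by metis
  have nz: "a t * d t - b t * c t \<noteq> 0" if t: "t \<in> {0..l}" for t
  proof
    assume det: "a t * d t - b t * c t = 0"
    then have "t \<noteq> 0" using ab(1,2) cd(1,2) by auto
    then have t': "0 < t" "t \<le> l" using t by auto
    obtain x y where xy: "x \<noteq> 0 \<or> y \<noteq> 0" "x * a t + y * c t = 0" "x * b t + y * d t = 0"
      using kernel_of_singular_2x2[OF det] .
    have "focal_point M P I \<gamma> t"
    proof (rule focal_point_of_degenerate_solution[where ?E1.0=E1 and ?E2.0=E2 and N=N and s=s and ?y1.0="\<lambda>t. x * a t + y * c t" and ?y2.0="\<lambda>t. x * b t + y * d t"
            and ?z1.0="\<lambda>t. x * a1 t + y * c1 t" and ?z2.0="\<lambda>t. x * b1 t + y * d1 t", OF V f on'])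
      show "s X Y t = - metric M (\<gamma> t) (riemann M (\<gamma> t) (X t) (k t) (k t)) (Y t)" for X Y t
        by (simp add: s_def)
    next
      fix r assume r: "r \<in> I"
      show "((\<lambda>t. x * a t + y * c t) has_real_derivative x * a1 r + y * c1 r) (at r within I)"
        by (intro DERIV_add DERIV_cmult ab(5) cd(5) r)
      show "((\<lambda>t. x * b t + y * d t) has_real_derivative x * b1 r + y * d1 r) (at r within I)"
        by (intro DERIV_add DERIV_cmult ab(6) cd(6) r)
      have "((\<lambda>t. x * a1 t + y * c1 t) has_real_derivative x * - (s E1 E1 r * a r + s E1 E2 r * b r) + y * - (s E1 E1 r * c r + s E1 E2 r * d r)) (at r within I)"
        by (intro DERIV_add DERIV_cmult ab(7) cd(7) r)
      then show "((\<lambda>t. x * a1 t + y * c1 t) has_real_derivative - (s E1 E1 r * (x * a r + y * c r) + s E1 E2 r * (x * b r + y * d r))) (at r within I)"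
        by (simp add: algebra_simps)
      have "((\<lambda>t. x * b1 t + y * d1 t) has_real_derivative x * - (s E1 E2 r * a r + s E2 E2 r * b r) + y * - (s E1 E2 r * c r + s E2 E2 r * d r)) (at r within I)"
        by (intro DERIV_add DERIV_cmult ab(8) cd(8) r)
      then show "((\<lambda>t. x * b1 t + y * d1 t) has_real_derivative - (s E1 E2 r * (x * a r + y * c r) + s E2 E2 r * (x * b r + y * d r))) (at r within I)"
        by (simp add: algebra_simps)
    qed (use xy(1) in \<open>simp_all add: ab(1-4) cd(1-4) xy(2,3) t'\<close>)
    then show False using nf t by blast
  qed
  have sub: "{0..l} \<subseteq> I" using l0 by auto
  have I: "t \<in> I" if "t \<in> {0..l}" for t using sub that by blast
  note w = DERIV_subset[OF _ sub]
  \<comment> \<open>Symmetry of the second fundamental form is the initial symmetry that makes the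
    Wronskian vanish.\<close>
  have b12: "b1 0 = c1 0" unfolding ab(4) cd(3) by (rule second_fundamental_form_sym[OF eTP k0])
  have "integral {0..l} (\<lambda>t. (1 - t / l)\<^sup>2 * (s E1 E1 t + s E2 E2 t)) < a1 0 + d1 0 + 2 / l"
    by (rule jacobi_determinant_bound[OF l w[OF ab(5)] w[OF ab(6)] w[OF cd(5)] w[OF cd(6)]
          w[OF ab(7)] w[OF ab(8)] w[OF cd(7)] w[OF cd(8)] ab(1,2) cd(1,2) b12
          continuous_on_subset[OF sc[OF V(1) V(1)] sub] continuous_on_subset[OF sc[OF V(2) V(2)] sub] nz]) (erule I)+
  also have "a1 0 + d1 0 = 2 * g (mean_normal_curvature M P (\<gamma> 0)) (k 0)"
    using mean[OF k0] by (simp add: ab(3) cd(4) E1 E2)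
  also have "integral {0..l} (\<lambda>t. (1 - t / l)\<^sup>2 * (s E1 E1 t + s E2 E2 t)) = integral {0..l} (\<lambda>t. (1 - t / l)\<^sup>2 * ricci M (\<gamma> t) (k t) (k t))"
    by (rule integral_cong) (simp add: ric[OF I])
  finally show "integral {0..l} (\<lambda>t. (1 - t / l)\<^sup>2 * ricci M (\<gamma> t) (k t) (k t)) < 2 * g (mean_normal_curvature M P (\<gamma> 0)) (k 0) + 2 / l" .
qed

end

text \<open>\<open>GREATEST\<close> denotes an upper bound only if it is attained, which compactness
  and continuity ensure.\<close>

lemma Greatest_image_Icc:
  fixes f :: "real \<Rightarrow> real"
  assumes "a \<le> b" "continuous_on {a..b} f" "t \<in> {a..b}"
  shows "f t \<le> (GREATEST r. r \<in> f ` {a..b})"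
proof -
  obtain m where m: "m \<in> {a..b}" "\<And>s. s \<in> {a..b} \<Longrightarrow> f s \<le> f m"
    using continuous_attains_sup[OF compact_Icc _ assms(2)] assms(1) by (metis atLeastatMost_empty_iff2 not_less)
  have "(GREATEST r. r \<in> f ` {a..b}) = f m"
    by (rule Greatest_equality) (use m in auto)
  then show ?thesis using m(2)[OF assms(3)] by simp
qed

text \<open>The quotient decreases in x, so the least value sits at the right end.\<close>

lemma Least_inverse:
  fixes c l :: real
  assumes "0 < c" "0 < l"
  shows "(LEAST m. m \<in> (\<lambda>x. c / x) ` {0<..l}) = c / l"
  by (rule Least_equality) (use assms in \<open>auto intro: divide_left_mono\<close>)

text \<open>The interval is open at 0 and \<open>c\<close> may have either sign. As Q / x blows up
  at 0, the minimum can be sought on a compact interval away from 0.\<close>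

lemma Least_inverse_plus_linear:
  fixes Q c l :: real
  assumes Q: "0 < Q" and l: "0 < l"
  obtains x where "0 < x" "x \<le> l" "(LEAST m. m \<in> (\<lambda>x. Q / x + c * x) ` {0<..l}) = Q / x + c * x"
proof -
  let ?f = "\<lambda>x. Q / x + c * x"
  \<comment> \<open>Below Q / K the term Q / y exceeds K, which leaves more than the value at
    \<open>l\<close> even after the linear term, of size at most \<bar>c\<bar> l, is
    subtracted.\<close>
  define K where "K = \<bar>?f l\<bar> + \<bar>c\<bar> * l + 1"
  define \<delta> where "\<delta> = min l (Q / K)"
  have K: "K > 0" unfolding K_def using l by (intro add_nonneg_pos add_nonneg_nonneg) auto
  have \<delta>: "0 < \<delta>" "\<delta> \<le> l" using Q K l by (auto simp: \<delta>_def)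
  have "continuous_on {\<delta>..l} ?f" using \<delta> by (intro continuous_intros) auto
  from continuous_attains_inf[OF compact_Icc _ this] \<delta>
  obtain x where x: "x \<in> {\<delta>..l}" "\<And>y. y \<in> {\<delta>..l} \<Longrightarrow> ?f x \<le> ?f y" by auto
  have min: "?f x \<le> ?f y" if y: "0 < y" "y \<le> l" for y
  proof (cases "\<delta> \<le> y")
    case True then show ?thesis using x(2) y by simp
  next
    case False
    then have "y < Q / K" using y by (simp add: \<delta>_def)
    then have "K < Q / y" using y K by (simp add: field_simps)
    moreover have "\<bar>c * y\<bar> \<le> \<bar>c\<bar> * l" using y by (simp add: abs_mult mult_left_mono)
    moreover have "?f x \<le> ?f l" using x(2)[of l] \<delta> by simp
    ultimately show ?thesis unfolding K_def by linarith
  qed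
  have "(LEAST m. m \<in> ?f ` {0<..l}) = ?f x"
    by (rule Least_equality) (use min x \<delta> in auto)
  then show thesis using that[of x] x \<delta> by auto
qed

theorem lemma4p2:
  fixes M :: "'a::{t2_space, second_countable_topology} lorentz_structure"
    and P :: "'a set"
    and H :: "'a \<Rightarrow> real" and Hhat :: "'a \<Rightarrow> 'a tvec"
    and \<gamma> :: "real \<Rightarrow> 'a" and Hpar k :: "real \<Rightarrow> 'a tvec"
    and \<rho> Lhat1 Lhat2 :: "real \<Rightarrow> real"
    and l l0 \<rho>max B Q1 L1 L2 :: real
  assumes "spacetime M"
    and "spacelike_submanifold_codim2 M P"
    and "achronal M P"
    and "future_converging M P"
    and "\<forall>p\<in>P. future_timelike M p (Hhat p) \<and> metric M p (Hhat p) (Hhat p) = 1"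
    and "\<forall>p\<in>P. mean_normal_curvature M P p = (\<lambda>c. H p *\<^sub>R Hhat p c)"
    and "l > 0" and "l0 > 0"
    and "future_null_geodesic M {-l0..l} \<gamma>"
    and "k = velocity M {-l0..l} \<gamma>"
    and "\<gamma> 0 \<in> P" and "k 0 \<in> sub_normal_space M P (\<gamma> 0)"
    and "parallel_along M {-l0..l} \<gamma> Hpar" and "Hpar 0 = Hhat (\<gamma> 0)"
    and "\<forall>t\<in>{-l0..l}. metric M (\<gamma> t) (Hpar t) (k t) = 1"
    and "\<rho> = (\<lambda>t. ricci M (\<gamma> t) (k t) (k t))"
    and "\<rho>max = (GREATEST r. r \<in> \<rho> ` {-l0..0})"
    and "B > 0" and "Q1 = 32 * pi * B"
    and "\<forall>g :: real \<Rightarrow> real. g C1_differentiable_on UNIV \<longrightarrow>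
           compact (closure {t. g t \<noteq> 0}) \<longrightarrow> closure {t. g t \<noteq> 0} \<subseteq> {-l0<..<l} \<longrightarrow>
           integral {-l0..l} (\<lambda>t. (g t)\<^sup>2 * \<rho> t) \<ge> - Q1 * integral {-l0..l} (\<lambda>t. (deriv g t)\<^sup>2)"
    and "Lhat1 = (\<lambda>x. (Q1 + 2) / x)"
    and "Lhat2 = (\<lambda>x. Q1 / x + 1/3 * \<rho>max * x)"
    and "L1 = (LEAST m. m \<in> Lhat1 ` {0<..l})"
    and "L2 = (LEAST m. m \<in> Lhat2 ` {0<..l0})"
    and "- 2 * H (\<gamma> 0) \<ge> L1 + L2"
  shows "\<exists>t\<in>{0..l}. focal_point M P {-l0..l} \<gamma> t"
proof (rule ccontr)
  assume nf: "\<not> ?thesis"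
  have atl: "maximal_smooth_atlas (atlas M)" and lor: "lorentzian_metric M"
    and tf: "time_field M q \<in> tangent_space M q" for q
    using assms(1) by (auto simp: spacetime_def smooth_vector_field_on_def)
  have zI: "0 \<in> {- l0..l}" using assms(7,8) by simp
  have kv: "velocity M {- l0..l} \<gamma> = k" using assms(10) by simp
  have k0: "future_null M (\<gamma> 0) (k 0)" using assms(9) zI by (simp add: future_null_geodesic_def kv)
  interpret lorentz_manifold M by unfold_locales (fact atl lor)+
  \<comment> \<open>A future-directed vector has positive product with the time orientation, which
    excludes zero.\<close>
  have "k 0 \<noteq> zero_tvec"
  proof
    assume "k 0 = zero_tvec"
    moreover have "metric M (\<gamma> 0) (time_field M (\<gamma> 0)) zero_tvec = 0"
      using metric_lin(2)[OF zero_tangent zero_tangent tf[of "\<gamma> 0"], of 0 0] by (simp add: zero_tvec_def)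
    ultimately show False using k0 by (simp add: future_null_def)
  qed
  then interpret null_normal_geodesic M \<gamma> l0 l P
    using assms(2,7-9,11,12) k0 by unfold_locales (simp_all add: kv future_null_geodesic_def future_null_def)
  have \<rho>c: "continuous_on {- l0..l} \<rho>"
    using no_focal_point_bound(1)[OF nf] unfolding assms(16) kv .
  have "integral {0..l} (\<lambda>t. (1 - t / l)\<^sup>2 * \<rho> t) < 2 * metric M (\<gamma> 0) (mean_normal_curvature M P (\<gamma> 0)) (k 0) + 2 / l"
    using no_focal_point_bound(2)[OF nf] unfolding assms(16) kv .
  \<comment> \<open>The normalization of the affine parameter enters here: the product of
    \<open>Hhat\<close> with \<open>k\<close> at 0 is 1, which leaves the factor
    \<open>H\<close>.\<close>
  also have "metric M (\<gamma> 0) (mean_normal_curvature M P (\<gamma> 0)) (k 0) = H (\<gamma> 0)"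
  proof -
    have h: "Hhat (\<gamma> 0) \<in> tangent_space M (\<gamma> 0)" using assms(5,11) by (simp add: future_timelike_def)
    have "metric M (\<gamma> 0) (Hhat (\<gamma> 0)) (k 0) = 1" using assms(14,15) zI by fastforce
    then show ?thesis
      using metric_lin(1)[OF h h NP_sub[OF assms(12)], of "H (\<gamma> 0)" 0] assms(6,11) by simp
  qed
  finally have ray: "integral {0..l} (\<lambda>t. (1 - t / l)\<^sup>2 * \<rho> t) < 2 * H (\<gamma> 0) + 2 / l" .
  have Q: "Q1 > 0" using assms(18,19) by simp
  \<comment> \<open>\<open>L\<close> is a minimizer of \<open>Lhat2\<close>, used as the left
    half-width of the tent.\<close>
  obtain L where L: "0 < L" "L \<le> l0" "L2 = Q1 / L + 1/3 * \<rho>max * L"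
    using Least_inverse_plus_linear[OF Q assms(8), of "1/3 * \<rho>max"] unfolding assms(22,24) by metis
  have L1: "L1 = (Q1 + 2) / l"
    unfolding assms(21,23) by (rule Least_inverse) (use Q assms(7) in simp_all)
  have "- Q1 * (1 / L + 1 / l) \<le> integral {- L..0} (\<lambda>t. (1 + t / L)\<^sup>2 * \<rho> t) + integral {0..l} (\<lambda>t. (1 - t / l)\<^sup>2 * \<rho> t)"
    by (rule tent_test_function[OF L(1,2) assms(7) \<rho>c]) (use assms(20) in blast)
  moreover have "integral {- L..0} (\<lambda>t. (1 + t / L)\<^sup>2 * \<rho> t) \<le> \<rho>max * L / 3"
  proof (rule integral_tent_left_le[OF L(1)])
    show "continuous_on {- L..0} \<rho>" by (rule continuous_on_subset[OF \<rho>c]) (use L assms(7) in auto)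
    fix t assume "t \<in> {- L..0}"
    then have "t \<in> {- l0..0}" using L(2) by simp
    moreover have "continuous_on {- l0..0} \<rho>" by (rule continuous_on_subset[OF \<rho>c]) (use assms(7) in auto)
    \<comment> \<open>The maximum over the whole left interval also bounds \<rho> on the part from -
      L to 0.\<close>
    ultimately show "\<rho> t \<le> \<rho>max" unfolding assms(17) using assms(8) by (intro Greatest_image_Icc) auto
  qed
  \<comment> \<open>Collects the tent energy, the term 2 / l and the bound for the left half into
    exactly \<open>L1 + L2\<close>; with the strict estimate \<open>ray\<close> this contradicts the
    hypothesis on \<open>H\<close>.\<close>
  moreover have "Q1 * (1 / L + 1 / l) + 2 / l + \<rho>max * L / 3 = L1 + L2"
    unfolding L1 L(3) by (simp add: add_divide_distrib algebra_simps)
  ultimately show False using ray assms(25) by linarith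
qed

end
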